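(* Let $\mathrm{C} \in \{\text{Regular}, \text{CF}, \text{CS}, \text{RE}\}$. The class of epiC groups is closed under graph products of finitely many groups and under extensions. That is: (i) if $\Gamma$ is a finite simple graph and $G_v$ is an epiC group for each vertex $v$ of $\Gamma$, then the graph product of the groups $G_v$ over $\Gamma$ is epiC; (ii) if $E$ is a group with a normal subgroup $N$ such that $N$ and $E/N$ are both epiC, then $E$ is epiC.
   Context: For a set $X$, $X^*$ denotes the set of all finite strings over $X$, including the empty string. The language classes are the standard Chomsky classes: Regular (accepted by a finite state automaton), CF = context-free (accepted by a pushdown automaton), CS = context-sensitive (accepted by a linearly bounded automaton), RE = recursively enumerable (accepted by a Turing machine). For a group $G$ and $X\subseteq G$, and $w\in X^*$, $g\in G$, write $w=_G g$ if the product in $G$ of the letters of $w$ equals $g$. A group $G$ is epiC if there are a finite set $X\subseteq G$ generating $G$ as a monoid and a language $L\subseteq X^*$ in the class C such that no $w\in L$ satisfies $w=_G 1_G$, and for every $h\in G\setminus\{1_G\}$ there is $w_h\in L$ with $w_h=_G h$. Graph product: given a finite simple graph $\Gamma$ with vertex set $V$ and edge set $E(\Gamma)$ and groups $G_v=\langle X_v\mid R_v\rangle$ ($v\in V$, pairwise disjoint as sets), the graph product is the group with generating set $\bigsqcup_{v}X_v$ and relators $\bigsqcup_v R_v$ together with the commutators $[x_v,x_w]$ for all $x_v\in X_v$, $x_w\in X_w$ with $\{v,w\}\in E(\Gamma)$. *)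

theory Defs
  imports "HOL-Algebra.Coset"
begin

text \<open>
  All automata are nondeterministic. They are polymorphic in the types of states and of auxiliary
  symbols; the language classes quantify over machines in which these types are \<^typ>\<open>nat\<close>, which
  is no restriction because the sets of states and of symbols are finite.
\<close>

record ('q, 'a) fsa =
  fsa_states :: "'q set"
  fsa_start  :: 'q
  fsa_final  :: "'q set"
  fsa_trans  :: "('q \<times> 'a option \<times> 'q) set"  \<comment> \<open>letter \<^const>\<open>None\<close>: the empty word\<close>

definition fsa_over :: "'a set \<Rightarrow> ('q, 'a) fsa \<Rightarrow> bool" where
  "fsa_over X M \<longleftrightarrow>
     finite (fsa_states M) \<and> fsa_start M \<in> fsa_states M \<and> fsa_final M \<subseteq> fsa_states M \<and>
     fsa_trans M \<subseteq> fsa_states M \<times> insert None (Some ` X) \<times> fsa_states M"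

inductive fsa_step :: "('q, 'a) fsa \<Rightarrow> 'q \<times> 'a list \<Rightarrow> 'q \<times> 'a list \<Rightarrow> bool" for M where
  "(p, Some a, q) \<in> fsa_trans M \<Longrightarrow> fsa_step M (p, a # w) (q, w)"
| "(p, None, q) \<in> fsa_trans M \<Longrightarrow> fsa_step M (p, w) (q, w)"

definition fsa_lang :: "'a set \<Rightarrow> ('q, 'a) fsa \<Rightarrow> 'a list set" where
  "fsa_lang X M =
     {w \<in> lists X. \<exists>q\<in>fsa_final M. (fsa_step M)\<^sup>*\<^sup>* (fsa_start M, w) (q, [])}"


record ('q, 'a, 'g) pda =
  pda_states :: "'q set"
  pda_stack  :: "'g set"
  pda_start  :: 'q
  pda_bottom :: 'g  \<comment> \<open>initial stack symbol\<close>
  pda_final  :: "'q set"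
  pda_trans  :: "('q \<times> 'a option \<times> 'g \<times> 'q \<times> 'g list) set"

definition pda_over :: "'a set \<Rightarrow> ('q, 'a, 'g) pda \<Rightarrow> bool" where
  "pda_over X M \<longleftrightarrow>
     finite (pda_states M) \<and> finite (pda_stack M) \<and>
     pda_start M \<in> pda_states M \<and> pda_bottom M \<in> pda_stack M \<and> pda_final M \<subseteq> pda_states M \<and>
     finite (pda_trans M) \<and>
     pda_trans M \<subseteq> pda_states M \<times> insert None (Some ` X) \<times> pda_stack M \<times>
                   pda_states M \<times> lists (pda_stack M)"

text \<open>Configurations: state, remaining input, stack with its top first.\<close>

inductive pda_step ::
  "('q, 'a, 'g) pda \<Rightarrow> 'q \<times> 'a list \<times> 'g list \<Rightarrow> 'q \<times> 'a list \<times> 'g list \<Rightarrow> bool" for M where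
  "(p, Some a, Z, q, zs) \<in> pda_trans M \<Longrightarrow> pda_step M (p, a # w, Z # s) (q, w, zs @ s)"
| "(p, None, Z, q, zs) \<in> pda_trans M \<Longrightarrow> pda_step M (p, w, Z # s) (q, w, zs @ s)"

definition pda_lang :: "'a set \<Rightarrow> ('q, 'a, 'g) pda \<Rightarrow> 'a list set" where
  "pda_lang X M =
     {w \<in> lists X. \<exists>q\<in>pda_final M. \<exists>s.
        (pda_step M)\<^sup>*\<^sup>* (pda_start M, w, [pda_bottom M]) (q, [], s)}"


datatype ('a, 'g) cell = Letter 'a | Work 'g | Blank | LeftEnd | RightEnd

datatype move = MoveLeft | Stay | MoveRight

record ('q, 'a, 'g) tm =
  tm_states :: "'q set"
  tm_tape   :: "('a, 'g) cell set"
  tm_start  :: 'q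
  tm_final  :: "'q set"
  tm_trans  :: "('q \<times> ('a, 'g) cell \<times> 'q \<times> ('a, 'g) cell \<times> move) set"

definition tm_over :: "'a set \<Rightarrow> ('q, 'a, 'g) tm \<Rightarrow> bool" where
  "tm_over X M \<longleftrightarrow>
     finite (tm_states M) \<and> finite (tm_tape M) \<and> Letter ` X \<union> {Blank} \<subseteq> tm_tape M \<and>
     tm_start M \<in> tm_states M \<and> tm_final M \<subseteq> tm_states M \<and>
     tm_trans M \<subseteq> tm_states M \<times> tm_tape M \<times> tm_states M \<times> tm_tape M \<times> UNIV"

text \<open>
  A configuration \<open>(l, q, r)\<close> describes a tape that is infinite in both directions: \<open>l\<close> lists the
  cells to the left of the head, nearest first, \<open>r\<close> lists the scanned cell and those to its right,
  and all further cells are blank.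
\<close>

definition scan :: "('a, 'g) cell list \<Rightarrow> ('a, 'g) cell" where
  "scan cs = (case cs of [] \<Rightarrow> Blank | c # _ \<Rightarrow> c)"

inductive tm_step ::
  "('q, 'a, 'g) tm \<Rightarrow> ('a, 'g) cell list \<times> 'q \<times> ('a, 'g) cell list
     \<Rightarrow> ('a, 'g) cell list \<times> 'q \<times> ('a, 'g) cell list \<Rightarrow> bool" for M where
  "(p, scan r, q, b, MoveLeft) \<in> tm_trans M \<Longrightarrow> tm_step M (l, p, r) (tl l, q, scan l # b # tl r)"
| "(p, scan r, q, b, Stay) \<in> tm_trans M \<Longrightarrow> tm_step M (l, p, r) (l, q, b # tl r)"
| "(p, scan r, q, b, MoveRight) \<in> tm_trans M \<Longrightarrow> tm_step M (l, p, r) (b # l, q, tl r)"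

definition tm_lang :: "'a set \<Rightarrow> ('q, 'a, 'g) tm \<Rightarrow> 'a list set" where
  "tm_lang X M =
     {w \<in> lists X. \<exists>q\<in>tm_final M. \<exists>l r.
        (tm_step M)\<^sup>*\<^sup>* ([], tm_start M, map Letter w) (l, q, r)}"

text \<open>
  A linearly bounded automaton is a Turing machine whose input is delimited by two endmarkers. It
  can neither write endmarkers nor overwrite them nor move beyond them, so that its head stays on
  the portion of the tape occupied by the input and the endmarkers.
\<close>

definition lba_over :: "'a set \<Rightarrow> ('q, 'a, 'g) tm \<Rightarrow> bool" where
  "lba_over X M \<longleftrightarrow> tm_over X M \<and> {LeftEnd, RightEnd} \<subseteq> tm_tape M \<and>
     (\<forall>(p, a, q, b, m) \<in> tm_trans M.
        (a = LeftEnd \<longleftrightarrow> b = LeftEnd) \<and> (a = RightEnd \<longleftrightarrow> b = RightEnd) \<and>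
        (a = LeftEnd \<longrightarrow> m \<noteq> MoveLeft) \<and> (a = RightEnd \<longrightarrow> m \<noteq> MoveRight))"

definition lba_lang :: "'a set \<Rightarrow> ('q, 'a, 'g) tm \<Rightarrow> 'a list set" where
  "lba_lang X M =
     {w \<in> lists X. \<exists>q\<in>tm_final M. \<exists>l r.
        (tm_step M)\<^sup>*\<^sup>* ([], tm_start M, LeftEnd # map Letter w @ [RightEnd]) (l, q, r)}"


datatype chomsky = Regular | CF | CS | RE

text \<open>The languages of a given class over the alphabet \<open>X\<close>.\<close>

fun languages :: "chomsky \<Rightarrow> 'a set \<Rightarrow> 'a list set set" where
  "languages Regular X = {fsa_lang X M | M :: (nat, 'a) fsa. fsa_over X M}"
| "languages CF X = {pda_lang X M | M :: (nat, 'a, nat) pda. pda_over X M}"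
| "languages CS X = {lba_lang X M | M :: (nat, 'a, nat) tm. lba_over X M}"
| "languages RE X = {tm_lang X M | M :: (nat, 'a, nat) tm. tm_over X M}"


definition word_val :: "('a, 'm) monoid_scheme \<Rightarrow> 'a list \<Rightarrow> 'a" where
  "word_val G w = foldr (\<otimes>\<^bsub>G\<^esub>) w \<one>\<^bsub>G\<^esub>"

definition epiC :: "chomsky \<Rightarrow> ('a, 'm) monoid_scheme \<Rightarrow> bool" where
  "epiC C G \<longleftrightarrow> group G \<and>
     (\<exists>X L. finite X \<and> X \<subseteq> carrier G \<and> word_val G ` lists X = carrier G \<and>
        L \<subseteq> lists X \<and> L \<in> languages C X \<and>
        (\<forall>w\<in>L. word_val G w \<noteq> \<one>\<^bsub>G\<^esub>) \<and>
        (\<forall>h\<in>carrier G - {\<one>\<^bsub>G\<^esub>}. \<exists>w\<in>L. word_val G w = h))"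


text \<open>
  Group words over \<open>X\<close> are lists over \<open>X \<times> UNIV\<close>, where \<open>(x, True)\<close> stands for the generator \<open>x\<close>
  and \<open>(x, False)\<close> for its formal inverse. Two words represent the same element of the group
  with presentation \<open>\<langle>X | R\<rangle>\<close> iff they are related by inserting and deleting relators and mutually
  inverse pairs of letters.
\<close>

type_synonym 'x group_word = "('x \<times> bool) list"

abbreviation group_words :: "'x set \<Rightarrow> 'x group_word set" where
  "group_words X \<equiv> lists (X \<times> UNIV)"

inductive pres_eq :: "'x set \<Rightarrow> 'x group_word set \<Rightarrow> 'x group_word \<Rightarrow> 'x group_word \<Rightarrow> bool"
  for X R where
  refl: "w \<in> group_words X \<Longrightarrow> pres_eq X R w w"
| sym: "pres_eq X R u w \<Longrightarrow> pres_eq X R w u"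
| trans: "pres_eq X R u v \<Longrightarrow> pres_eq X R v w \<Longrightarrow> pres_eq X R u w"
| cancel: "u \<in> group_words X \<Longrightarrow> w \<in> group_words X \<Longrightarrow> x \<in> X \<Longrightarrow>
    pres_eq X R (u @ [(x, b), (x, \<not> b)] @ w) (u @ w)"
| relator: "u \<in> group_words X \<Longrightarrow> w \<in> group_words X \<Longrightarrow> r \<in> R \<Longrightarrow>
    pres_eq X R (u @ r @ w) (u @ w)"

text \<open>This is meaningful for \<open>R \<subseteq> group_words X\<close> only.\<close>

definition presented_group :: "'x set \<Rightarrow> 'x group_word set \<Rightarrow> 'x group_word set monoid" where
  "presented_group X R =
     \<lparr>carrier = group_words X // {(u, w). pres_eq X R u w},
      mult = (\<lambda>A B. {w. \<exists>a\<in>A. \<exists>b\<in>B. pres_eq X R (a @ b) w}),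
      one = {w. pres_eq X R [] w}\<rparr>"


definition finite_simple_graph :: "'v set \<Rightarrow> 'v set set \<Rightarrow> bool" where
  "finite_simple_graph V E \<longleftrightarrow> finite V \<and> E \<subseteq> {{v, w} | v w. v \<in> V \<and> w \<in> V \<and> v \<noteq> w}"

text \<open>
  The generating sets \<open>X v\<close> are made disjoint by tagging each generator with its vertex.
\<close>

definition tag_word :: "'v \<Rightarrow> 'x group_word \<Rightarrow> ('v \<times> 'x) group_word" where
  "tag_word v w = map (\<lambda>(x, b). ((v, x), b)) w"

definition commutator_word :: "'x \<Rightarrow> 'x \<Rightarrow> 'x group_word" where
  "commutator_word x y = [(x, True), (y, True), (x, False), (y, False)]"

definition graph_product ::
  "'v set \<Rightarrow> 'v set set \<Rightarrow> ('v \<Rightarrow> 'x set) \<Rightarrow> ('v \<Rightarrow> 'x group_word set)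
     \<Rightarrow> ('v \<times> 'x) group_word set monoid" where
  "graph_product V E X R =
     presented_group (Sigma V X)
       ((\<Union>v\<in>V. tag_word v ` R v) \<union>
        {commutator_word (v, x) (w, y) | v w x y.
           v \<in> V \<and> w \<in> V \<and> {v, w} \<in> E \<and> x \<in> X v \<and> y \<in> X w})"

end

theory Submission
  imports Defs
begin

text \<open>
  Write a group element as a product of pieces whose nontriviality can be certified separately. If
  every piece is a word of one of the given languages and the shape of the product is controlled by
  a finite automaton, then the words obtained form a language of the given class, because each of
  the four classes is closed under substituting languages that do not contain the empty word into a
  regular language, followed by letter-to-letter maps (\<open>languages_subst\<close>). A word of a language that
  certifies an epiC group is never empty, since the empty word represents the identity.

  Extensions (\<open>epiC_extension\<close>): let \<open>K\<close> and \<open>L\<close> be the languages of \<open>N\<close> and \<open>E/N\<close>, and let \<open>s\<close>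
  choose a representative of each coset. The language \<open>K \<union> s(L) \<union> K s(L)\<close> has the required
  properties: its words outside \<open>K\<close> represent nontrivial elements of \<open>E/N\<close>, and an element of
  \<open>E - N\<close> equals \<open>n x\<close> where \<open>x\<close> is the value of a word of \<open>s(L)\<close> in its coset and \<open>n \<in> N\<close> is either
  trivial or the value of a word of \<open>K\<close>.

  Graph products (\<open>epiC_graph_product\<close>): every element is a product of syllables, nontrivial elements
  of the vertex groups. A sequence of syllables is reduced if no syllable can be moved next to an
  earlier one of the same vertex by exchanging syllables of adjacent vertices. Reducedness depends
  on the sequence of vertices only, and a finite automaton decides it: its state is the set of
  exposed vertices, those with a syllable that can be moved to the end. Merging syllables shows that
  every element has a reduced expression (\<open>reduced_form\<close>). Conversely, a nonempty reduced sequence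
  represents a nontrivial element (\<open>reduced_word_nontrivial\<close>). To see this, let the graph product
  act on pilings: there is one stack for each vertex, and a syllable puts itself on the stack of its
  vertex and a blank marker on the stack of each vertex that is not adjacent to it. A reduced
  sequence only ever pushes, so it moves the empty piling to a nonempty one.

  Substitution closure is shown by a machine that guesses a factorization of its input and
  runs the given machines on the factors one after another. Finite automata and pushdown automata
  do this directly. A linearly bounded automaton has no room for endmarkers between the factors,
  so the first and the last cell of the factor being processed are marked, and the visits of the
  head to the endmarkers are remembered in the state (\<open>lba_subst\<close>). The factors of a recursively
  enumerable language would need unbounded space on a shared tape. Such a language therefore is
  first replaced by a context-sensitive language whose words provide the space as occurrences of a
  padding letter (\<open>recursively_enumerable_padding\<close>); after the substitution the padding is erased,
  which a Turing machine undoes by guessing where it has been (\<open>recursively_enumerable_erase\<close>).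
\<close>

section \<open>Substituting languages into a regular language\<close>

text \<open>
  \<open>path_lang D K s w t\<close>: some path from \<open>s\<close> to \<open>t\<close> in the edge-labelled graph \<open>D\<close> spells \<open>w\<close> when each
  label \<open>v\<close> is replaced by a word of \<open>K v\<close>. Paths grow at their end, the order in which machines
  process them.
\<close>

inductive path_lang :: "('s \<times> 'v \<times> 's) set \<Rightarrow> ('v \<Rightarrow> 'b list set) \<Rightarrow> 's \<Rightarrow> 'b list \<Rightarrow> 's \<Rightarrow> bool"
  for D K s where
  Nil: "path_lang D K s [] s"
| Snoc: "path_lang D K s u t \<Longrightarrow> (t, v, t') \<in> D \<Longrightarrow> x \<in> K v \<Longrightarrow> path_lang D K s (u @ x) t'"

definition subst_lang :: "('s \<times> 'v \<times> 's) set \<Rightarrow> ('v \<Rightarrow> 'b list set) \<Rightarrow> 's \<Rightarrow> 's set \<Rightarrow> 'b list set" where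
  "subst_lang D K s F = {w. \<exists>t\<in>F. path_lang D K s w t}"

lemma path_lang_lists:
  "path_lang D K s w t \<Longrightarrow> (\<And>s v t. (s, v, t) \<in> D \<Longrightarrow> K v \<subseteq> lists Y) \<Longrightarrow> w \<in> lists Y"
  by (induction rule: path_lang.induct) (auto, blast)

lemma map_option_letters:
  "f ` X \<subseteq> Y \<Longrightarrow> a \<in> insert None (Some ` X) \<Longrightarrow> map_option f a \<in> insert None (Some ` Y)"
  by (cases a) auto

lemma map_in_lists: "f ` X \<subseteq> Y \<Longrightarrow> w \<in> lists X \<Longrightarrow> map f w \<in> lists Y"
  by (simp add: in_lists_conv_set image_subset_iff)

section \<open>Finite automata\<close>

lemma fsa_step_append: "fsa_step M (p, x) (q, y) \<Longrightarrow> fsa_step M (p, x @ z) (q, y @ z)"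
  by (erule fsa_step.cases) (auto intro: fsa_step.intros)

lemma fsa_steps_append:
  "(fsa_step M)\<^sup>*\<^sup>* (p, x) (q, y) \<Longrightarrow> (fsa_step M)\<^sup>*\<^sup>* (p, x @ z) (q, y @ z)"
  by (induction "(p, x)" "(q, y)" arbitrary: q y rule: rtranclp.induct)
     (auto intro: fsa_step_append rtranclp.rtrancl_into_rtrancl)

text \<open>
  Both kinds of moves at once; they differ only in the consumed prefix.
\<close>

lemma fsa_step_iff:
  "fsa_step M (p, x) (q, y) \<longleftrightarrow>
     (\<exists>a. (p, a, q) \<in> fsa_trans M \<and> x = (case a of None \<Rightarrow> [] | Some b \<Rightarrow> [b]) @ y)" (is "?l \<longleftrightarrow> ?r")
proof
  assume ?l
  then show ?r by cases force+
next
  assume ?r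
  then obtain a where "(p, a, q) \<in> fsa_trans M" "x = (case a of None \<Rightarrow> [] | Some b \<Rightarrow> [b]) @ y"
    by blast
  then show ?l by (cases a) (auto intro: fsa_step.intros)
qed

lemma finite_inj_nat: "finite A \<Longrightarrow> \<exists>f :: _ \<Rightarrow> nat. inj_on f A"
  using finite_imp_inj_to_nat_seg by metis

text \<open>
  The machines that define the classes have natural numbers as states. Numbering the states turns an
  automaton with any type of states into one of these, so that the constructions below are free to
  use datatypes.
\<close>

lemma regularI:
  assumes M: "fsa_over X (M :: ('q, 'a) fsa)"
  shows "fsa_lang X M \<in> languages Regular X"
proof -
  obtain f :: "'q \<Rightarrow> nat" where f: "inj_on f (fsa_states M)"
    using M finite_inj_nat unfolding fsa_over_def by metis
  define M' where "M' = \<lparr>fsa_states = f ` fsa_states M, fsa_start = f (fsa_start M),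
     fsa_final = f ` fsa_final M, fsa_trans = (\<lambda>(p, a, q). (f p, a, f q)) ` fsa_trans M\<rparr>"
  have over: "fsa_over X M'"
    using M unfolding fsa_over_def M'_def by fastforce
  have step: "fsa_step M' (f p, w) (f q, u)" if "fsa_step M (p, w) (q, u)" for p w q u
    using that by (cases; force simp: M'_def intro!: fsa_step.intros)
  have steps: "(fsa_step M')\<^sup>*\<^sup>* (f p, w) (f q, u)" if "(fsa_step M)\<^sup>*\<^sup>* (p, w) (q, u)" for p w q u
    using that by (induction "(p, w)" "(q, u)" arbitrary: q u rule: rtranclp.induct)
      (auto intro: step rtranclp.rtrancl_into_rtrancl)
  have bwd: "\<exists>q\<in>fsa_states M. q' = f q \<and> fsa_step M (p, w) (q, u)"
    if "fsa_step M' (f p, w) (q', u)" "p \<in> fsa_states M" for p w q' u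
    using that(1)
  proof cases
    case (1 a)
    then obtain p0 q where "(p0, Some a, q) \<in> fsa_trans M" "f p0 = f p" "q' = f q"
      by (auto simp: M'_def)
    moreover from this have "p0 = p" "q \<in> fsa_states M"
      using M f that(2) unfolding fsa_over_def by (auto dest!: inj_onD)
    ultimately show ?thesis using 1 by (auto intro: fsa_step.intros)
  next
    case 2
    then obtain p0 q where "(p0, None, q) \<in> fsa_trans M" "f p0 = f p" "q' = f q"
      by (auto simp: M'_def)
    moreover from this have "p0 = p" "q \<in> fsa_states M"
      using M f that(2) unfolding fsa_over_def by (auto dest!: inj_onD)
    ultimately show ?thesis using 2 by (auto intro: fsa_step.intros)
  qed
  have backs: "\<exists>q\<in>fsa_states M. q' = f q \<and> (fsa_step M)\<^sup>*\<^sup>* (p, w) (q, u)"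
    if "(fsa_step M')\<^sup>*\<^sup>* (f p, w) (q', u)" "p \<in> fsa_states M" for p w q' u
    using that
  proof (induction "(f p, w)" "(q', u)" arbitrary: q' u rule: rtranclp.induct)
    case rtrancl_refl
    then show ?case by blast
  next
    case (rtrancl_into_rtrancl b)
    then show ?case
      by (cases b) (metis bwd rtranclp.rtrancl_into_rtrancl)
  qed
  have "fsa_lang X M' = fsa_lang X M"
  proof -
    have st: "fsa_start M \<in> fsa_states M" and fin: "fsa_final M \<subseteq> fsa_states M"
      using M unfolding fsa_over_def by auto
    have "(\<exists>q'\<in>fsa_final M'. (fsa_step M')\<^sup>*\<^sup>* (f (fsa_start M), w) (q', [])) \<longleftrightarrow>
        (\<exists>q\<in>fsa_final M. (fsa_step M)\<^sup>*\<^sup>* (fsa_start M, w) (q, []))" (is "?l \<longleftrightarrow> ?r") for w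
    proof
      assume ?l
      then obtain q where q: "q \<in> fsa_final M" "(fsa_step M')\<^sup>*\<^sup>* (f (fsa_start M), w) (f q, [])"
        by (auto simp: M'_def)
      with backs[OF q(2) st] inj_onD[OF f] fin show ?r by blast
    next
      assume ?r
      with steps show ?l by (force simp: M'_def)
    qed
    then show ?thesis by (simp add: fsa_lang_def M'_def)
  qed
  with over show ?thesis by auto
qed

text \<open>
  Control of the composite automaton: between two factors it is at a vertex of the graph, and within a
  factor it runs the automaton of the edge label, remembering the target of the edge.
\<close>

datatype ('s, 'v, 'q) frame = Node 's | Run 'v 's 'q

lemma regular_subst:
  fixes L :: "'v \<Rightarrow> 'a list set" and D :: "('s \<times> 'v \<times> 's) set" and Y :: "'b set"
  assumes D: "finite D" and L: "\<And>s v t. (s, v, t) \<in> D \<Longrightarrow> L v \<in> languages Regular (X v)"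
    and f: "\<And>s v t. (s, v, t) \<in> D \<Longrightarrow> f v ` X v \<subseteq> Y"
  shows "subst_lang D (\<lambda>v. map (f v) ` L v) s0 F \<in> languages Regular Y"
proof -
  have "\<exists>M :: (nat, 'a) fsa. (\<exists>s t. (s, v, t) \<in> D) \<longrightarrow> fsa_over (X v) M \<and> fsa_lang (X v) M = L v" for v
    using L by simp blast
  then obtain M :: "'v \<Rightarrow> (nat, 'a) fsa" where M0: "\<And>s v t. (s, v, t) \<in> D \<Longrightarrow>
      fsa_over (X v) (M v) \<and> L v = fsa_lang (X v) (M v)"
    by metis
  note M = M0[THEN conjunct1] and LM = M0[THEN conjunct2]
  define S where "S = insert s0 (fst ` D \<union> (snd \<circ> snd) ` D)"
  have S: "s0 \<in> S" "\<And>s v t. (s, v, t) \<in> D \<Longrightarrow> s \<in> S \<and> t \<in> S"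
    unfolding S_def by force+
  define Q where "Q = Node ` S \<union> (\<Union>(s, v, t)\<in>D. Run v t ` fsa_states (M v))"
  define tr where "tr = (\<lambda>(s :: 's, v :: 'v, t :: 's).
      insert (Node s, None, Run v t (fsa_start (M v)))
      ((\<lambda>(p, a, q). (Run v t p, map_option (f v) a, Run v t q)) ` fsa_trans (M v) \<union>
      (\<lambda>p. (Run v t p, None, Node t)) ` fsa_final (M v)))"
  define T where "T = (\<Union>d\<in>D. tr d)"
  define C where "C = \<lparr>fsa_states = Q, fsa_start = Node s0, fsa_final = Node ` (F \<inter> S), fsa_trans = T\<rparr>"
  have transC: "fsa_trans C = T" by (simp add: C_def)
  have trM: "p \<in> fsa_states (M v) \<and> a \<in> insert None (Some ` X v) \<and> q \<in> fsa_states (M v)"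
    if "(p, a, q) \<in> fsa_trans (M v)" "(s, v, t) \<in> D" for p a q s v t
    using M[OF that(2)] that(1) unfolding fsa_over_def by auto
  have "finite Q" "Node s0 \<in> Q" "Node ` (F \<inter> S) \<subseteq> Q"
    unfolding Q_def S_def using D M by (auto simp: fsa_over_def)
  moreover have "T \<subseteq> Q \<times> insert None (Some ` Y) \<times> Q"
  proof -
    have "tr d \<subseteq> Q \<times> insert None (Some ` Y) \<times> Q" if "d \<in> D" for d
    proof -
      obtain s v t where d: "d = (s, v, t)" by (cases d)
      with that have dD: "(s, v, t) \<in> D" by simp
      have nodes: "Node s \<in> Q" "Node t \<in> Q" using S(2)[OF dD] by (auto simp: Q_def)
      have runQ: "Run v t p \<in> Q" if "p \<in> fsa_states (M v)" for p
        unfolding Q_def using that by (intro UnI2 UN_I[OF dD]) auto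
      have "(Run v t p, map_option (f v) a, Run v t q) \<in> Q \<times> insert None (Some ` Y) \<times> Q"
        if "(p, a, q) \<in> fsa_trans (M v)" for p a q
        using trM[OF that dD] map_option_letters[OF f[OF dD]] runQ by auto
      then have "(\<lambda>(p, a, q). (Run v t p, map_option (f v) a, Run v t q)) ` fsa_trans (M v) \<subseteq>
          Q \<times> insert None (Some ` Y) \<times> Q"
        by (intro image_subsetI) (simp only: split_paired_all prod.case)
      moreover have "fsa_start (M v) \<in> fsa_states (M v)" "fsa_final (M v) \<subseteq> fsa_states (M v)"
        using M[OF dD] by (auto simp: fsa_over_def)
      ultimately show ?thesis
        using nodes runQ unfolding tr_def d by auto
    qed
    then show ?thesis unfolding T_def by blast
  qed
  ultimately have over: "fsa_over Y C"
    unfolding fsa_over_def C_def by simp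
  let ?K = "\<lambda>v. map (f v) ` L v"
  \<comment> \<open>Invariant: the input consumed so far spells a path, except for the part of the current factor
    that the automaton of this factor has read.\<close>
  define I where "I w c rest = (case c of Node s \<Rightarrow> \<exists>u. w = u @ rest \<and> path_lang D ?K s0 u s
     | Run v t p \<Rightarrow> \<exists>u x s. w = u @ map (f v) x @ rest \<and> path_lang D ?K s0 u s \<and> (s, v, t) \<in> D \<and>
          x \<in> lists (X v) \<and> (fsa_step (M v))\<^sup>*\<^sup>* (fsa_start (M v), x) (p, []))" for w c rest
  have inv: "I w c' rest'" if "fsa_step C (c, rest) (c', rest')" "I w c rest" for w c rest c' rest'
  proof -
    from that(1) obtain oa where tr: "(c, oa, c') \<in> T" and rest: "rest = (case oa of None \<Rightarrow> [] | Some a \<Rightarrow> [a]) @ rest'"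
      unfolding fsa_step_iff transC by blast
    from tr obtain d where "d \<in> D" "(c, oa, c') \<in> tr d"
      unfolding T_def by (elim UN_E)
    then obtain s v t where d: "(s, v, t) \<in> D" and "(c, oa, c') \<in> tr (s, v, t)"
      by (cases d) simp
    then consider (enter) "c = Node s" "oa = None" "c' = Run v t (fsa_start (M v))"
      | (run) p a q where "c = Run v t p" "oa = map_option (f v) a" "c' = Run v t q" "(p, a, q) \<in> fsa_trans (M v)"
      | (leave) p where "c = Run v t p" "oa = None" "c' = Node t" "p \<in> fsa_final (M v)"
      unfolding tr_def by auto
    then show ?thesis
    proof cases
      case enter
      with that(2) obtain u where u: "w = u @ rest" "path_lang D ?K s0 u s" 
        unfolding I_def enter frame.case by blast
      show ?thesis
        unfolding I_def enter frame.case using u rest d enter(2)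
        by (intro exI[of _ u] exI[of _ "[]"] exI[of _ s]) auto
    next
      case run
      from that(2) run(1) obtain u1 x s' where u: "w = u1 @ map (f v) x @ rest" "path_lang D ?K s0 u1 s'"
         "(s', v, t) \<in> D" "x \<in> lists (X v)" and st: "(fsa_step (M v))\<^sup>*\<^sup>* (fsa_start (M v), x) (p, [])"
        unfolding I_def run frame.case by blast
      define y where "y = (case a of None \<Rightarrow> [] | Some a \<Rightarrow> [a])"
      have y: "fsa_step (M v) (p, y) (q, [])"
        unfolding fsa_step_iff using run(4) by (auto simp: y_def)
      have y2: "y \<in> lists (X v)" "w = u1 @ map (f v) (x @ y) @ rest'"
        using trM[OF run(4) d] run(2) u(1) rest unfolding y_def
        by (auto split: option.splits)
      have "(fsa_step (M v))\<^sup>*\<^sup>* (fsa_start (M v), x @ y) (q, [])"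
        using fsa_steps_append[OF st, of y] y by simp
      then show ?thesis
        unfolding I_def run(3) frame.case using y2 u
        by (intro exI[of _ u1] exI[of _ "x @ y"] exI[of _ s']) auto
    next
      case leave
      from that(2) leave(1) obtain u1 x s' where u: "w = u1 @ map (f v) x @ rest" "path_lang D ?K s0 u1 s'"
         "(s', v, t) \<in> D" "x \<in> lists (X v)" and st: "(fsa_step (M v))\<^sup>*\<^sup>* (fsa_start (M v), x) (p, [])"
        unfolding I_def leave frame.case by blast
      have "x \<in> L v" using LM[OF d] leave st u by (auto simp: fsa_lang_def)
      with u have "path_lang D ?K s0 (u1 @ map (f v) x) t" by (auto intro: path_lang.Snoc)
      with u(1) rest show ?thesis unfolding I_def leave frame.case
        by (intro exI[of _ "u1 @ map (f v) x"]) simp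
    qed
  qed
  have sound: "I w c rest" if "(fsa_step C)\<^sup>*\<^sup>* (Node s0, w) (c, rest)" for w c rest
    using that
  proof (induction "(Node s0 :: ('s, 'v, nat) frame, w)" "(c, rest)" arbitrary: c rest rule: rtranclp.induct)
    case rtrancl_refl
    then show ?case by (auto simp: I_def intro: path_lang.Nil)
  next
    case (rtrancl_into_rtrancl b)
    then show ?case using inv by (cases b) auto
  qed
  have run: "(fsa_step C)\<^sup>*\<^sup>* (Run v t p, map (f v) x @ rest) (Run v t q, map (f v) y @ rest)"
    if "(fsa_step (M v))\<^sup>*\<^sup>* (p, x) (q, y)" "(s, v, t) \<in> D" for s v t p q x y rest
    using that(1)
  proof (induction "(p, x)" "(q, y)" arbitrary: q y rule: rtranclp.induct)
    case (rtrancl_into_rtrancl b)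
    obtain r z where b: "b = (r, z)" by (cases b)
    from rtrancl_into_rtrancl(3) obtain a where
      tr: "(r, a, q) \<in> fsa_trans (M v)" "z = (case a of None \<Rightarrow> [] | Some b \<Rightarrow> [b]) @ y"
      unfolding b fsa_step_iff by blast
    have "(Run v t r, map_option (f v) a, Run v t q) \<in> tr (s, v, t)"
      unfolding tr_def using tr(1) by force
    then have "(Run v t r, map_option (f v) a, Run v t q) \<in> T"
      using that(2) unfolding T_def by blast
    then have "fsa_step C (Run v t r, map (f v) z @ rest) (Run v t q, map (f v) y @ rest)"
      unfolding fsa_step_iff transC using tr(2) by (cases a) fastforce+
    with rtrancl_into_rtrancl(2)[OF b] show ?case by auto
  qed simp
  have complete: "(fsa_step C)\<^sup>*\<^sup>* (Node s0, w @ rest) (Node t, rest)" if "path_lang D ?K s0 w t" for w t rest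
    using that
  proof (induction arbitrary: rest)
    case (Snoc u t v t' x)
    then obtain x' q where x: "x = map (f v) x'" "q \<in> fsa_final (M v)"
        "(fsa_step (M v))\<^sup>*\<^sup>* (fsa_start (M v), x') (q, [])"
      using LM[of t v t'] by (auto simp: fsa_lang_def)
    have TI: "m \<in> T" if "m \<in> tr (t, v, t')" for m
      using Snoc(2) that unfolding T_def by blast
    note Snoc.IH[of "x @ rest"]
    also have "fsa_step C (Node t, x @ rest) (Run v t' (fsa_start (M v)), x @ rest)"
      unfolding fsa_step_iff transC by (intro exI[of _ None]) (auto intro!: TI simp: tr_def)
    also have "(fsa_step C)\<^sup>*\<^sup>* \<dots> (Run v t' q, rest)"
      using run[OF x(3) Snoc(2), of rest] by (simp add: x)
    also have "fsa_step C \<dots> (Node t', rest)"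
      unfolding fsa_step_iff transC by (intro exI[of _ None]) (use x(2) in \<open>auto intro!: TI simp: tr_def\<close>)
    finally show ?case by simp
  qed simp
  have "subst_lang D ?K s0 F = fsa_lang Y C" (is "?A = ?B")
  proof (intro Set.set_eqI iffI)
    fix w assume "w \<in> ?A"
    then obtain t where t: "t \<in> F" "path_lang D ?K s0 w t" by (auto simp: subst_lang_def)
    have "w \<in> lists Y"
    proof (rule path_lang_lists[OF t(2)])
      fix s v t assume "(s, v, t) \<in> D"
      from map_in_lists[OF f[OF this]] LM[OF this] show "map (f v) ` L v \<subseteq> lists Y"
        by (auto simp: fsa_lang_def)
    qed
    moreover have "t \<in> S" using t(2) S by cases auto
    ultimately show "w \<in> ?B"
      using complete[OF t(2), of "[]"] t(1) by (auto simp: fsa_lang_def C_def)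
  next
    fix w assume "w \<in> ?B"
    then obtain t where "t \<in> F" "(fsa_step C)\<^sup>*\<^sup>* (Node s0, w) (Node t, [])"
      by (auto simp: fsa_lang_def C_def)
    with sound[OF this(2)] show "w \<in> ?A"
      unfolding subst_lang_def I_def frame.case by auto
  qed
  with regularI[OF over] show ?thesis by simp
qed

section \<open>Pushdown automata\<close>

lemma pda_step_append:
  "pda_step M (p, x, s) (q, y, s') \<Longrightarrow> pda_step M (p, x @ z, s @ zs) (q, y @ z, s' @ zs)"
  by (erule pda_step.cases) (auto intro: pda_step.intros)

lemma pda_steps_append:
  "(pda_step M)\<^sup>*\<^sup>* (p, x, s) (q, y, s') \<Longrightarrow> (pda_step M)\<^sup>*\<^sup>* (p, x @ z, s @ zs) (q, y @ z, s' @ zs)"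
proof (induction "(p, x, s)" "(q, y, s')" arbitrary: q y s' rule: rtranclp.induct)
  case (rtrancl_into_rtrancl b)
  then show ?case
    by (cases b) (auto intro: pda_step_append rtranclp.rtrancl_into_rtrancl)
qed simp

lemma pda_step_iff:
  "pda_step M (p, x, s) (q, y, s') \<longleftrightarrow>
     (\<exists>a Z zs s0. (p, a, Z, q, zs) \<in> pda_trans M \<and> x = (case a of None \<Rightarrow> [] | Some b \<Rightarrow> [b]) @ y \<and>
        s = Z # s0 \<and> s' = zs @ s0)" (is "?l \<longleftrightarrow> ?r")
proof
  assume ?l
  then show ?r by cases force+
next
  assume ?r
  then obtain a Z zs s0 where *: "(p, a, Z, q, zs) \<in> pda_trans M"
     "x = (case a of None \<Rightarrow> [] | Some b \<Rightarrow> [b]) @ y" "s = Z # s0" "s' = zs @ s0"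
    by blast
  then show ?l by (cases a) (auto intro: pda_step.intros)
qed

lemma pda_step_epsI:
  "(p, None, Z, q, zs) \<in> pda_trans M \<Longrightarrow> s' = zs @ s \<Longrightarrow> pda_step M (p, x, Z # s) (q, x, s')"
  by (auto intro: pda_step.intros)

lemma context_freeI:
  assumes M: "pda_over X (M :: ('q, 'a, 'g) pda)"
  shows "pda_lang X M \<in> languages CF X"
proof -
  obtain f :: "'q \<Rightarrow> nat" where f: "inj_on f (pda_states M)"
    using M finite_inj_nat unfolding pda_over_def by metis
  obtain g :: "'g \<Rightarrow> nat" where g: "inj_on g (pda_stack M)"
    using M finite_inj_nat unfolding pda_over_def by metis
  define M' where "M' = \<lparr>pda_states = f ` pda_states M, pda_stack = g ` pda_stack M,
     pda_start = f (pda_start M), pda_bottom = g (pda_bottom M), pda_final = f ` pda_final M,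
     pda_trans = (\<lambda>(p, a, Z, q, zs). (f p, a, g Z, f q, map g zs)) ` pda_trans M\<rparr>"
  have trM: "p \<in> pda_states M \<and> a \<in> insert None (Some ` X) \<and> Z \<in> pda_stack M \<and> q \<in> pda_states M \<and>
      zs \<in> lists (pda_stack M)" if "(p, a, Z, q, zs) \<in> pda_trans M" for p a Z q zs
    using M that unfolding pda_over_def by auto
  have over: "pda_over X M'"
    unfolding pda_over_def
  proof (intro conjI)
    show "pda_trans M' \<subseteq> pda_states M' \<times> insert None (Some ` X) \<times> pda_stack M' \<times>
                   pda_states M' \<times> lists (pda_stack M')"
      by (auto simp: M'_def dest!: trM)
  qed (use M in \<open>auto simp: M'_def pda_over_def\<close>)
  have step: "pda_step M' (f p, w, map g s) (f q, u, map g s')" if "pda_step M (p, w, s) (q, u, s')" for p w q u s s'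
    using that unfolding pda_step_iff by (force simp: M'_def)
  have steps: "(pda_step M')\<^sup>*\<^sup>* (f p, w, map g s) (f q, u, map g s')" if "(pda_step M)\<^sup>*\<^sup>* (p, w, s) (q, u, s')" for p w q u s s'
    using that
  proof (induction "(p, w, s)" "(q, u, s')" arbitrary: q u s' rule: rtranclp.induct)
    case (rtrancl_into_rtrancl b)
    then show ?case
      by (cases b) (auto intro: step rtranclp.rtrancl_into_rtrancl)
  qed simp
  have bwd: "\<exists>q\<in>pda_states M. \<exists>s'\<in>lists (pda_stack M). q' = f q \<and> t' = map g s' \<and> pda_step M (p, w, s) (q, u, s')"
    if st: "pda_step M' (f p, w, map g s) (q', u, t')" "p \<in> pda_states M" "s \<in> lists (pda_stack M)" for p w q' u s t'
  proof -
    from st(1) obtain a Z' zs' s0' where "(f p, a, Z', q', zs') \<in> pda_trans M'"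
      and w: "w = (case a of None \<Rightarrow> [] | Some b \<Rightarrow> [b]) @ u" and s: "map g s = Z' # s0'" "t' = zs' @ s0'"
      unfolding pda_step_iff by (elim exE conjE) (rule that)
    then obtain p0 Z q zs where tr: "(p0, a, Z, q, zs) \<in> pda_trans M" and eq: "f p0 = f p" "Z' = g Z"
      "q' = f q" "zs' = map g zs"
      by (auto simp: M'_def)
    obtain Z0 s0 where s0: "s = Z0 # s0" "g Z0 = g Z" "s0' = map g s0"
      using s(1) eq by (cases s) auto
    have "p0 = p" using trM[OF tr] eq(1) that(2) f by (auto dest!: inj_onD)
    moreover have "Z0 = Z" using trM[OF tr] s0 that(3) g by (auto dest!: inj_onD)
    ultimately have "pda_step M (p, w, s) (q, u, zs @ s0)"
      unfolding pda_step_iff using tr w s0 by blast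
    moreover have "zs @ s0 \<in> lists (pda_stack M)" using trM[OF tr] that(3) s0 by auto
    moreover have "t' = map g (zs @ s0)" using eq s(2) s0(3) by simp
    ultimately show ?thesis using trM[OF tr] eq(3) by blast
  qed
  have bwds: "\<exists>q\<in>pda_states M. \<exists>s'\<in>lists (pda_stack M). q' = f q \<and> t' = map g s' \<and> (pda_step M)\<^sup>*\<^sup>* (p, w, s) (q, u, s')"
    if "(pda_step M')\<^sup>*\<^sup>* (f p, w, map g s) (q', u, t')" "p \<in> pda_states M" "s \<in> lists (pda_stack M)" for p w q' u s t'
    using that
  proof (induction "(f p, w, map g s)" "(q', u, t')" arbitrary: q' u t' rule: rtranclp.induct)
    case rtrancl_refl
    then show ?case by blast
  next
    case (rtrancl_into_rtrancl b)
    obtain q1 u1 t1 where b: "b = (q1, u1, t1)" by (cases b)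
    from rtrancl_into_rtrancl.hyps(2)[OF b rtrancl_into_rtrancl.prems] obtain q s' where
      1: "q \<in> pda_states M" "s' \<in> lists (pda_stack M)" "q1 = f q" "t1 = map g s'" "(pda_step M)\<^sup>*\<^sup>* (p, w, s) (q, u1, s')"
      by blast
    from bwd[of q u1 s' q' u t'] rtrancl_into_rtrancl.hyps(3) 1 b show ?case
      by (metis rtranclp.rtrancl_into_rtrancl)
  qed
  have st: "pda_start M \<in> pda_states M" and bot: "[pda_bottom M] \<in> lists (pda_stack M)"
    and fin: "pda_final M \<subseteq> pda_states M"
    using M unfolding pda_over_def by auto
  have "(\<exists>q'\<in>pda_final M'. \<exists>s. (pda_step M')\<^sup>*\<^sup>* (f (pda_start M), w, [g (pda_bottom M)]) (q', [], s)) \<longleftrightarrow>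
      (\<exists>q\<in>pda_final M. \<exists>s. (pda_step M)\<^sup>*\<^sup>* (pda_start M, w, [pda_bottom M]) (q, [], s))" (is "?l \<longleftrightarrow> ?r") for w
  proof
    assume ?l
    then obtain q s where q: "q \<in> pda_final M"
       "(pda_step M')\<^sup>*\<^sup>* (f (pda_start M), w, map g [pda_bottom M]) (f q, [], s)"
      by (auto simp: M'_def)
    with bwds[OF q(2) st bot] inj_onD[OF f] fin show ?r by blast
  next
    assume ?r
    then obtain q s where "q \<in> pda_final M" "(pda_step M)\<^sup>*\<^sup>* (pda_start M, w, [pda_bottom M]) (q, [], s)"
      by blast
    with steps[OF this(2)] show ?l by (auto simp: M'_def)
  qed
  then have "pda_lang X M' = pda_lang X M" by (simp add: pda_lang_def M'_def)
  with over show ?thesis by auto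
qed

text \<open>
  A pushdown automaton accepts with any stack, so what is left of the stack of a factor is drained
  before the next factor starts. A bottom symbol \<open>None\<close>, below the symbols \<open>Some Z\<close> of the factor,
  tells when this is done.
\<close>

datatype ('s, 'v, 'q) pda_frame = PNode 's | PRun 'v 's 'q | Drain 's

lemma context_free_subst:
  fixes L :: "'v \<Rightarrow> 'a list set" and D :: "('s \<times> 'v \<times> 's) set" and Y :: "'b set"
  assumes D: "finite D" and L: "\<And>s v t. (s, v, t) \<in> D \<Longrightarrow> L v \<in> languages CF (X v)"
    and f: "\<And>s v t. (s, v, t) \<in> D \<Longrightarrow> f v ` X v \<subseteq> Y"
  shows "subst_lang D (\<lambda>v. map (f v) ` L v) s0 F \<in> languages CF Y"
proof -
  have "\<exists>M :: (nat, 'a, nat) pda. (\<exists>s t. (s, v, t) \<in> D) \<longrightarrow> pda_over (X v) M \<and> pda_lang (X v) M = L v" for v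
    using L by simp blast
  then obtain M :: "'v \<Rightarrow> (nat, 'a, nat) pda" where M0: "\<And>s v t. (s, v, t) \<in> D \<Longrightarrow>
      pda_over (X v) (M v) \<and> L v = pda_lang (X v) (M v)"
    by metis
  note M = M0[THEN conjunct1] and LM = M0[THEN conjunct2]
  define S where "S = insert s0 (fst ` D \<union> (snd \<circ> snd) ` D)"
  have S: "s0 \<in> S" "\<And>s v t. (s, v, t) \<in> D \<Longrightarrow> s \<in> S \<and> t \<in> S"
    unfolding S_def by force+
  define Q where "Q = PNode ` S \<union> Drain ` S \<union> (\<Union>(s, v, t)\<in>D. PRun v t ` pda_states (M v))"
  define G where "G = insert None (Some ` (\<Union>(s, v, t)\<in>D. pda_stack (M v)))"
  define tr where "tr = (\<lambda>(s :: 's, v :: 'v, t :: 's).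
      insert (PNode s, None, None, PRun v t (pda_start (M v)), [Some (pda_bottom (M v)), None])
      ((\<lambda>(p, a, Z, q, zs). (PRun v t p, map_option (f v) a, Some Z, PRun v t q, map Some zs)) ` pda_trans (M v) \<union>
      (\<lambda>(p, Z). (PRun v t p, None, Z, Drain t, [Z])) ` (pda_final (M v) \<times> G) \<union>
      (\<lambda>Z. (Drain t, None, Z, Drain t, [])) ` (G - {None}) \<union>
      {(Drain t, None, None, PNode t, [None])}))"
  define T where "T = (\<Union>d\<in>D. tr d)"
  define C where "C = \<lparr>pda_states = Q, pda_stack = G, pda_start = PNode s0, pda_bottom = None,
     pda_final = PNode ` (F \<inter> S), pda_trans = T\<rparr>"
  have trM: "p \<in> pda_states (M v) \<and> a \<in> insert None (Some ` X v) \<and> Z \<in> pda_stack (M v) \<and> q \<in> pda_states (M v) \<and>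
      zs \<in> lists (pda_stack (M v))" if "(p, a, Z, q, zs) \<in> pda_trans (M v)" "(s, v, t) \<in> D" for p a Z q zs s v t
    using M[OF that(2)] that(1) unfolding pda_over_def by auto
  have finG: "finite G" and finQ: "finite Q" and Q0: "PNode s0 \<in> Q" "PNode ` (F \<inter> S) \<subseteq> Q"
    unfolding Q_def S_def G_def using D M by (auto simp: pda_over_def intro!: finite_imageI)
  have finT: "finite T"
  proof -
    have "finite (tr d)" if d: "d \<in> D" for d
    proof -
      obtain s v t where dd: "d = (s, v, t)" by (cases d)
      then have "finite (pda_final (M v))" "finite (pda_trans (M v))"
        using M[of s v t] d unfolding pda_over_def by (auto intro: finite_subset)
      then show ?thesis using finG unfolding tr_def dd by simp
    qed
    then show ?thesis using D by (simp add: T_def)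
  qed
  have T: "T \<subseteq> Q \<times> insert None (Some ` Y) \<times> G \<times> Q \<times> lists G"
  proof -
    have "tr d \<subseteq> Q \<times> insert None (Some ` Y) \<times> G \<times> Q \<times> lists G" if "d \<in> D" for d
    proof -
      obtain s v t where d: "d = (s, v, t)" by (cases d)
      with that have dD: "(s, v, t) \<in> D" by simp
      have nodes: "PNode s \<in> Q" "PNode t \<in> Q" "Drain t \<in> Q" using S(2)[OF dD] by (auto simp: Q_def)
      have runQ: "PRun v t p \<in> Q" if "p \<in> pda_states (M v)" for p
        unfolding Q_def using that by (intro UnI2 UN_I[OF dD]) auto
      have stG: "Some Z \<in> G" if "Z \<in> pda_stack (M v)" for Z
        unfolding G_def using that dD by blast
      have "None \<in> G" by (simp add: G_def)
      have A: "(PRun v t p, map_option (f v) a, Some Z, PRun v t q, map Some zs) \<in> Q \<times> insert None (Some ` Y) \<times> G \<times> Q \<times> lists G"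
        if "(p, a, Z, q, zs) \<in> pda_trans (M v)" for p a Z q zs
        using trM[OF that dD] map_option_letters[OF f[OF dD]] runQ stG by auto
      have "pda_start (M v) \<in> pda_states (M v)" "pda_final (M v) \<subseteq> pda_states (M v)" "pda_bottom (M v) \<in> pda_stack (M v)"
        using M[OF dD] by (auto simp: pda_over_def)
      with nodes runQ stG \<open>None \<in> G\<close> have "tr d - (\<lambda>(p, a, Z, q, zs). (PRun v t p, map_option (f v) a, Some Z,
          PRun v t q, map Some zs)) ` pda_trans (M v) \<subseteq> Q \<times> insert None (Some ` Y) \<times> G \<times> Q \<times> lists G"
        unfolding tr_def d by (auto simp del: image_iff)
      moreover have "(\<lambda>(p, a, Z, q, zs). (PRun v t p, map_option (f v) a, Some Z, PRun v t q, map Some zs)) ` pda_trans (M v)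
          \<subseteq> Q \<times> insert None (Some ` Y) \<times> G \<times> Q \<times> lists G"
        using A by (intro image_subsetI) (simp only: split_paired_all prod.case)
      ultimately show ?thesis by blast
    qed
    then show ?thesis unfolding T_def by blast
  qed
  have over: "pda_over Y C"
    using finG finQ Q0 finT T unfolding pda_over_def C_def by (simp add: G_def)
  let ?K = "\<lambda>v. map (f v) ` L v"
  \<comment> \<open>Invariant as for finite automata; the stack in addition is that of the current factor above the
    bottom symbol.\<close>
  define I where "I w c rest st = (case c of
       PNode s \<Rightarrow> \<exists>u. w = u @ rest \<and> path_lang D ?K s0 u s \<and> st = [None]
     | PRun v t p \<Rightarrow> \<exists>u x s z. w = u @ map (f v) x @ rest \<and> path_lang D ?K s0 u s \<and> (s, v, t) \<in> D \<and>
          x \<in> lists (X v) \<and> st = map Some z @ [None] \<and>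
          (pda_step (M v))\<^sup>*\<^sup>* (pda_start (M v), x, [pda_bottom (M v)]) (p, [], z)
     | Drain s \<Rightarrow> \<exists>u z. w = u @ rest \<and> path_lang D ?K s0 u s \<and> st = map Some z @ [None])" for w c rest st
  have inv: "I w c' rest' st'" if "pda_step C (c, rest, st) (c', rest', st')" "I w c rest st" for w c rest c' rest' st st'
  proof -
    from that(1) obtain oa Z zs st0 where tr: "(c, oa, Z, c', zs) \<in> T"
        and rest: "rest = (case oa of None \<Rightarrow> [] | Some a \<Rightarrow> [a]) @ rest'"
        and st: "st = Z # st0" "st' = zs @ st0"
      unfolding pda_step_iff by (auto simp: C_def)
    from tr obtain d where "d \<in> D" "(c, oa, Z, c', zs) \<in> tr d"
      unfolding T_def by (elim UN_E)
    then obtain s v t where d: "(s, v, t) \<in> D" and "(c, oa, Z, c', zs) \<in> tr (s, v, t)"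
      by (cases d) simp
    then consider (enter) "c = PNode s" "oa = None" "Z = None" "c' = PRun v t (pda_start (M v))"
         "zs = [Some (pda_bottom (M v)), None]"
      | (run) p a q Z' zs' where "c = PRun v t p" "oa = map_option (f v) a" "Z = Some Z'" "c' = PRun v t q"
          "zs = map Some zs'" "(p, a, Z', q, zs') \<in> pda_trans (M v)"
      | (leave) p where "c = PRun v t p" "oa = None" "c' = Drain t" "zs = [Z]" "p \<in> pda_final (M v)"
      | (drain) Z' where "c = Drain t" "oa = None" "c' = Drain t" "zs = []" "Z = Some Z'"
      | (finish) "c = Drain t" "oa = None" "c' = PNode t" "zs = [None]" "Z = None"
      unfolding tr_def by (cases Z) auto
    then show ?thesis
    proof cases
      case enter
      with that(2) obtain u where u: "w = u @ rest" "path_lang D ?K s0 u s" "st = [None]"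
        unfolding I_def enter pda_frame.case by blast
      show ?thesis
        unfolding I_def enter pda_frame.case using u rest d enter(2,5) st
        by (intro exI[of _ u] exI[of _ "[]"] exI[of _ s] exI[of _ "[pda_bottom (M v)]"]) auto
    next
      case run
      from that(2) run(1) obtain u1 x s' z where u: "w = u1 @ map (f v) x @ rest" "path_lang D ?K s0 u1 s'"
         "(s', v, t) \<in> D" "x \<in> lists (X v)" and z: "st = map Some z @ [None]"
         and sts: "(pda_step (M v))\<^sup>*\<^sup>* (pda_start (M v), x, [pda_bottom (M v)]) (p, [], z)"
        unfolding I_def run pda_frame.case by blast
      obtain z0 where z0: "z = Z' # z0" "st0 = map Some z0 @ [None]"
        using z st run(3) by (cases z) auto
      define y where "y = (case a of None \<Rightarrow> [] | Some a \<Rightarrow> [a])"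
      have y: "pda_step (M v) (p, y, z) (q, [], zs' @ z0)"
        unfolding pda_step_iff using run(6) z0 by (auto simp: y_def)
      have y2: "y \<in> lists (X v)" "w = u1 @ map (f v) (x @ y) @ rest'"
        using trM[OF run(6) d] run(2) u(1) rest unfolding y_def
        by (auto split: option.splits)
      have "(pda_step (M v))\<^sup>*\<^sup>* (pda_start (M v), x @ y, [pda_bottom (M v)]) (q, [], zs' @ z0)"
        using pda_steps_append[OF sts, of y "[]"] y by simp
      then show ?thesis
        unfolding I_def run(4) pda_frame.case using y2 u st run(5) z0
        by (intro exI[of _ u1] exI[of _ "x @ y"] exI[of _ s'] exI[of _ "zs' @ z0"]) auto
    next
      case leave
      from that(2) leave(1) obtain u1 x s' z where u: "w = u1 @ map (f v) x @ rest" "path_lang D ?K s0 u1 s'"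
         "(s', v, t) \<in> D" "x \<in> lists (X v)" "st = map Some z @ [None]"
         and sts: "(pda_step (M v))\<^sup>*\<^sup>* (pda_start (M v), x, [pda_bottom (M v)]) (p, [], z)"
        unfolding I_def leave pda_frame.case by blast
      have "x \<in> L v" using LM[OF d] leave sts u by (auto simp: pda_lang_def)
      with u have "path_lang D ?K s0 (u1 @ map (f v) x) t" by (auto intro: path_lang.Snoc)
      with u rest leave(2,4) st show ?thesis unfolding I_def leave(3) pda_frame.case
        by (intro exI[of _ "u1 @ map (f v) x"] exI[of _ z]) simp
    next
      case drain
      with that(2) obtain u z where u: "w = u @ rest" "path_lang D ?K s0 u t" and z: "st = map Some z @ [None]"
        unfolding I_def drain pda_frame.case by blast
      obtain z' where "st0 = map Some z' @ [None]"
        using z st drain(5) by (cases z) auto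
      with u rest drain(2,4) st show ?thesis unfolding I_def drain(3) pda_frame.case
        by (intro exI[of _ u] exI[of _ z']) simp
    next
      case finish
      with that(2) obtain u z where u: "w = u @ rest" "path_lang D ?K s0 u t" and z: "st = map Some z @ [None]"
        unfolding I_def finish pda_frame.case by blast
      have "st0 = []"
        using z st finish(5) by (cases z) auto
      with u rest finish(2,4) st show ?thesis unfolding I_def finish(3) pda_frame.case
        by (intro exI[of _ u]) simp
    qed
  qed
  have sound: "I w c rest st" if "(pda_step C)\<^sup>*\<^sup>* (PNode s0, w, [None]) (c, rest, st)" for w c rest st
    using that
  proof (induction "(PNode s0 :: ('s, 'v, nat) pda_frame, w, [None :: nat option])" "(c, rest, st)" arbitrary: c rest st rule: rtranclp.induct)
    case rtrancl_refl
    then show ?case by (auto simp: I_def intro: path_lang.Nil)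
  next
    case (rtrancl_into_rtrancl b)
    then show ?case using inv by (cases b) auto
  qed
  have stackC: "pda_stack C = G" and transC: "pda_trans C = T" by (simp_all add: C_def)
  have run: "(pda_step C)\<^sup>*\<^sup>* (PRun v t p, map (f v) x @ rest, map Some z @ [None]) (PRun v t q, map (f v) y @ rest, map Some z' @ [None])
      \<and> z' \<in> lists (pda_stack (M v))"
    if "(pda_step (M v))\<^sup>*\<^sup>* (p, x, z) (q, y, z')" "(s, v, t) \<in> D" "z \<in> lists (pda_stack (M v))" for s v t p q x y rest z z'
    using that(1)
  proof (induction "(p, x, z)" "(q, y, z')" arbitrary: q y z' rule: rtranclp.induct)
    case rtrancl_refl
    then show ?case using that by simp
  next
    case (rtrancl_into_rtrancl b)
    obtain r x1 z1 where b: "b = (r, x1, z1)" by (cases b)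
    from rtrancl_into_rtrancl(3) obtain a Z zs z0 where
      tr: "(r, a, Z, q, zs) \<in> pda_trans (M v)" "x1 = (case a of None \<Rightarrow> [] | Some b \<Rightarrow> [b]) @ y" "z1 = Z # z0" "z' = zs @ z0"
      unfolding b pda_step_iff by blast
    have "(PRun v t r, map_option (f v) a, Some Z, PRun v t q, map Some zs) \<in> tr (s, v, t)"
      unfolding tr_def using tr(1) by force
    then have "(PRun v t r, map_option (f v) a, Some Z, PRun v t q, map Some zs) \<in> T"
      using that(2) unfolding T_def by blast
    then have "pda_step C (PRun v t r, map (f v) x1 @ rest, map Some z1 @ [None]) (PRun v t q, map (f v) y @ rest, map Some z' @ [None])"
      unfolding pda_step_iff transC using tr(2-) by (cases a) fastforce+
    with rtrancl_into_rtrancl(2)[OF b] trM[OF tr(1) that(2)] tr show ?case by auto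
  qed
  have drain: "(pda_step C)\<^sup>*\<^sup>* (Drain t, rest, map Some z @ [None]) (Drain t, rest, [None])"
    if "z \<in> lists (pda_stack (M v))" "(s, v, t) \<in> D" for s v t rest z
    using that(1)
  proof (induction z)
    case (Cons Z z)
    have "Some Z \<in> G" unfolding G_def using Cons(1) that(2) by blast
    then have "(Drain t, None, Some Z, Drain t, []) \<in> tr (s, v, t)" by (auto simp: tr_def)
    then have "(Drain t, None, Some Z, Drain t, []) \<in> T" using that(2) unfolding T_def by blast
    then have "pda_step C (Drain t, rest, map Some (Z # z) @ [None]) (Drain t, rest, map Some z @ [None])"
      unfolding pda_step_iff transC by fastforce
    also note Cons.IH
    finally show ?case .
  qed simp
  have complete: "(pda_step C)\<^sup>*\<^sup>* (PNode s0, w @ rest, [None]) (PNode t, rest, [None])" if "path_lang D ?K s0 w t" for w t rest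
    using that
  proof (induction arbitrary: rest)
    case (Snoc u t v t' x)
    then obtain x' q z where x: "x = map (f v) x'" "q \<in> pda_final (M v)"
        "(pda_step (M v))\<^sup>*\<^sup>* (pda_start (M v), x', [pda_bottom (M v)]) (q, [], z)"
      using LM[of t v t'] by (auto simp: pda_lang_def)
    have TI: "m \<in> T" if "m \<in> tr (t, v, t')" for m
      using Snoc(2) that unfolding T_def by blast
    have bot: "[pda_bottom (M v)] \<in> lists (pda_stack (M v))"
      using M[OF Snoc(2)] by (auto simp: pda_over_def)
    have r: "(pda_step C)\<^sup>*\<^sup>* (PRun v t' (pda_start (M v)), x @ rest, [Some (pda_bottom (M v)), None])
         (PRun v t' q, rest, map Some z @ [None])" and z: "z \<in> lists (pda_stack (M v))"
      using run[OF x(3) Snoc(2) bot, of rest] by (auto simp: x)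
    obtain Z zs where Z: "map Some z @ [None] = Z # zs" "Z \<in> G"
    proof (cases z)
      case Nil
      then show ?thesis using that[of None "[]"] by (simp add: G_def)
    next
      case (Cons a z')
      then have "a \<in> pda_stack (M v)" using z by simp
      then have "Some a \<in> G" using Snoc(2) unfolding G_def by blast
      with Cons show ?thesis using that[of "Some a" "map Some z' @ [None]"] by simp
    qed
    note Snoc.IH[of "x @ rest"]
    also have "pda_step C (PNode t, x @ rest, [None]) (PRun v t' (pda_start (M v)), x @ rest, [Some (pda_bottom (M v)), None])"
      by (rule pda_step_epsI[where zs = "[Some (pda_bottom (M v)), None]"]) (auto intro!: TI simp: tr_def transC)
    also note r
    also have "pda_step C (PRun v t' q, rest, map Some z @ [None]) (Drain t', rest, map Some z @ [None])"
      unfolding Z(1)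
      by (rule pda_step_epsI[where zs = "[Z]"]) (use x(2) Z(2) in \<open>auto intro!: TI simp: tr_def transC\<close>)
    also note drain[OF z Snoc(2)]
    also have "pda_step C (Drain t', rest, [None]) (PNode t', rest, [None])"
      by (rule pda_step_epsI[where zs = "[None]"]) (auto intro!: TI simp: tr_def transC)
    finally show ?case by simp
  qed simp
  have "subst_lang D ?K s0 F = pda_lang Y C" (is "?A = ?B")
  proof (intro Set.set_eqI iffI)
    fix w assume "w \<in> ?A"
    then obtain t where t: "t \<in> F" "path_lang D ?K s0 w t" by (auto simp: subst_lang_def)
    have "w \<in> lists Y"
    proof (rule path_lang_lists[OF t(2)])
      fix s v t assume "(s, v, t) \<in> D"
      from map_in_lists[OF f[OF this]] LM[OF this] show "map (f v) ` L v \<subseteq> lists Y"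
        by (auto simp: pda_lang_def)
    qed
    moreover have "t \<in> S" using t(2) S by cases auto
    ultimately show "w \<in> ?B"
    proof -
      have "(pda_step C)\<^sup>*\<^sup>* (pda_start C, w, [pda_bottom C]) (PNode t, [], [None])"
        using complete[OF t(2), of "[]"] by (simp add: C_def)
      moreover have "PNode t \<in> pda_final C" using t(1) \<open>t \<in> S\<close> by (simp add: C_def)
      ultimately show ?thesis using \<open>w \<in> lists Y\<close> unfolding pda_lang_def by blast
    qed
  next
    fix w assume "w \<in> ?B"
    then obtain t st where "t \<in> F" "(pda_step C)\<^sup>*\<^sup>* (PNode s0, w, [None]) (PNode t, [], st)"
      by (auto simp: pda_lang_def C_def)
    with sound[OF this(2)] show "w \<in> ?A"
      unfolding subst_lang_def I_def pda_frame.case by auto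
  qed
  with context_freeI[OF over] show ?thesis by simp
qed

section \<open>Turing machines\<close>

text \<open>
  The tape after writing \<open>b\<close> and moving, where \<open>r\<close> is the part strictly to the right of the head. It lets
  one equation describe the three kinds of moves.
\<close>

fun write_move :: "move \<Rightarrow> ('a, 'g) cell \<Rightarrow> ('a, 'g) cell list \<Rightarrow> ('a, 'g) cell list
    \<Rightarrow> ('a, 'g) cell list \<times> ('a, 'g) cell list" where
  "write_move MoveLeft b l r = (tl l, scan l # b # r)"
| "write_move Stay b l r = (l, b # r)"
| "write_move MoveRight b l r = (b # l, r)"

lemma scan_simps [simp]: "scan [] = Blank" "scan (c # cs) = c"
  by (simp_all add: scan_def)

lemma tm_step_iff:
  "tm_step M (l, p, r) (l', q, r') \<longleftrightarrow>
     (\<exists>b m. (p, scan r, q, b, m) \<in> tm_trans M \<and> (l', r') = write_move m b l (tl r))" (is "?l \<longleftrightarrow> ?r")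
proof
  assume ?l
  then show ?r by cases force+
next
  assume ?r
  then obtain b m where "(p, scan r, q, b, m) \<in> tm_trans M" "(l', r') = write_move m b l (tl r)"
    by blast
  then show ?l by (cases m) (auto intro: tm_step.intros)
qed

lemma tm_stepI:
  "(p, a, q, b, m) \<in> tm_trans M \<Longrightarrow> (l', r') = write_move m b l r \<Longrightarrow> tm_step M (l, p, a # r) (l', q, r')"
  unfolding tm_step_iff by auto

lemma tm_sweep:
  assumes "\<And>x. x \<in> set xs \<Longrightarrow> (p, g x, p, h x, MoveRight) \<in> tm_trans M"
  shows "(tm_step M)\<^sup>*\<^sup>* (l, p, map g xs @ r) (rev (map h xs) @ l, p, r)"
  using assms
proof (induction xs arbitrary: l)
  case (Cons x xs)
  have "tm_step M (l, p, map g (x # xs) @ r) (h x # l, p, map g xs @ r)"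
    unfolding list.map append.simps by (rule tm_stepI) (use Cons.prems in auto)
  also have "(tm_step M)\<^sup>*\<^sup>* \<dots> (rev (map h xs) @ h x # l, p, r)"
    by (rule Cons.IH) (use Cons.prems in auto)
  finally show ?case by simp
qed simp

definition accepts :: "('q, 'a, 'g) tm \<Rightarrow> ('a, 'g) cell list \<Rightarrow> bool" where
  "accepts M cs \<longleftrightarrow> (\<exists>q\<in>tm_final M. \<exists>l r. (tm_step M)\<^sup>*\<^sup>* ([], tm_start M, cs) (l, q, r))"

lemma tm_lang_accepts: "tm_lang X M = {w \<in> lists X. accepts M (map Letter w)}"
  by (simp add: tm_lang_def accepts_def)

lemma lba_lang_accepts:
  "lba_lang X M = {w \<in> lists X. accepts M (LeftEnd # map Letter w @ [RightEnd])}"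
  by (simp add: lba_lang_def accepts_def)

lemma lba_overI:
  assumes "tm_over X M" "{LeftEnd, RightEnd} \<subseteq> tm_tape M"
    and "\<And>p a q b m. (p, a, q, b, m) \<in> tm_trans M \<Longrightarrow> (a = LeftEnd \<longleftrightarrow> b = LeftEnd) \<and> (a = RightEnd \<longleftrightarrow> b = RightEnd) \<and>
        (a = LeftEnd \<longrightarrow> m \<noteq> MoveLeft) \<and> (a = RightEnd \<longrightarrow> m \<noteq> MoveRight)"
  shows "lba_over X M"
  unfolding lba_over_def
proof (intro conjI ballI)
  fix t assume "t \<in> tm_trans M"
  then show "case t of (p, a, q, b, m) \<Rightarrow> (a = LeftEnd \<longleftrightarrow> b = LeftEnd) \<and> (a = RightEnd \<longleftrightarrow> b = RightEnd) \<and>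
        (a = LeftEnd \<longrightarrow> m \<noteq> MoveLeft) \<and> (a = RightEnd \<longrightarrow> m \<noteq> MoveRight)"
    using assms(3) by (cases t) blast
qed (rule assms)+

definition rename_tm :: "('q \<Rightarrow> 'p) \<Rightarrow> ('g \<Rightarrow> 'h) \<Rightarrow> ('q, 'a, 'g) tm \<Rightarrow> ('p, 'a, 'h) tm" where
  "rename_tm f g M = \<lparr>tm_states = f ` tm_states M, tm_tape = map_cell id g ` tm_tape M,
     tm_start = f (tm_start M), tm_final = f ` tm_final M,
     tm_trans = (\<lambda>(p, a, q, b, m). (f p, map_cell id g a, f q, map_cell id g b, m)) ` tm_trans M\<rparr>"

lemma map_cell_scan [simp]: "scan (map (map_cell h g) r) = map_cell h g (scan r)"
  by (cases r) auto

lemma write_move_map: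
  "write_move m (map_cell h g b) (map (map_cell h g) l) (map (map_cell h g) r) =
     map_prod (map (map_cell h g)) (map (map_cell h g)) (write_move m b l r)"
  by (cases m) (auto simp: map_tl)

lemma write_move_subset:
  "write_move m b l r = (l', r') \<Longrightarrow> set l \<union> set r \<union> {b, Blank} \<subseteq> A \<Longrightarrow> set l' \<union> set r' \<subseteq> A"
  by (cases m; cases l) auto

lemma rename_tm_trans:
  "(p, a, q, b, m) \<in> tm_trans M \<Longrightarrow> (f p, map_cell id g a, f q, map_cell id g b, m) \<in> tm_trans (rename_tm f g M)"
  by (force simp: rename_tm_def)

lemma rename_tm_step:
  fixes M :: "('q, 'a, 'g) tm" and f :: "'q \<Rightarrow> 'p" and g :: "'g \<Rightarrow> 'h"
  assumes "tm_step M (l, p, r) (l', q, r')"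
  shows "tm_step (rename_tm f g M) (map (map_cell id g) l, f p, map (map_cell id g) r)
     (map (map_cell id g) l', f q, map (map_cell id g) r')"
proof -
  define h where "h = map (map_cell id g :: ('a, 'g) cell \<Rightarrow> ('a, 'h) cell)"
  from assms obtain b m where *: "(p, scan r, q, b, m) \<in> tm_trans M" "(l', r') = write_move m b l (tl r)"
    unfolding tm_step_iff by blast
  have "(h l', h r') = map_prod h h (l', r')" by simp
  also have "\<dots> = write_move m (map_cell id g b) (h l) (tl (h r))"
    unfolding *(2) h_def by (simp add: write_move_map map_tl [symmetric])
  finally show ?thesis
    unfolding tm_step_iff using rename_tm_trans[OF *(1), of f g] unfolding h_def map_cell_scan by blast
qed

text \<open>
  Injectivity is needed on the states and cells of the machine only, and a run never leaves them. This
  is why the lemma also records that the new configuration consists of states and cells of the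
  machine.
\<close>

lemma rename_tm_step_inv:
  fixes M :: "('q, 'a, 'g) tm" and f :: "'q \<Rightarrow> 'p" and g :: "'g \<Rightarrow> 'h"
  assumes step: "tm_step (rename_tm f g M) (map (map_cell id g) l, f p, map (map_cell id g) r) (l'', q', r'')"
    and over: "tm_over X M" and f: "inj_on f (tm_states M)" and h: "inj_on (map_cell id g) (tm_tape M)"
    and p: "p \<in> tm_states M" and lr: "set l \<union> set r \<subseteq> tm_tape M"
  shows "\<exists>l' q r'. l'' = map (map_cell id g) l' \<and> q' = f q \<and> r'' = map (map_cell id g) r' \<and>
    q \<in> tm_states M \<and> set l' \<union> set r' \<subseteq> tm_tape M \<and> tm_step M (l, p, r) (l', q, r')"
proof -
  let ?h = "map_cell id g :: ('a, 'g) cell \<Rightarrow> ('a, 'h) cell"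
  from step obtain b' m where *: "(f p, ?h (scan r), q', b', m) \<in> tm_trans (rename_tm f g M)"
     "(l'', r'') = write_move m b' (map ?h l) (tl (map ?h r))"
    unfolding tm_step_iff by auto
  then obtain p0 a q b where tr: "(p0, a, q, b, m) \<in> tm_trans M" "f p0 = f p" "?h a = ?h (scan r)"
      "q' = f q" "b' = ?h b"
    by (auto simp: rename_tm_def)
  have in_M: "p0 \<in> tm_states M" "q \<in> tm_states M" "a \<in> tm_tape M" "b \<in> tm_tape M" "Blank \<in> tm_tape M"
    using over tr(1) by (auto simp: tm_over_def)
  have "p0 = p" using inj_onD[OF f tr(2)] in_M p by simp
  moreover have "scan r \<in> tm_tape M" using lr in_M by (cases r) auto
  then have "a = scan r" using inj_onD[OF h tr(3)] in_M by simp
  ultimately have t: "(p, scan r, q, b, m) \<in> tm_trans M" using tr(1) by simp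
  obtain l' r' where w: "write_move m b l (tl r) = (l', r')" by (cases "write_move m b l (tl r)")
  have "(l'', r'') = map_prod (map ?h) (map ?h) (l', r')"
    using *(2) unfolding tr(5) w[symmetric] by (simp add: write_move_map map_tl [symmetric])
  moreover have "tm_step M (l, p, r) (l', q, r')"
    unfolding tm_step_iff using t w by metis
  moreover have "set l' \<union> set r' \<subseteq> tm_tape M"
    by (rule write_move_subset[OF w]) (use lr in_M in \<open>cases r; auto\<close>)
  ultimately show ?thesis using in_M tr(4) by auto
qed

lemma rename_tm_accepts:
  fixes M :: "('q, 'a, 'g) tm" and f :: "'q \<Rightarrow> 'p" and g :: "'g \<Rightarrow> 'h"
  assumes over: "tm_over X M" and f: "inj_on f (tm_states M)" and h: "inj_on (map_cell id g) (tm_tape M)"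
    and cs: "set cs \<subseteq> tm_tape M"
  shows "accepts (rename_tm f g M) (map (map_cell id g) cs) \<longleftrightarrow> accepts M cs"
proof
  let ?M = "rename_tm f g M" and ?h = "map_cell id g :: ('a, 'g) cell \<Rightarrow> ('a, 'h) cell"
  have fin: "tm_final M \<subseteq> tm_states M" and st: "tm_start M \<in> tm_states M"
    using over by (auto simp: tm_over_def)
  {
    assume "accepts ?M (map ?h cs)"
    then obtain q l r where q: "q \<in> tm_final M" and
      run: "(tm_step ?M)\<^sup>*\<^sup>* (map ?h [], f (tm_start M), map ?h cs) (l, f q, r)"
      by (auto simp: accepts_def rename_tm_def)
    have "\<exists>l' q r'. l'' = map ?h l' \<and> q' = f q \<and> r'' = map ?h r' \<and>
      q \<in> tm_states M \<and> set l' \<union> set r' \<subseteq> tm_tape M \<and> (tm_step M)\<^sup>*\<^sup>* ([], tm_start M, cs) (l', q, r')"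
      if "(tm_step ?M)\<^sup>*\<^sup>* (map ?h [], f (tm_start M), map ?h cs) (l'', q', r'')" for l'' q' r''
      using that
    proof (induction "(map ?h [], f (tm_start M), map ?h cs)" "(l'', q', r'')" arbitrary: l'' q' r''
        rule: rtranclp.induct)
      case rtrancl_refl
      show ?case
        by (rule exI[of _ "[]"], rule exI[of _ "tm_start M"], rule exI[of _ cs]) (use st cs in simp)
    next
      case (rtrancl_into_rtrancl c)
      obtain l1 q1 r1 where c: "c = (l1, q1, r1)" by (cases c)
      from rtrancl_into_rtrancl(2)[OF c] obtain l' q r' where
        *: "l1 = map ?h l'" "q1 = f q" "r1 = map ?h r'" "q \<in> tm_states M" "set l' \<union> set r' \<subseteq> tm_tape M"
          and run: "(tm_step M)\<^sup>*\<^sup>* ([], tm_start M, cs) (l', q, r')"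
        by blast
      have "tm_step ?M (map ?h l', f q, map ?h r') (l'', q', r'')"
        using rtrancl_into_rtrancl(3) c *(1-3) by simp
      from rename_tm_step_inv[OF this over f h *(4,5)] obtain l2 q2 r2 where
        "l'' = map ?h l2" "q' = f q2" "r'' = map ?h r2" "q2 \<in> tm_states M" "set l2 \<union> set r2 \<subseteq> tm_tape M"
        and "tm_step M (l', q, r') (l2, q2, r2)"
        by blast
      with rtranclp.rtrancl_into_rtrancl[OF run this(6)] show ?case by blast
    qed
    from this[OF run] obtain l' q1 r' where "f q = f q1" "q1 \<in> tm_states M"
      "(tm_step M)\<^sup>*\<^sup>* ([], tm_start M, cs) (l', q1, r')"
      by blast
    moreover from this have "q1 = q" using inj_onD[OF f] fin q by blast
    ultimately show "accepts M cs" using q by (auto simp: accepts_def)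
  next
    assume "accepts M cs"
    then obtain q l r where q: "q \<in> tm_final M" "(tm_step M)\<^sup>*\<^sup>* ([], tm_start M, cs) (l, q, r)"
      by (auto simp: accepts_def)
    have "(tm_step ?M)\<^sup>*\<^sup>* ([], f (tm_start M), map ?h cs) (map ?h l, f q, map ?h r)"
      if "(tm_step M)\<^sup>*\<^sup>* ([], tm_start M, cs) (l, q, r)" for l q r
      using that
    proof (induction "([] :: ('a, 'g) cell list, tm_start M, cs)" "(l, q, r)" arbitrary: l q r rule: rtranclp.induct)
      case (rtrancl_into_rtrancl c)
      then show ?case
        by (cases c) (blast intro: rtranclp.rtrancl_into_rtrancl rename_tm_step)
    qed simp
    from this[OF q(2)] q(1) show "accepts ?M (map ?h cs)"
      by (auto simp: accepts_def rename_tm_def)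
  }
qed

lemma tm_renaming:
  assumes over: "tm_over X (M :: ('q, 'a, 'g) tm)"
  obtains M' :: "(nat, 'a, nat) tm" and g where "tm_over X M'" "lba_over X M \<Longrightarrow> lba_over X M'"
    "\<And>cs. set cs \<subseteq> tm_tape M \<Longrightarrow> accepts M' (map (map_cell id g) cs) \<longleftrightarrow> accepts M cs"
proof -
  obtain f :: "'q \<Rightarrow> nat" where f: "inj_on f (tm_states M)"
    using over finite_inj_nat unfolding tm_over_def by metis
  define W where "W = {g. Work g \<in> tm_tape M}"
  have "finite (Work -` tm_tape M)"
    using over by (auto simp: tm_over_def intro!: finite_vimageI injI)
  then have "finite W" by (simp add: W_def vimage_def)
  then obtain g :: "'g \<Rightarrow> nat" where g: "inj_on g W"
    using finite_inj_nat by metis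
  let ?h = "map_cell id g :: ('a, 'g) cell \<Rightarrow> ('a, nat) cell"
  have h: "inj_on ?h (tm_tape M)"
  proof (rule inj_onI)
    fix c d assume "c \<in> tm_tape M" "d \<in> tm_tape M" "?h c = ?h d"
    then show "c = d" using inj_onD[OF g] by (cases c; cases d) (auto simp: W_def)
  qed
  have ov: "tm_over X (rename_tm f g M)"
  proof -
    have "Letter ` X \<union> {Blank} \<subseteq> ?h ` tm_tape M"
    proof
      fix c :: "('a, nat) cell" assume "c \<in> Letter ` X \<union> {Blank}"
      then consider x where "c = ?h (Letter x)" "Letter x \<in> tm_tape M" | "c = ?h Blank" "Blank \<in> tm_tape M"
        using over by (auto simp: tm_over_def)
      then show "c \<in> ?h ` tm_tape M" by cases (simp_all only: imageI)
    qed
    moreover have "(f p, ?h a, f q, ?h b, m) \<in>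
        f ` tm_states M \<times> ?h ` tm_tape M \<times> f ` tm_states M \<times> ?h ` tm_tape M \<times> UNIV"
      if "(p, a, q, b, m) \<in> tm_trans M" for p a q b m
      using over that unfolding tm_over_def by blast
    then have "tm_trans (rename_tm f g M) \<subseteq>
        f ` tm_states M \<times> ?h ` tm_tape M \<times> f ` tm_states M \<times> ?h ` tm_tape M \<times> UNIV"
      unfolding rename_tm_def tm.simps
      by (intro image_subsetI) (simp only: split_paired_all prod.case)
    moreover have "finite (tm_states M)" "finite (tm_tape M)" "tm_start M \<in> tm_states M" "tm_final M \<subseteq> tm_states M"
      using over by (auto simp: tm_over_def)
    ultimately show ?thesis
      unfolding tm_over_def by (simp add: rename_tm_def image_mono)
  qed
  have "lba_over X (rename_tm f g M)" if lba: "lba_over X M"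
  proof -
    have ends: "?h c = LeftEnd \<longleftrightarrow> c = LeftEnd" "?h c = RightEnd \<longleftrightarrow> c = RightEnd" for c
      by (cases c; simp)+
    have "{LeftEnd, RightEnd} \<subseteq> ?h ` tm_tape M"
    proof -
      have "{LeftEnd, RightEnd} \<subseteq> tm_tape M" using lba by (simp add: lba_over_def)
      then have "{?h LeftEnd, ?h RightEnd} \<subseteq> ?h ` tm_tape M" by blast
      then show ?thesis by simp
    qed
    moreover have "(a = LeftEnd \<longleftrightarrow> b = LeftEnd) \<and> (a = RightEnd \<longleftrightarrow> b = RightEnd) \<and>
        (a = LeftEnd \<longrightarrow> m \<noteq> MoveLeft) \<and> (a = RightEnd \<longrightarrow> m \<noteq> MoveRight)"
      if "(p, a, q, b, m) \<in> tm_trans M" for p a q b m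
      using lba that unfolding lba_over_def by auto
    then have "\<forall>(p, a, q, b, m) \<in> tm_trans (rename_tm f g M).
        (a = LeftEnd \<longleftrightarrow> b = LeftEnd) \<and> (a = RightEnd \<longleftrightarrow> b = RightEnd) \<and>
        (a = LeftEnd \<longrightarrow> m \<noteq> MoveLeft) \<and> (a = RightEnd \<longrightarrow> m \<noteq> MoveRight)"
      unfolding rename_tm_def tm.simps ball_simps
      by (intro ballI) (simp only: split_paired_all prod.case ends, simp)
    ultimately show ?thesis unfolding lba_over_def using ov by (simp add: rename_tm_def)
  qed
  with that[OF ov _ rename_tm_accepts[OF over f h]] show thesis by blast
qed

lemma context_sensitiveI:
  assumes M: "lba_over X M"
  shows "lba_lang X M \<in> languages CS X"
proof -
  have over: "tm_over X M" using M by (simp add: lba_over_def)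
  obtain M' :: "(nat, 'a, nat) tm" and g where M': "lba_over X M'"
    and acc: "\<And>cs. set cs \<subseteq> tm_tape M \<Longrightarrow> accepts M' (map (map_cell id g) cs) \<longleftrightarrow> accepts M cs"
    using tm_renaming[OF over] M by metis
  have "accepts M' (LeftEnd # map Letter w @ [RightEnd]) \<longleftrightarrow> accepts M (LeftEnd # map Letter w @ [RightEnd])"
    if "w \<in> lists X" for w
    using acc[of "LeftEnd # map Letter w @ [RightEnd]"] M that by (auto simp: lba_over_def tm_over_def o_def)
  then have "lba_lang X M' = lba_lang X M" by (auto simp: lba_lang_accepts)
  with M' show ?thesis by auto
qed

lemma recursively_enumerableI:
  assumes M: "tm_over X M"
  shows "tm_lang X M \<in> languages RE X"
proof -
  obtain M' :: "(nat, 'a, nat) tm" and g where M': "tm_over X M'"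
    and acc: "\<And>cs. set cs \<subseteq> tm_tape M \<Longrightarrow> accepts M' (map (map_cell id g) cs) \<longleftrightarrow> accepts M cs"
    using tm_renaming[OF M] by metis
  have "accepts M' (map Letter w) \<longleftrightarrow> accepts M (map Letter w)" if "w \<in> lists X" for w
    using acc[of "map Letter w"] M that by (auto simp: tm_over_def o_def)
  then have "tm_lang X M' = tm_lang X M" by (auto simp: tm_lang_accepts)
  with M' show ?thesis by auto
qed

section \<open>Context-sensitive languages\<close>

text \<open>
  Where the simulated head stands: on one of the virtual endmarkers of the current factor or on a cell
  of the factor. The endmarkers have no cells on the tape. While the simulated head is on one of them,
  the real head rests on the neighbouring cell of the factor.
\<close>

datatype side = AtLeft | Inside | AtRight

text \<open>
  The phases of processing a factor: at \<open>Begin s\<close> the head is on the first cell after the factors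
  processed so far; \<open>Mark\<close> guesses the extent of the next factor and the preimages of its letters (its
  flag says that the first cell is not yet marked); \<open>Rewind\<close> returns to the first cell; \<open>Sim\<close> runs the
  machine of the edge label; \<open>Finish\<close> moves past the last cell.
\<close>

datatype ('s, 'v, 'q) lba_frame =
  Init | Begin 's | Mark 'v 's bool | Rewind 'v 's | Sim 'v 's 'q side | Finish 's | Accept

text \<open>
  A move of the simulated head as the new side and the real move. The two flags say whether the scanned
  cell is the first or the last one of the factor.
\<close>

fun bounded_move :: "bool \<Rightarrow> bool \<Rightarrow> move \<Rightarrow> side \<times> move" where
  "bounded_move True _ MoveLeft = (AtLeft, Stay)"
| "bounded_move _ True MoveRight = (AtRight, Stay)"
| "bounded_move _ _ m = (Inside, m)"

text \<open>
  The cells of a factor left of the head, nearest first, and right of the head. Each cell carries its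
  content and two flags that mark the first and the last cell of the factor.
\<close>

fun encL :: "('a, 'g) cell list \<Rightarrow> ('b, ('a, 'g) cell \<times> bool \<times> bool) cell list" where
  "encL [] = []"
| "encL (c # l) = Work (c, l = [], False) # encL l"

fun encR :: "('a, 'g) cell list \<Rightarrow> ('b, ('a, 'g) cell \<times> bool \<times> bool) cell list" where
  "encR [] = []"
| "encR (c # r) = Work (c, False, r = []) # encR r"

locale lba_subst =
  fixes D :: "('s \<times> 'v \<times> 's) set" and s0 :: 's and F :: "'s set"
    and X :: "'v \<Rightarrow> 'a set" and Y :: "'b set" and f :: "'v \<Rightarrow> 'a \<Rightarrow> 'b"
    and M :: "'v \<Rightarrow> ('q, 'a, 'g) tm"
  assumes D: "finite D" and Y: "finite Y"
    and M: "(s, v, t) \<in> D \<Longrightarrow> lba_over (X v) (M v)"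
    and f: "(s, v, t) \<in> D \<Longrightarrow> f v ` X v \<subseteq> Y"
    and nonempty: "(s, v, t) \<in> D \<Longrightarrow> [] \<notin> lba_lang (X v) (M v)"
begin

text \<open>
  The contents that the cells of a factor can have: endmarkers are neither written nor overwritten.
\<close>

definition inner :: "'v \<Rightarrow> ('a, 'g) cell set" where
  "inner v = tm_tape (M v) - {LeftEnd, RightEnd}"

definition verts :: "'s set" where
  "verts = insert s0 (fst ` D \<union> (snd \<circ> snd) ` D)"

inductive composite_trans :: "('s, 'v, 'q) lba_frame \<Rightarrow> ('b, ('a, 'g) cell \<times> bool \<times> bool) cell
    \<Rightarrow> ('s, 'v, 'q) lba_frame \<Rightarrow> ('b, ('a, 'g) cell \<times> bool \<times> bool) cell \<Rightarrow> move \<Rightarrow> bool" where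
  init: "composite_trans Init LeftEnd (Begin s0) LeftEnd MoveRight"
| accept: "s \<in> F \<Longrightarrow> s \<in> verts \<Longrightarrow> composite_trans (Begin s) RightEnd Accept RightEnd Stay"
| enter: "(s, v, t) \<in> D \<Longrightarrow> y \<in> Y \<Longrightarrow> composite_trans (Begin s) (Letter y) (Mark v t True) (Letter y) Stay"
| mark: "(s, v, t) \<in> D \<Longrightarrow> x \<in> X v \<Longrightarrow>
    composite_trans (Mark v t b) (Letter (f v x)) (Mark v t False) (Work (Letter x, b, False)) MoveRight"
| mark_last: "(s, v, t) \<in> D \<Longrightarrow> x \<in> X v \<Longrightarrow>
    composite_trans (Mark v t b) (Letter (f v x)) (Rewind v t) (Work (Letter x, b, True)) Stay"
| rewind: "(s, v, t) \<in> D \<Longrightarrow> c \<in> inner v \<Longrightarrow>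
    composite_trans (Rewind v t) (Work (c, False, b)) (Rewind v t) (Work (c, False, b)) MoveLeft"
| start: "(s, v, t) \<in> D \<Longrightarrow> c \<in> inner v \<Longrightarrow>
    composite_trans (Rewind v t) (Work (c, True, b)) (Sim v t (tm_start (M v)) AtLeft) (Work (c, True, b)) Stay"
| sim_left: "(s, v, t) \<in> D \<Longrightarrow> c \<in> inner v \<Longrightarrow> (p, LeftEnd, q, LeftEnd, m) \<in> tm_trans (M v) \<Longrightarrow>
    composite_trans (Sim v t p AtLeft) (Work (c, True, b))
      (Sim v t q (if m = MoveRight then Inside else AtLeft)) (Work (c, True, b)) Stay"
| sim_right: "(s, v, t) \<in> D \<Longrightarrow> c \<in> inner v \<Longrightarrow> (p, RightEnd, q, RightEnd, m) \<in> tm_trans (M v) \<Longrightarrow>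
    composite_trans (Sim v t p AtRight) (Work (c, b, True))
      (Sim v t q (if m = MoveLeft then Inside else AtRight)) (Work (c, b, True)) Stay"
| sim: "(s, v, t) \<in> D \<Longrightarrow> c \<in> inner v \<Longrightarrow> d \<in> inner v \<Longrightarrow> (p, c, q, d, m) \<in> tm_trans (M v) \<Longrightarrow>
    bounded_move b b' m = (i, m') \<Longrightarrow>
    composite_trans (Sim v t p Inside) (Work (c, b, b')) (Sim v t q i) (Work (d, b, b')) m'"
| leave: "(s, v, t) \<in> D \<Longrightarrow> c \<in> inner v \<Longrightarrow> p \<in> tm_final (M v) \<Longrightarrow>
    composite_trans (Sim v t p i) (Work (c, b)) (Finish t) (Work (c, b)) Stay"
| skip: "(s, v, t) \<in> D \<Longrightarrow> (s', v', t') \<in> D \<Longrightarrow> c \<in> inner v' \<Longrightarrow>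
    composite_trans (Finish t) (Work (c, b, False)) (Finish t) (Work (c, b, False)) MoveRight"
| finish: "(s, v, t) \<in> D \<Longrightarrow> (s', v', t') \<in> D \<Longrightarrow> c \<in> inner v' \<Longrightarrow>
    composite_trans (Finish t) (Work (c, b, True)) (Begin t) (Work (c, b, True)) MoveRight"

definition composite :: "(('s, 'v, 'q) lba_frame, 'b, ('a, 'g) cell \<times> bool \<times> bool) tm" where
  "composite = \<lparr>tm_states = {Init, Accept} \<union> Begin ` verts \<union> Finish ` verts \<union>
       (\<Union>(s, v, t)\<in>D. Mark v t ` UNIV \<union> {Rewind v t} \<union>
          (\<lambda>(p, i). Sim v t p i) ` (tm_states (M v) \<times> {AtLeft, Inside, AtRight})),
     tm_tape = {Blank, LeftEnd, RightEnd} \<union> Letter ` Y \<union> (\<Union>(s, v, t)\<in>D. Work ` (inner v \<times> UNIV)),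
     tm_start = Init, tm_final = {Accept},
     tm_trans = {(p, a, q, b, m). composite_trans p a q b m}\<rparr>"

abbreviation reaches where "reaches \<equiv> (tm_step composite)\<^sup>*\<^sup>*"

lemma inner_letter: "(s, v, t) \<in> D \<Longrightarrow> x \<in> X v \<Longrightarrow> Letter x \<in> inner v"
  using M[of s v t] by (auto simp: inner_def lba_over_def tm_over_def)

lemma trans_M:
  assumes "(s, v, t) \<in> D" "(p, a, q, b, m) \<in> tm_trans (M v)"
  shows "p \<in> tm_states (M v)" "q \<in> tm_states (M v)" "a \<in> tm_tape (M v)" "b \<in> tm_tape (M v)"
    "a = LeftEnd \<longleftrightarrow> b = LeftEnd" "a = RightEnd \<longleftrightarrow> b = RightEnd"
    "a = LeftEnd \<Longrightarrow> m \<noteq> MoveLeft" "a = RightEnd \<Longrightarrow> m \<noteq> MoveRight"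
  using M[OF assms(1)] assms(2) unfolding lba_over_def tm_over_def by auto

lemma verts: "s0 \<in> verts" "(s, v, t) \<in> D \<Longrightarrow> s \<in> verts" "(s, v, t) \<in> D \<Longrightarrow> t \<in> verts"
  unfolding verts_def by force+

lemma composite_states:
  "Init \<in> tm_states composite" "Accept \<in> tm_states composite"
  "s \<in> verts \<Longrightarrow> Begin s \<in> tm_states composite" "s \<in> verts \<Longrightarrow> Finish s \<in> tm_states composite"
  "(s, v, t) \<in> D \<Longrightarrow> Mark v t b \<in> tm_states composite"
  "(s, v, t) \<in> D \<Longrightarrow> Rewind v t \<in> tm_states composite"
  "(s, v, t) \<in> D \<Longrightarrow> p \<in> tm_states (M v) \<Longrightarrow> Sim v t p i \<in> tm_states composite"
proof -
  show "Sim v t p i \<in> tm_states composite" if "(s, v, t) \<in> D" "p \<in> tm_states (M v)"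
    unfolding composite_def tm.simps
    by (intro UnI2 UN_I[OF that(1)]) (use that(2) in \<open>cases i; auto\<close>)
  show "Mark v t b \<in> tm_states composite" "Rewind v t \<in> tm_states composite" if "(s, v, t) \<in> D"
    unfolding composite_def tm.simps by (intro UnI2 UN_I[OF that]; simp)+
qed (auto simp: composite_def)

lemma composite_tape:
  "Blank \<in> tm_tape composite" "LeftEnd \<in> tm_tape composite" "RightEnd \<in> tm_tape composite"
  "y \<in> Y \<Longrightarrow> Letter y \<in> tm_tape composite"
  "(s, v, t) \<in> D \<Longrightarrow> c \<in> inner v \<Longrightarrow> Work (c, b) \<in> tm_tape composite"
  unfolding composite_def tm.simps by (simp_all, blast)

lemma composite_trans_over:
  "composite_trans p a q b m \<Longrightarrow> p \<in> tm_states composite \<and> a \<in> tm_tape composite \<and> q \<in> tm_states composite \<and>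
     b \<in> tm_tape composite \<and> (a = LeftEnd \<longleftrightarrow> b = LeftEnd) \<and> (a = RightEnd \<longleftrightarrow> b = RightEnd) \<and>
     (a = LeftEnd \<longrightarrow> m \<noteq> MoveLeft) \<and> (a = RightEnd \<longrightarrow> m \<noteq> MoveRight)"
proof (induction rule: composite_trans.induct)
  case (mark s v t x b)
  then have "f v x \<in> Y" using f by blast
  with mark show ?case
    using inner_letter by (auto intro!: composite_states composite_tape)
next
  case (mark_last s v t x b)
  then have "f v x \<in> Y" using f by blast
  with mark_last show ?case
    using inner_letter by (auto intro!: composite_states composite_tape)
next
  case (start s v t c b)
  then have "tm_start (M v) \<in> tm_states (M v)" using M by (auto simp: lba_over_def tm_over_def)
  with start show ?case by (auto intro!: composite_states composite_tape)
next
  case (leave s v t c p i b)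
  then have "p \<in> tm_states (M v)" using M[of s v t] by (auto simp: lba_over_def tm_over_def)
  with leave show ?case using verts by (auto intro!: composite_states composite_tape)
next
  case (skip s v t s' v' t' c b)
  then show ?case
    using composite_tape(5)[OF skip(2,3)] verts by (auto intro!: composite_states)
next
  case (finish s v t s' v' t' c b)
  then show ?case
    using composite_tape(5)[OF finish(2,3)] verts by (auto intro!: composite_states)
qed (auto intro!: composite_states composite_tape dest: trans_M(1,2) intro: verts)

lemma composite_over: "lba_over Y composite"
proof -
  have "finite verts" using D by (simp add: verts_def)
  moreover have "finite (inner v)" "finite (tm_states (M v))" if "(s, v, t) \<in> D" for s v t
    using M[OF that] by (simp_all add: inner_def lba_over_def tm_over_def)
  ultimately have fin: "finite (tm_states composite)" "finite (tm_tape composite)"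
    using D Y unfolding composite_def tm.simps by (auto intro!: finite_UN_I)
  have tr: "(p, a, q, b, m) \<in> tm_trans composite \<longleftrightarrow> composite_trans p a q b m" for p a q b m
    by (simp add: composite_def)
  have "tm_trans composite \<subseteq> tm_states composite \<times> tm_tape composite \<times> tm_states composite \<times> tm_tape composite \<times> UNIV"
    using composite_trans_over tr by auto
  moreover have "tm_start composite = Init" "tm_final composite = {Accept}" by (simp_all add: composite_def)
  ultimately have "tm_over Y composite"
    unfolding tm_over_def using fin by (auto intro!: composite_states composite_tape)
  then show ?thesis
  proof (rule lba_overI)
    fix p a q b m assume "(p, a, q, b, m) \<in> tm_trans composite"
    then have "composite_trans p a q b m" by (simp only: tr)
    from composite_trans_over[OF this] show "(a = LeftEnd \<longleftrightarrow> b = LeftEnd) \<and> (a = RightEnd \<longleftrightarrow> b = RightEnd) \<and>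
        (a = LeftEnd \<longrightarrow> m \<noteq> MoveLeft) \<and> (a = RightEnd \<longrightarrow> m \<noteq> MoveRight)"
      by blast
  qed (auto intro!: composite_tape)
qed

text \<open>
  Relates a configuration of the machine of the current factor to the configuration of the composite
  machine that simulates it, one rule for each side. The cells \<open>lc\<close> and \<open>rc\<close> outside the factor are
  arbitrary, which expresses that the simulation does not touch them.
\<close>

inductive embedded for v :: 'v and t :: 's
    and lc rc :: "('b, ('a, 'g) cell \<times> bool \<times> bool) cell list" where
  left: "set (c # r) \<subseteq> inner v \<Longrightarrow>
    embedded v t lc rc ([], p, LeftEnd # c # r @ [RightEnd])
      (lc, Sim v t p AtLeft, Work (c, True, r = []) # encR r @ rc)"
| inside: "set (l @ c # r) \<subseteq> inner v \<Longrightarrow>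
    embedded v t lc rc (l @ [LeftEnd], p, c # r @ [RightEnd])
      (encL l @ lc, Sim v t p Inside, Work (c, l = [], r = []) # encR r @ rc)"
| right: "set (c # l) \<subseteq> inner v \<Longrightarrow>
    embedded v t lc rc (c # l @ [LeftEnd], p, [RightEnd])
      (encL l @ lc, Sim v t p AtRight, Work (c, l = [], True) # rc)"

lemma tm_step_compositeI:
  "composite_trans p a q b m \<Longrightarrow> (l', r') = write_move m b l r \<Longrightarrow> tm_step composite (l, p, a # r) (l', q, r')"
  unfolding tm_step_iff by (auto simp: composite_def)

lemma embedded_forward:
  assumes d: "(s, v, t) \<in> D" and e: "embedded v t lc rc c c'" and step: "tm_step (M v) c d"
  shows "\<exists>d'. tm_step composite c' d' \<and> embedded v t lc rc d d'"
  using e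
proof cases
  case (left c0 r p)
  obtain l1 q r1 where dd: "d = (l1, q, r1)" by (cases d)
  from step obtain b m where tr: "(p, LeftEnd, q, b, m) \<in> tm_trans (M v)" and
    w: "(l1, r1) = write_move m b [] (c0 # r @ [RightEnd])"
    unfolding left dd tm_step_iff by auto
  have "b = LeftEnd" "m \<noteq> MoveLeft" using trans_M[OF d tr] by auto
  then have "tm_step composite c' (lc, Sim v t q (if m = MoveRight then Inside else AtLeft),
       Work (c0, True, r = []) # encR r @ rc)"
    unfolding left using left d tr by (intro tm_step_compositeI[OF sim_left]) auto
  moreover have "embedded v t lc rc d (lc, Sim v t q (if m = MoveRight then Inside else AtLeft),
       Work (c0, True, r = []) # encR r @ rc)"
    using \<open>m \<noteq> MoveLeft\<close> w left \<open>b = LeftEnd\<close> embedded.left[of c0 r v t lc rc q] embedded.inside[of "[]" c0 r v t lc rc q]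
    by (cases m) (auto simp: dd)
  ultimately show ?thesis by blast
next
  case (inside l c0 r p)
  obtain l1 q r1 where dd: "d = (l1, q, r1)" by (cases d)
  from step obtain b m where tr: "(p, c0, q, b, m) \<in> tm_trans (M v)" and
    w: "(l1, r1) = write_move m b (l @ [LeftEnd]) (r @ [RightEnd])"
    unfolding inside dd tm_step_iff by auto
  have b: "b \<in> inner v" "c0 \<in> inner v" using trans_M[OF d tr] inside(3) by (auto simp: inner_def)
  obtain i m' where im: "bounded_move (l = []) (r = []) m = (i, m')" by (cases "bounded_move (l = []) (r = []) m")
  have step': "tm_step composite c' (l2, Sim v t q i, r2)"
    if "(l2, r2) = write_move m' (Work (b, l = [], r = [])) (encL l @ lc) (encR r @ rc)" for l2 r2
    unfolding inside by (rule tm_step_compositeI[OF sim[OF d b(2,1) tr im] that])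
  show ?thesis
  proof (cases m)
    case MoveLeft
    show ?thesis
    proof (cases l)
      case Nil
      with step' im MoveLeft w inside b embedded.left[of b r v t lc rc q] show ?thesis by (auto simp: dd)
    next
      case (Cons a l')
      with step' im MoveLeft w inside b embedded.inside[of l' a "b # r" v t lc rc q] show ?thesis
        by (auto simp: dd)
    qed
  next
    case Stay
    with step' im w inside b embedded.inside[of l b r v t lc rc q] show ?thesis by (auto simp: dd)
  next
    case MoveRight
    show ?thesis
    proof (cases r)
      case Nil
      with step' im MoveRight w inside b embedded.right[of b l v t lc rc q] show ?thesis by (auto simp: dd)
    next
      case (Cons a r')
      with step' im MoveRight w inside b embedded.inside[of "b # l" a r' v t lc rc q] show ?thesis
        by (auto simp: dd)
    qed
  qed
next
  case (right c0 l p)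
  obtain l1 q r1 where dd: "d = (l1, q, r1)" by (cases d)
  from step obtain b m where tr: "(p, RightEnd, q, b, m) \<in> tm_trans (M v)" and
    w: "(l1, r1) = write_move m b (c0 # l @ [LeftEnd]) []"
    unfolding right dd tm_step_iff by auto
  have b: "b = RightEnd" "m \<noteq> MoveRight" using trans_M[OF d tr] by auto
  then have "tm_step composite c' (encL l @ lc, Sim v t q (if m = MoveLeft then Inside else AtRight),
       Work (c0, l = [], True) # rc)"
    unfolding right using right d tr by (intro tm_step_compositeI[OF sim_right]) auto
  moreover have "embedded v t lc rc d (encL l @ lc, Sim v t q (if m = MoveLeft then Inside else AtRight),
       Work (c0, l = [], True) # rc)"
    using b w right embedded.right[of c0 l v t lc rc q] embedded.inside[of l c0 "[]" v t lc rc q]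
    by (cases m) (auto simp: dd)
  ultimately show ?thesis by blast
qed

text \<open>
  The composite machine cannot do anything within a factor except simulate a step or, in a final state,
  leave the factor. Together with the previous lemma this makes the simulation exact.
\<close>

lemma embedded_backward:
  assumes e: "embedded v t lc rc c c'" and step: "tm_step composite c' d'"
  shows "(\<exists>d. tm_step (M v) c d \<and> embedded v t lc rc d d') \<or>
    (\<exists>l p r l' c0 b r'. c = (l, p, r) \<and> p \<in> tm_final (M v) \<and>
       d' = (l', Finish t, Work (c0, b, r' = []) # encR r' @ rc))"
  using e
proof cases
  case (left c0 r p)
  obtain l1 q' r1 where dd: "d' = (l1, q', r1)" by (cases d')
  from step obtain b m where tr: "composite_trans (Sim v t p AtLeft) (Work (c0, True, r = [])) q' b m" and
    w: "(l1, r1) = write_move m b lc (encR r @ rc)"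
    unfolding left dd tm_step_iff by (auto simp: composite_def)
  from tr show ?thesis
  proof cases
    case (sim_left s q m')
    have "m' \<noteq> MoveLeft" using trans_M[OF sim_left(4,6)] by auto
    show ?thesis
    proof (cases m')
      case MoveRight
      have "tm_step (M v) c ([LeftEnd], q, c0 # r @ [RightEnd])"
        unfolding left by (rule tm_stepI[OF sim_left(6)]) (simp add: MoveRight)
      moreover have "embedded v t lc rc ([LeftEnd], q, c0 # r @ [RightEnd]) d'"
        using embedded.inside[of "[]" c0 r v t lc rc q] left w sim_left MoveRight by (simp add: dd)
      ultimately show ?thesis by blast
    next
      case Stay
      have "tm_step (M v) c ([], q, LeftEnd # c0 # r @ [RightEnd])"
        unfolding left by (rule tm_stepI[OF sim_left(6)]) (simp add: Stay)
      moreover have "embedded v t lc rc ([], q, LeftEnd # c0 # r @ [RightEnd]) d'"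
        using embedded.left[of c0 r v t lc rc q] left w sim_left Stay by (simp add: dd)
      ultimately show ?thesis by blast
    qed (use \<open>m' \<noteq> MoveLeft\<close> in simp)
  next
    case (leave s)
    with w left show ?thesis by (auto simp: dd)
  qed
next
  case (inside l c0 r p)
  obtain l1 q' r1 where dd: "d' = (l1, q', r1)" by (cases d')
  from step obtain b m where tr: "composite_trans (Sim v t p Inside) (Work (c0, l = [], r = [])) q' b m" and
    w: "(l1, r1) = write_move m b (encL l @ lc) (encR r @ rc)"
    unfolding inside dd tm_step_iff by (auto simp: composite_def)
  from tr show ?thesis
  proof cases
    case (sim s d q m' i)
    have step': "tm_step (M v) c (l2, q, r2)"
      if "(l2, r2) = write_move m' d (l @ [LeftEnd]) (r @ [RightEnd])" for l2 r2
      unfolding inside tm_step_iff using sim that by auto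
    show ?thesis
    proof (cases m')
      case MoveLeft
      show ?thesis
      proof (cases l)
        case Nil
        with step' sim MoveLeft w inside embedded.left[of d r v t lc rc q] show ?thesis by (auto simp: dd)
      next
        case (Cons a l')
        with step' sim MoveLeft w inside embedded.inside[of l' a "d # r" v t lc rc q] show ?thesis
          by (auto simp: dd)
      qed
    next
      case Stay
      with step' sim w inside embedded.inside[of l d r v t lc rc q] show ?thesis by (auto simp: dd)
    next
      case MoveRight
      show ?thesis
      proof (cases r)
        case Nil
        with step' sim MoveRight w inside embedded.right[of d l v t lc rc q] show ?thesis by (auto simp: dd)
      next
        case (Cons a r')
        with step' sim MoveRight w inside embedded.inside[of "d # l" a r' v t lc rc q] show ?thesis
          by (auto simp: dd)
      qed
    qed
  next
    case (leave s)
    with w inside show ?thesis by (auto simp: dd)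
  qed
next
  case (right c0 l p)
  obtain l1 q' r1 where dd: "d' = (l1, q', r1)" by (cases d')
  from step obtain b m where tr: "composite_trans (Sim v t p AtRight) (Work (c0, l = [], True)) q' b m" and
    w: "(l1, r1) = write_move m b (encL l @ lc) rc"
    unfolding right dd tm_step_iff by (auto simp: composite_def)
  from tr show ?thesis
  proof cases
    case (sim_right s q m')
    have "m' \<noteq> MoveRight" using trans_M[OF sim_right(4,6)] by auto
    show ?thesis
    proof (cases m')
      case MoveLeft
      have "tm_step (M v) c (l @ [LeftEnd], q, c0 # [] @ [RightEnd])"
        unfolding right by (rule tm_stepI[OF sim_right(6)]) (simp add: MoveLeft)
      moreover have "embedded v t lc rc (l @ [LeftEnd], q, c0 # [] @ [RightEnd]) d'"
        using embedded.inside[of l c0 "[]" v t lc rc q] right w sim_right MoveLeft by (simp add: dd)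
      ultimately show ?thesis by blast
    next
      case Stay
      have "tm_step (M v) c (c0 # l @ [LeftEnd], q, [RightEnd])"
        unfolding right by (rule tm_stepI[OF sim_right(6)]) (simp add: Stay)
      moreover have "embedded v t lc rc (c0 # l @ [LeftEnd], q, [RightEnd]) d'"
        using embedded.right[of c0 l v t lc rc q] right w sim_right Stay by (simp add: dd)
      ultimately show ?thesis by blast
    qed (use \<open>m' \<noteq> MoveRight\<close> in simp)
  next
    case (leave s)
    with w right show ?thesis by (auto simp: dd intro!: exI[of _ "[]"])
  qed
qed

abbreviation K :: "'v \<Rightarrow> 'b list set" where
  "K v \<equiv> map (f v) ` lba_lang (X v) (M v)"

text \<open>
  What is known about the configurations reached on input \<open>w\<close>. In the rules for \<open>Begin\<close> and \<open>Finish\<close>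
  nothing is said about the cells on the left, because the head never returns to a finished factor.
\<close>

inductive invariant for w :: "'b list" where
  init: "invariant w ([], Init, LeftEnd # map Letter w @ [RightEnd])"
| enter: "path_lang D K s0 u s \<Longrightarrow> w = u @ rest \<Longrightarrow> invariant w (l, Begin s, map Letter rest @ [RightEnd])"
| mark: "path_lang D K s0 u s \<Longrightarrow> (s, v, t) \<in> D \<Longrightarrow> x \<in> lists (X v) \<Longrightarrow> w = u @ map (f v) x @ rest \<Longrightarrow>
    invariant w (encL (rev (map Letter x)) @ lc, Mark v t (x = []), map Letter rest @ [RightEnd])"
| rewind: "path_lang D K s0 u s \<Longrightarrow> (s, v, t) \<in> D \<Longrightarrow> x @ a # y \<in> lists (X v) \<Longrightarrow>
    w = u @ map (f v) (x @ a # y) @ rest \<Longrightarrow>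
    invariant w (encL (rev (map Letter x)) @ lc, Rewind v t,
      Work (Letter a, x = [], y = []) # encR (map Letter y) @ map Letter rest @ [RightEnd])"
| sim: "path_lang D K s0 u s \<Longrightarrow> (s, v, t) \<in> D \<Longrightarrow> x \<in> lists (X v) \<Longrightarrow> w = u @ map (f v) x @ rest \<Longrightarrow>
    (tm_step (M v))\<^sup>*\<^sup>* ([], tm_start (M v), LeftEnd # map Letter x @ [RightEnd]) c \<Longrightarrow>
    embedded v t lc (map Letter rest @ [RightEnd]) c c' \<Longrightarrow> invariant w c'"
| finish: "path_lang D K s0 u t \<Longrightarrow> w = u @ rest \<Longrightarrow>
    invariant w (l, Finish t, Work (c, b, r = []) # encR r @ map Letter rest @ [RightEnd])"
| accept: "path_lang D K s0 w t \<Longrightarrow> t \<in> F \<Longrightarrow> invariant w (l, Accept, r)"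

lemma step_cases:
  assumes "tm_step composite (l, p, r) c'"
  obtains b m q l' r' where "c' = (l', q, r')" "composite_trans p (scan r) q b m" "(l', r') = write_move m b l (tl r)"
  using assms by (cases c') (auto simp: tm_step_iff composite_def)

lemma letters_inner: "(s, v, t) \<in> D \<Longrightarrow> x \<in> lists (X v) \<Longrightarrow> set (map Letter x) \<subseteq> inner v"
  using inner_letter by auto

lemma invariant_step:
  assumes "invariant w c" "tm_step composite c c'"
  shows "invariant w c'"
  using assms(1)
proof cases
  case init
  from assms(2)[unfolded init] obtain b m q l' r' where c': "c' = (l', q, r')" and
    tr: "composite_trans Init LeftEnd q b m" and w: "(l', r') = write_move m b [] (map Letter w @ [RightEnd])"
    by (auto elim!: step_cases)
  from tr show ?thesis
  proof cases
    case init
    with w invariant.enter[OF path_lang.Nil, of w w "[LeftEnd]"] show ?thesis by (simp add: c')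
  qed
next
  case (enter u s rest l)
  note at_begin = this
  from assms(2)[unfolded at_begin] obtain b m q l' r' where c': "c' = (l', q, r')" and
    tr: "composite_trans (Begin s) (scan (map Letter rest @ [RightEnd])) q b m" and
    w: "(l', r') = write_move m b l (tl (map Letter rest @ [RightEnd]))"
    by (auto elim!: step_cases)
  from tr show ?thesis
  proof cases
    case accept
    then have "rest = []" by (cases rest) auto
    with accept at_begin show ?thesis by (auto simp: c' intro: invariant.accept)
  next
    case (enter v t y)
    then obtain rest' where "rest = y # rest'" by (cases rest) auto
    with enter w at_begin invariant.mark[of u s v t "[]" w rest l] show ?thesis by (auto simp: c')
  qed
next
  case (mark u s v t x rest lc)
  from assms(2)[unfolded mark] obtain b m q l' r' where c': "c' = (l', q, r')" and
    tr: "composite_trans (Mark v t (x = [])) (scan (map Letter rest @ [RightEnd])) q b m" and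
    w: "(l', r') = write_move m b (encL (rev (map Letter x)) @ lc) (tl (map Letter rest @ [RightEnd]))"
    by (auto elim!: step_cases)
  from tr show ?thesis
  proof cases
    case (mark s' a)
    then obtain rest' where "rest = f v a # rest'" by (cases rest) auto
    with mark w \<open>path_lang D K s0 u s\<close> \<open>(s, v, t) \<in> D\<close> \<open>x \<in> lists (X v)\<close> \<open>w = u @ map (f v) x @ rest\<close>
      invariant.mark[of u s v t "x @ [a]" w rest' lc]
    show ?thesis by (auto simp: c')
  next
    case (mark_last s' a)
    then obtain rest' where "rest = f v a # rest'" by (cases rest) auto
    with mark_last w mark invariant.rewind[of u s v t x a "[]" w rest' lc]
    show ?thesis by (auto simp: c')
  qed
next
  case (rewind u s v t x a y rest lc)
  from assms(2)[unfolded rewind] obtain b m q l' r' where c': "c' = (l', q, r')" and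
    tr: "composite_trans (Rewind v t) (Work (Letter a, x = [], y = [])) q b m" and
    w: "(l', r') = write_move m b (encL (rev (map Letter x)) @ lc) (encR (map Letter y) @ map Letter rest @ [RightEnd])"
    by (auto elim!: step_cases)
  from tr show ?thesis
  proof cases
    case (rewind s')
    then obtain x' a' where "x = x' @ [a']" by (cases x rule: rev_cases) auto
    with rewind w \<open>path_lang D K s0 u s\<close> \<open>(s, v, t) \<in> D\<close> \<open>x @ a # y \<in> lists (X v)\<close>
      \<open>w = u @ map (f v) (x @ a # y) @ rest\<close> invariant.rewind[of u s v t x' a' "a # y" w rest lc]
    show ?thesis by (auto simp: c')
  next
    case (start s')
    have "set (Letter a # map Letter y) \<subseteq> inner v"
      using letters_inner[OF rewind(3), of "a # y"] rewind by simp
    from embedded.left[OF this, of t lc "map Letter rest @ [RightEnd]" "tm_start (M v)"]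
    have e: "embedded v t lc (map Letter rest @ [RightEnd])
        ([], tm_start (M v), LeftEnd # map Letter (a # y) @ [RightEnd]) c'"
      using start w by (simp add: c')
    show ?thesis
      by (rule invariant.sim[OF rewind(2,3) _ _ rtranclp.rtrancl_refl e]) (use rewind start in auto)
  qed
next
  case (sim u s v t x rest c0 lc)
  from embedded_backward[OF sim(6) assms(2)] show ?thesis
  proof (elim disjE exE conjE)
    fix d assume "tm_step (M v) c0 d" "embedded v t lc (map Letter rest @ [RightEnd]) d c'"
    with sim show ?thesis by (auto intro: invariant.sim rtranclp.rtrancl_into_rtrancl)
  next
    fix l p r l' c1 b r'
    assume *: "c0 = (l, p, r)" "p \<in> tm_final (M v)"
      "c' = (l', Finish t, Work (c1, b, r' = []) # encR r' @ map Letter rest @ [RightEnd])"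
    with sim have "x \<in> lba_lang (X v) (M v)" by (auto simp: lba_lang_def)
    with sim have "path_lang D K s0 (u @ map (f v) x) t" by (auto intro: path_lang.Snoc)
    with * sim show ?thesis by (auto intro: invariant.finish)
  qed
next
  case (finish u t rest l c0 b r)
  from assms(2)[unfolded finish] obtain b' m q l' r' where c': "c' = (l', q, r')" and
    tr: "composite_trans (Finish t) (Work (c0, b, r = [])) q b' m" and
    w: "(l', r') = write_move m b' l (encR r @ map Letter rest @ [RightEnd])"
    by (auto elim!: step_cases)
  from tr show ?thesis
  proof cases
    case skip
    then obtain c1 r1 where "r = c1 # r1" by (cases r) auto
    with skip w finish invariant.finish[of u t w rest _ c1 False r1] show ?thesis by (auto simp: c')
  next
    case finish
    with w \<open>path_lang D K s0 u t\<close> \<open>w = u @ rest\<close> show ?thesis by (auto simp: c' intro: invariant.enter)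
  qed
next
  case (accept t l r)
  from assms(2)[unfolded accept] obtain b m q where "composite_trans Accept (scan r) q b m"
    by (auto elim!: step_cases)
  then show ?thesis by cases
qed

lemma invariant_steps:
  "reaches c c' \<Longrightarrow> invariant w c \<Longrightarrow> invariant w c'"
  by (induction rule: rtranclp.induct) (auto intro: invariant_step)

lemma embedded_run:
  assumes "(tm_step (M v))\<^sup>*\<^sup>* c d" "(s, v, t) \<in> D" "embedded v t lc rc c c'"
  shows "\<exists>d'. reaches c' d' \<and> embedded v t lc rc d d'"
  using assms(1)
proof induction
  case base
  then show ?case using assms(3) by blast
next
  case (step d e)
  then show ?case using embedded_forward[OF assms(2)] by (meson rtranclp.rtrancl_into_rtrancl)
qed

lemma mark_run:
  assumes d: "(s, v, t) \<in> D" and x: "x @ [a] \<in> lists (X v)"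
  shows "reaches (lc, Mark v t True, map Letter (map (f v) (x @ [a]) @ rest) @ [RightEnd])
    (encL (rev (map Letter x)) @ lc, Rewind v t, Work (Letter a, x = [], True) # map Letter rest @ [RightEnd])"
proof -
  have "reaches (lc, Mark v t True, map Letter (map (f v) x) @ r)
     (encL (rev (map Letter x)) @ lc, Mark v t (x = []), r)" if "x \<in> lists (X v)" for r
    using that
  proof (induction x arbitrary: r rule: rev_induct)
    case (snoc b y)
    have "reaches (lc, Mark v t True, map Letter (map (f v) y) @ Letter (f v b) # r)
        (encL (rev (map Letter y)) @ lc, Mark v t (y = []), Letter (f v b) # r)"
      using snoc by simp
    also have "tm_step composite \<dots> (Work (Letter b, y = [], False) # encL (rev (map Letter y)) @ lc, Mark v t False, r)"
      by (rule tm_step_compositeI[OF composite_trans.mark[OF d]]) (use snoc in auto)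
    finally show ?case by simp
  qed simp
  from this[of "Letter (f v a) # map Letter rest @ [RightEnd]"] x
  have "reaches (lc, Mark v t True, map Letter (map (f v) (x @ [a]) @ rest) @ [RightEnd])
    (encL (rev (map Letter x)) @ lc, Mark v t (x = []), Letter (f v a) # map Letter rest @ [RightEnd])"
    by simp
  also have "tm_step composite \<dots> (encL (rev (map Letter x)) @ lc, Rewind v t,
      Work (Letter a, x = [], True) # map Letter rest @ [RightEnd])"
    by (rule tm_step_compositeI[OF composite_trans.mark_last[OF d]]) (use x in auto)
  finally show ?thesis .
qed

lemma rewind_run:
  assumes d: "(s, v, t) \<in> D"
  shows "x @ a # y \<in> lists (X v) \<Longrightarrow> \<exists>a' y'. x @ a # y = a' # y' \<and> reaches
    (encL (rev (map Letter x)) @ lc, Rewind v t, Work (Letter a, x = [], y = []) # encR (map Letter y) @ rc)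
    (lc, Rewind v t, Work (Letter a', True, y' = []) # encR (map Letter y') @ rc)"
proof (induction x arbitrary: a y rule: rev_induct)
  case Nil
  then show ?case by auto
next
  case (snoc b x)
  then obtain a' y' where *: "x @ b # a # y = a' # y'" and run: "reaches
    (encL (rev (map Letter x)) @ lc, Rewind v t, Work (Letter b, x = [], False) # encR (map Letter (a # y)) @ rc)
    (lc, Rewind v t, Work (Letter a', True, y' = []) # encR (map Letter y') @ rc)"
    using snoc.IH[of b "a # y"] by auto
  have "tm_step composite (encL (rev (map Letter (x @ [b]))) @ lc, Rewind v t, Work (Letter a, False, y = []) # encR (map Letter y) @ rc)
     (encL (rev (map Letter x)) @ lc, Rewind v t, Work (Letter b, x = [], False) # encR (map Letter (a # y)) @ rc)"
    by (rule tm_step_compositeI[OF composite_trans.rewind[OF d]]) (use snoc inner_letter[OF d] in auto)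
  with run * show ?case by (auto intro: converse_rtranclp_into_rtranclp)
qed

lemma finish_run:
  assumes d: "(s, v, t) \<in> D"
  shows "set (c # r) \<subseteq> inner v \<Longrightarrow>
    \<exists>l'. reaches (l, Finish t, Work (c, b, r = []) # encR r @ rc) (l', Begin t, rc)"
proof (induction r arbitrary: l c b)
  case Nil
  have "tm_step composite (l, Finish t, Work (c, b, True) # rc) (Work (c, b, True) # l, Begin t, rc)"
    by (rule tm_step_compositeI[OF composite_trans.finish[OF d d]]) (use Nil in auto)
  then show ?case by auto
next
  case (Cons c' r)
  have "tm_step composite (l, Finish t, Work (c, b, False) # encR (c' # r) @ rc)
     (Work (c, b, False) # l, Finish t, encR (c' # r) @ rc)"
    by (rule tm_step_compositeI[OF composite_trans.skip[OF d d]]) (use Cons in auto)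
  with Cons.IH[of c' "Work (c, b, False) # l" False] Cons.prems show ?case
    by (auto intro: converse_rtranclp_into_rtranclp)
qed

text \<open>
  Here the factor must not be empty: there has to be a cell to carry its marks.
\<close>

lemma block_run:
  assumes d: "(s, v, t) \<in> D" and x: "x \<in> lba_lang (X v) (M v)"
  shows "\<exists>l'. reaches (l, Begin s, map Letter (map (f v) x @ rest) @ [RightEnd])
     (l', Begin t, map Letter rest @ [RightEnd])"
proof -
  from x obtain q l1 r1 where q: "q \<in> tm_final (M v)" and xX: "x \<in> lists (X v)"
    and run: "(tm_step (M v))\<^sup>*\<^sup>* ([], tm_start (M v), LeftEnd # map Letter x @ [RightEnd]) (l1, q, r1)"
    by (auto simp: lba_lang_def)
  define rc :: "('b, ('a, 'g) cell \<times> bool \<times> bool) cell list" where "rc = map Letter rest @ [RightEnd]"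
  have "x \<noteq> []" using nonempty[OF d] x by auto
  then obtain y a where y: "x = y @ [a]" by (cases x rule: rev_cases) auto
  obtain z a' where z: "x = a' # z" using \<open>x \<noteq> []\<close> by (cases x) auto
  have "f v a' \<in> Y" using f[OF d] xX z by auto
  then have "tm_step composite (l, Begin s, map Letter (map (f v) x @ rest) @ [RightEnd])
       (l, Mark v t True, map Letter (map (f v) x @ rest) @ [RightEnd])"
    using z by (auto intro!: tm_step_compositeI[OF composite_trans.enter[OF d]])
  also have "reaches \<dots> (encL (rev (map Letter y)) @ l, Rewind v t, Work (Letter a, y = [], True) # rc)"
    using mark_run[OF d, of y a l rest] xX y by (simp add: rc_def)
  also have "reaches \<dots> (l, Rewind v t, Work (Letter a', True, z = []) # encR (map Letter z) @ rc)"
    using rewind_run[OF d, of y a "[]" l rc] xX y z by auto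
  also have "tm_step composite \<dots> (l, Sim v t (tm_start (M v)) AtLeft, Work (Letter a', True, z = []) # encR (map Letter z) @ rc)"
    by (rule tm_step_compositeI[OF composite_trans.start[OF d]]) (use xX z inner_letter[OF d] in auto)
  finally have 1: "reaches (l, Begin s, map Letter (map (f v) x @ rest) @ [RightEnd])
     (l, Sim v t (tm_start (M v)) AtLeft, Work (Letter a', True, z = []) # encR (map Letter z) @ rc)" .
  have "embedded v t l rc ([], tm_start (M v), LeftEnd # map Letter x @ [RightEnd])
     (l, Sim v t (tm_start (M v)) AtLeft, Work (Letter a', True, z = []) # encR (map Letter z) @ rc)"
    using embedded.left[of "Letter a'" "map Letter z" v t l rc] letters_inner[OF d xX] by (simp add: z)
  from embedded_run[OF run d this] obtain d' where
    2: "reaches (l, Sim v t (tm_start (M v)) AtLeft, Work (Letter a', True, z = []) # encR (map Letter z) @ rc) d'"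
    and e: "embedded v t l rc (l1, q, r1) d'"
    by blast
  obtain l2 i c b r2 where d': "d' = (l2, Sim v t q i, Work (c, b, r2 = []) # encR r2 @ rc)"
    and c: "set (c # r2) \<subseteq> inner v"
    using e
  proof cases
    case (right c l)
    then show ?thesis using that[of _ _ c _ "[]"] by auto
  qed (use that in auto)
  have 3: "tm_step composite d' (l2, Finish t, Work (c, b, r2 = []) # encR r2 @ rc)"
    unfolding d' by (rule tm_step_compositeI[OF composite_trans.leave[OF d _ q]]) (use c in auto)
  from finish_run[OF d c, of l2 b rc] obtain l' where
    4: "reaches (l2, Finish t, Work (c, b, r2 = []) # encR r2 @ rc) (l', Begin t, rc)"
    by blast
  from rtranclp_trans[OF rtranclp_trans[OF 1 rtranclp.rtrancl_into_rtrancl[OF 2 3]] 4]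
  have "reaches (l, Begin s, map Letter (map (f v) x @ rest) @ [RightEnd]) (l', Begin t, rc)" .
  then show ?thesis unfolding rc_def by blast
qed

lemma path_run:
  "path_lang D K s0 u t \<Longrightarrow> \<exists>l. reaches ([], Init, LeftEnd # map Letter (u @ rest) @ [RightEnd])
     (l, Begin t, map Letter rest @ [RightEnd])"
proof (induction arbitrary: rest rule: path_lang.induct)
  case Nil
  have "tm_step composite ([], Init, LeftEnd # map Letter rest @ [RightEnd]) ([LeftEnd], Begin s0, map Letter rest @ [RightEnd])"
    by (rule tm_step_compositeI[OF composite_trans.init]) simp
  then show ?case by auto
next
  case (Snoc u s v t x)
  then obtain x' where x': "x = map (f v) x'" "x' \<in> lba_lang (X v) (M v)" by blast
  obtain l where l: "reaches ([], Init, LeftEnd # map Letter (u @ x @ rest) @ [RightEnd])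
     (l, Begin s, map Letter (x @ rest) @ [RightEnd])"
    using Snoc.IH by blast
  obtain l' where l': "reaches (l, Begin s, map Letter (x @ rest) @ [RightEnd])
     (l', Begin t, map Letter rest @ [RightEnd])"
    using block_run[OF Snoc(2) x'(2), of l rest] unfolding x'(1) by blast
  from rtranclp_trans[OF l l'] show ?case by auto
qed

lemma composite_lang: "lba_lang Y composite = subst_lang D K s0 F"
proof (intro Set.set_eqI iffI)
  fix w assume "w \<in> lba_lang Y composite"
  then obtain l r where "reaches ([], Init, LeftEnd # map Letter w @ [RightEnd]) (l, Accept, r)"
    by (auto simp: lba_lang_def composite_def)
  from invariant_steps[OF this invariant.init] show "w \<in> subst_lang D K s0 F"
    by cases (auto simp: subst_lang_def elim: embedded.cases)
next
  fix w assume "w \<in> subst_lang D K s0 F"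
  then obtain t where t: "t \<in> F" "path_lang D K s0 w t" by (auto simp: subst_lang_def)
  have "w \<in> lists Y"
  proof (rule path_lang_lists[OF t(2)])
    fix s v t assume "(s, v, t) \<in> D"
    from map_in_lists[OF f[OF this]] show "K v \<subseteq> lists Y"
      by (auto simp: lba_lang_def)
  qed
  have "t \<in> verts" using t(2) verts by cases auto
  obtain l where "reaches ([], Init, LeftEnd # map Letter w @ [RightEnd]) (l, Begin t, [RightEnd])"
    using path_run[OF t(2), of "[]"] by auto
  also have "tm_step composite \<dots> (l, Accept, [RightEnd])"
    by (rule tm_step_compositeI[OF composite_trans.accept]) (use t \<open>t \<in> verts\<close> in auto)
  finally show "w \<in> lba_lang Y composite"
    using \<open>w \<in> lists Y\<close> by (auto simp: lba_lang_def composite_def)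
qed

end

lemma context_sensitive_subst:
  fixes L :: "'v \<Rightarrow> 'a list set" and D :: "('s \<times> 'v \<times> 's) set" and Y :: "'b set"
  assumes D: "finite D" and Y: "finite Y"
    and L: "\<And>s v t. (s, v, t) \<in> D \<Longrightarrow> L v \<in> languages CS (X v) \<and> [] \<notin> L v"
    and f: "\<And>s v t. (s, v, t) \<in> D \<Longrightarrow> f v ` X v \<subseteq> Y"
  shows "subst_lang D (\<lambda>v. map (f v) ` L v) s0 F \<in> languages CS Y"
proof -
  have "\<exists>M :: (nat, 'a, nat) tm. (\<exists>s t. (s, v, t) \<in> D) \<longrightarrow> lba_over (X v) M \<and> lba_lang (X v) M = L v" for v
    using L by simp blast
  then obtain M :: "'v \<Rightarrow> (nat, 'a, nat) tm" where LM: "\<And>s v t. (s, v, t) \<in> D \<Longrightarrow>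
      lba_over (X v) (M v) \<and> L v = lba_lang (X v) (M v)"
    by metis
  interpret lba_subst D s0 F X Y f M
    by unfold_locales (use D Y L f LM in auto)
  have "path_lang D (\<lambda>v. map (f v) ` L v) s0 w t \<longleftrightarrow> path_lang D K s0 w t" for w t
  proof
    show "path_lang D K s0 w t" if "path_lang D (\<lambda>v. map (f v) ` L v) s0 w t"
      using that by induction (use LM in \<open>auto intro!: path_lang.intros\<close>)
    show "path_lang D (\<lambda>v. map (f v) ` L v) s0 w t" if "path_lang D K s0 w t"
      using that by induction (use LM in \<open>auto intro!: path_lang.intros\<close>)
  qed
  then have "subst_lang D (\<lambda>v. map (f v) ` L v) s0 F = lba_lang Y composite"
    unfolding composite_lang by (simp add: subst_lang_def)
  with context_sensitiveI[OF composite_over] show ?thesis by simp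
qed

section \<open>Erased words and blank cells\<close>

text \<open>
  The letter \<open>None\<close> serves as padding.
\<close>

fun erase :: "'a option list \<Rightarrow> 'a list" where
  "erase [] = []"
| "erase (None # w) = erase w"
| "erase (Some x # w) = x # erase w"

lemma erase_append [simp]: "erase (u @ w) = erase u @ erase w"
  by (induction u rule: erase.induct) auto

lemma erase_replicate_None [simp]: "erase (replicate n None) = []"
  by (induction n) auto

lemma erase_map_Some [simp]: "erase (map Some w) = w"
  by (induction w) auto

lemma erase_map_option: "erase (map (map_option f) w) = map f (erase w)"
  by (induction w rule: erase.induct) auto

text \<open>
  Two lists of cells that describe the same half of a tape: they may differ in trailing blanks.
\<close>

definition blank_equiv :: "('a, 'g) cell list \<Rightarrow> ('a, 'g) cell list \<Rightarrow> bool" where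
  "blank_equiv cs ds \<longleftrightarrow> (\<forall>i. scan (drop i cs) = scan (drop i ds))"

lemma blank_equiv_sym: "blank_equiv cs ds \<Longrightarrow> blank_equiv ds cs"
  by (simp add: blank_equiv_def)

lemma blank_equiv_scan: "blank_equiv cs ds \<Longrightarrow> scan cs = scan ds"
  unfolding blank_equiv_def by (metis drop0)

lemma blank_equiv_tl: "blank_equiv cs ds \<Longrightarrow> blank_equiv (tl cs) (tl ds)"
  unfolding blank_equiv_def by (metis drop_Suc)

lemma blank_equiv_Cons: "blank_equiv cs ds \<Longrightarrow> blank_equiv (c # cs) (c # ds)"
  unfolding blank_equiv_def
proof
  fix i assume "\<forall>i. scan (drop i cs) = scan (drop i ds)"
  then show "scan (drop i (c # cs)) = scan (drop i (c # ds))" by (cases i) auto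
qed

lemma blank_equiv_pad: "blank_equiv cs (cs @ replicate n Blank)"
  unfolding blank_equiv_def
proof
  fix i show "scan (drop i cs) = scan (drop i (cs @ replicate n Blank))"
    by (cases "i < length cs"; cases "n - (i - length cs)") (auto simp: scan_def split: list.splits)
qed

lemma blank_equiv_write_move:
  assumes "blank_equiv l l'" "blank_equiv r r'"
  shows "blank_equiv (fst (write_move m b l r)) (fst (write_move m b l' r')) \<and>
    blank_equiv (snd (write_move m b l r)) (snd (write_move m b l' r'))"
  using assms blank_equiv_scan[OF assms(1)] by (cases m) (auto intro: blank_equiv_tl blank_equiv_Cons)

lemma tm_steps_blank_equiv:
  assumes "(tm_step M)\<^sup>*\<^sup>* (l, p, r) (l1, q, r1)" "blank_equiv l l'" "blank_equiv r r'"
  shows "\<exists>l1' r1'. (tm_step M)\<^sup>*\<^sup>* (l', p, r') (l1', q, r1') \<and> blank_equiv l1 l1' \<and> blank_equiv r1 r1'"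
  using assms(1)
proof (induction "(l, p, r)" "(l1, q, r1)" arbitrary: l1 q r1 rule: rtranclp.induct)
  case rtrancl_refl
  then show ?case using assms by auto
next
  case (rtrancl_into_rtrancl c)
  obtain l2 q2 r2 where c: "c = (l2, q2, r2)" by (cases c)
  then obtain l2' r2' where 1: "(tm_step M)\<^sup>*\<^sup>* (l', p, r') (l2', q2, r2')" "blank_equiv l2 l2'" "blank_equiv r2 r2'"
    using rtrancl_into_rtrancl(2) by blast
  obtain b m where t: "(q2, scan r2, q, b, m) \<in> tm_trans M" "(l1, r1) = write_move m b l2 (tl r2)"
    using rtrancl_into_rtrancl(3) unfolding c tm_step_iff by blast
  obtain l1' r1' where w: "write_move m b l2' (tl r2') = (l1', r1')"
    by (cases "write_move m b l2' (tl r2')")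
  have "tm_step M (l2', q2, r2') (l1', q, r1')"
    unfolding tm_step_iff
    by (intro exI[of _ b] exI[of _ m]) (use t w blank_equiv_scan[OF 1(3)] in simp)
  moreover have "blank_equiv l1 l1' \<and> blank_equiv r1 r1'"
    using blank_equiv_write_move[OF 1(2) blank_equiv_tl[OF 1(3)], of m b] t(2)[symmetric] w by simp
  ultimately show ?case using 1(1) by (meson rtranclp.rtrancl_into_rtrancl)
qed

section \<open>Recursively enumerable languages as erased context-sensitive languages\<close>

text \<open>
  A Turing machine uses only finitely many cells in an accepting run. A linearly bounded automaton can
  therefore imitate it on the input enclosed by sufficiently many padding letters, which it treats as
  blank cells. The states before \<open>Simulate\<close> check that padding occurs only around the proper
  input, replace each letter by the cell that it stands for, and find the first proper letter.
\<close>

datatype 'q pad_frame = PStart | LeftPads | Letters | RightPads | Return | Skip | Simulate 'q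

locale padding =
  fixes X :: "'a set" and M :: "('q, 'a, 'g) tm"
  assumes M: "tm_over X M" and X: "finite X"
begin

abbreviation Y :: "'a option set" where "Y \<equiv> insert None (Some ` X)"

inductive pad_trans :: "'q pad_frame \<Rightarrow> ('a option, ('a, 'g) cell) cell \<Rightarrow> 'q pad_frame
    \<Rightarrow> ('a option, ('a, 'g) cell) cell \<Rightarrow> move \<Rightarrow> bool" where
  start: "pad_trans PStart LeftEnd LeftPads LeftEnd MoveRight"
| left_pad: "pad_trans LeftPads (Letter None) LeftPads (Work Blank) MoveRight"
| first_letter: "x \<in> X \<Longrightarrow> pad_trans LeftPads (Letter (Some x)) Letters (Work (Letter x)) MoveRight"
| letter: "x \<in> X \<Longrightarrow> pad_trans Letters (Letter (Some x)) Letters (Work (Letter x)) MoveRight"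
| first_right_pad: "pad_trans Letters (Letter None) RightPads (Work Blank) MoveRight"
| right_pad: "pad_trans RightPads (Letter None) RightPads (Work Blank) MoveRight"
| letters_end: "pad_trans Letters RightEnd Return RightEnd MoveLeft"
| pads_end: "pad_trans RightPads RightEnd Return RightEnd MoveLeft"
| return: "c \<in> tm_tape M \<Longrightarrow> pad_trans Return (Work c) Return (Work c) MoveLeft"
| return_end: "pad_trans Return LeftEnd Skip LeftEnd MoveRight"
| skip: "pad_trans Skip (Work Blank) Skip (Work Blank) MoveRight"
| skip_end: "x \<in> X \<Longrightarrow> pad_trans Skip (Work (Letter x)) (Simulate (tm_start M)) (Work (Letter x)) Stay"
| simulate: "(p, c, q, b, m) \<in> tm_trans M \<Longrightarrow> pad_trans (Simulate p) (Work c) (Simulate q) (Work b) m"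

definition padded :: "('q pad_frame, 'a option, ('a, 'g) cell) tm" where
  "padded = \<lparr>tm_states = {PStart, LeftPads, Letters, RightPads, Return, Skip} \<union> Simulate ` tm_states M,
     tm_tape = {Blank, LeftEnd, RightEnd} \<union> Letter ` Y \<union> Work ` tm_tape M,
     tm_start = PStart, tm_final = Simulate ` tm_final M,
     tm_trans = {(p, a, q, b, m). pad_trans p a q b m}\<rparr>"

abbreviation reaches where "reaches \<equiv> (tm_step padded)\<^sup>*\<^sup>*"

lemma trans_in: "(p, a, q, b, m) \<in> tm_trans M \<Longrightarrow> p \<in> tm_states M \<and> a \<in> tm_tape M \<and> q \<in> tm_states M \<and> b \<in> tm_tape M"
  using M unfolding tm_over_def by auto

lemma tape_in: "Blank \<in> tm_tape M" "x \<in> X \<Longrightarrow> Letter x \<in> tm_tape M" "tm_start M \<in> tm_states M"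
  using M unfolding tm_over_def by auto

lemma pad_trans_over:
  "pad_trans p a q b m \<Longrightarrow> p \<in> tm_states padded \<and> a \<in> tm_tape padded \<and> q \<in> tm_states padded \<and>
     b \<in> tm_tape padded \<and> (a = LeftEnd \<longleftrightarrow> b = LeftEnd) \<and> (a = RightEnd \<longleftrightarrow> b = RightEnd) \<and>
     (a = LeftEnd \<longrightarrow> m \<noteq> MoveLeft) \<and> (a = RightEnd \<longrightarrow> m \<noteq> MoveRight)"
  by (induction rule: pad_trans.induct) (auto simp: padded_def tape_in dest: trans_in)

lemma padded_over: "lba_over Y padded"
proof -
  have tr: "(p, a, q, b, m) \<in> tm_trans padded \<longleftrightarrow> pad_trans p a q b m" for p a q b m
    by (simp add: padded_def)
  have "tm_trans padded \<subseteq> tm_states padded \<times> tm_tape padded \<times> tm_states padded \<times> tm_tape padded \<times> UNIV"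
    using pad_trans_over tr by auto
  moreover have "finite (tm_states padded)" "finite (tm_tape padded)" "tm_final padded \<subseteq> tm_states padded"
    using M X by (auto simp: padded_def tm_over_def)
  ultimately have "tm_over Y padded"
    unfolding tm_over_def by (simp add: padded_def, blast)
  then show ?thesis
  proof (rule lba_overI)
    fix p a q b m assume "(p, a, q, b, m) \<in> tm_trans padded"
    then have "pad_trans p a q b m" by (simp only: tr)
    from pad_trans_over[OF this] show "(a = LeftEnd \<longleftrightarrow> b = LeftEnd) \<and> (a = RightEnd \<longleftrightarrow> b = RightEnd) \<and>
        (a = LeftEnd \<longrightarrow> m \<noteq> MoveLeft) \<and> (a = RightEnd \<longrightarrow> m \<noteq> MoveRight)"
      by blast
  qed (simp add: padded_def)
qed

lemma step_padI:
  "pad_trans p a q b m \<Longrightarrow> (l', r') = write_move m b l r \<Longrightarrow> tm_step padded (l, p, a # r) (l', q, r')"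
  by (rule tm_stepI) (simp_all add: padded_def)

lemma pad_step_cases:
  assumes "tm_step padded (l, p, r) c'"
  obtains b m q l' r' where "c' = (l', q, r')" "pad_trans p (scan r) q b m" "(l', r') = write_move m b l (tl r)"
  using assms by (cases c') (auto simp: tm_step_iff padded_def)

definition padded_word :: "nat \<Rightarrow> 'a list \<Rightarrow> nat \<Rightarrow> 'a option list" where
  "padded_word j x k = replicate j None @ map Some x @ replicate k None"

definition padded_tape :: "nat \<Rightarrow> 'a list \<Rightarrow> nat \<Rightarrow> ('a, 'g) cell list" where
  "padded_tape j x k = replicate j Blank @ map Letter x @ replicate k Blank"

text \<open>
  After the check the tape between the endmarkers is an encoded part of a tape of the Turing machine. In
  case \<open>overflow\<close> the simulated head has run out of padding on the left; the automaton is stuck, but the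
  state it is in has been reached by the Turing machine as well, so accepting in it is correct. When
  the padding on the right is used up, the case \<open>simulate\<close> still applies, with \<open>r\<close> empty.
\<close>

inductive invariant for w :: "'a option list" where
  start: "invariant w ([], PStart, LeftEnd # map Letter w @ [RightEnd])"
| left_pads: "w = padded_word j [] 0 @ rest \<Longrightarrow>
    invariant w (map Work (rev (padded_tape j [] 0)) @ [LeftEnd], LeftPads, map Letter rest @ [RightEnd])"
| letters: "x \<noteq> [] \<Longrightarrow> w = padded_word j x 0 @ rest \<Longrightarrow>
    invariant w (map Work (rev (padded_tape j x 0)) @ [LeftEnd], Letters, map Letter rest @ [RightEnd])"
| right_pads: "x \<noteq> [] \<Longrightarrow> w = padded_word j x k @ rest \<Longrightarrow>
    invariant w (map Work (rev (padded_tape j x k)) @ [LeftEnd], RightPads, map Letter rest @ [RightEnd])"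
| return: "x \<noteq> [] \<Longrightarrow> w = padded_word j x k \<Longrightarrow> padded_tape j x k = rev l @ r \<Longrightarrow>
    invariant w (map Work l @ [LeftEnd], Return, map Work r @ [RightEnd])"
| return_end: "x \<noteq> [] \<Longrightarrow> w = padded_word j x k \<Longrightarrow>
    invariant w ([], Return, LeftEnd # map Work (padded_tape j x k) @ [RightEnd])"
| skip: "x \<noteq> [] \<Longrightarrow> w = padded_word j x k \<Longrightarrow> padded_tape j x k = replicate i Blank @ r \<Longrightarrow>
    invariant w (map Work (replicate i Blank) @ [LeftEnd], Skip, map Work r @ [RightEnd])"
| simulate: "w = padded_word j x k \<Longrightarrow>
    (tm_step M)\<^sup>*\<^sup>* (replicate j Blank, tm_start M, map Letter x @ replicate k Blank) (l, q, r) \<Longrightarrow>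
    invariant w (map Work l @ [LeftEnd], Simulate q, map Work r @ [RightEnd])"
| overflow: "w = padded_word j x k \<Longrightarrow>
    (tm_step M)\<^sup>*\<^sup>* (replicate j Blank, tm_start M, map Letter x @ replicate k Blank) (l, q, r) \<Longrightarrow>
    invariant w ([], Simulate q, LeftEnd # r')"

text \<open>
  In state \<open>Skip\<close> the automaton thus starts the simulation at the first proper letter only.
\<close>

lemma leading_blanks:
  assumes "x \<noteq> []" "padded_tape j x k = replicate i Blank @ Letter a # r"
  shows "i = j"
proof -
  have "length (takeWhile (\<lambda>c. c = Blank) (padded_tape j x k)) = j"
    using assms(1) by (cases x) (auto simp: padded_tape_def takeWhile_append)
  moreover have "length (takeWhile (\<lambda>c. c = Blank) (padded_tape j x k)) = i"
    unfolding assms(2) by (auto simp: takeWhile_append)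
  ultimately show ?thesis by simp
qed

lemma simulate_write_move:
  assumes "(l', r') = write_move m (Work b) (map Work l @ [LeftEnd]) (map Work r @ [RightEnd])"
    and "(l1, r1) = write_move m b l r"
  shows "(l', r') = (map Work l1 @ [LeftEnd], map Work r1 @ [RightEnd]) \<or> (l = [] \<and> m = MoveLeft \<and> l' = [] \<and> (\<exists>r2. r' = LeftEnd # r2))"
  using assms by (cases m; cases l) auto

lemma invariant_step:
  assumes "invariant w c" "tm_step padded c c'"
  shows "invariant w c'"
  using assms(1)
proof cases
  case start
  show ?thesis
    using assms(2) invariant.left_pads[of w 0 w] unfolding start
    by (auto elim!: pad_step_cases pad_trans.cases simp: padded_word_def padded_tape_def)
next
  case (left_pads j rest)
  from assms(2)[unfolded left_pads] obtain b m q l' r' where c': "c' = (l', q, r')" and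
    tr: "pad_trans LeftPads (scan (map Letter rest @ [RightEnd])) q b m" and
    w: "(l', r') = write_move m b (map Work (rev (padded_tape j [] 0)) @ [LeftEnd]) (tl (map Letter rest @ [RightEnd]))"
    by (auto elim!: pad_step_cases)
  from tr show ?thesis
  proof cases
    case left_pad
    then obtain rest' where "rest = None # rest'" by (cases rest) auto
    with left_pad w left_pads(2) invariant.left_pads[of w "Suc j" rest'] show ?thesis
      by (simp add: c' padded_word_def padded_tape_def replicate_append_same)
  next
    case (first_letter x)
    then obtain rest' where "rest = Some x # rest'" by (cases rest) auto
    with first_letter w left_pads(2) invariant.letters[of "[x]" w j rest'] show ?thesis
      by (simp add: c' padded_word_def padded_tape_def)
  qed
next
  case (letters x j rest)
  from assms(2)[unfolded letters] obtain b m q l' r' where c': "c' = (l', q, r')" and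
    tr: "pad_trans Letters (scan (map Letter rest @ [RightEnd])) q b m" and
    w: "(l', r') = write_move m b (map Work (rev (padded_tape j x 0)) @ [LeftEnd]) (tl (map Letter rest @ [RightEnd]))"
    by (auto elim!: pad_step_cases)
  from tr show ?thesis
  proof cases
    case (letter y)
    then obtain rest' where "rest = Some y # rest'" by (cases rest) auto
    with letter w letters(2,3) invariant.letters[of "x @ [y]" w j rest'] show ?thesis
      by (simp add: c' padded_word_def padded_tape_def)
  next
    case first_right_pad
    then obtain rest' where "rest = None # rest'" by (cases rest) auto
    with first_right_pad w letters(2,3) invariant.right_pads[of x w j 1 rest'] show ?thesis
      by (simp add: c' padded_word_def padded_tape_def)
  next
    case letters_end
    then have rest: "rest = []" by (cases rest) auto
    obtain z y where "x = y @ [z]" using letters(2) by (cases x rule: rev_cases) auto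
    with letters_end w letters(2,3) rest
      invariant.return[of x w j 0 "rev (padded_tape j y 0)" "[Letter z]"] show ?thesis
      by (simp add: c' padded_word_def padded_tape_def)
  qed
next
  case (right_pads x j k rest)
  from assms(2)[unfolded right_pads] obtain b m q l' r' where c': "c' = (l', q, r')" and
    tr: "pad_trans RightPads (scan (map Letter rest @ [RightEnd])) q b m" and
    w: "(l', r') = write_move m b (map Work (rev (padded_tape j x k)) @ [LeftEnd]) (tl (map Letter rest @ [RightEnd]))"
    by (auto elim!: pad_step_cases)
  from tr show ?thesis
  proof cases
    case right_pad
    then obtain rest' where "rest = None # rest'" by (cases rest) auto
    with right_pad w right_pads(2,3) invariant.right_pads[of x w j "Suc k" rest'] show ?thesis
      by (simp add: c' padded_word_def padded_tape_def replicate_app_Cons_same)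
  next
    case pads_end
    then have rest: "rest = []" by (cases rest) auto
    have "padded_tape j x k \<noteq> []" using right_pads(2) by (simp add: padded_tape_def)
    then obtain z y where zy: "padded_tape j x k = y @ [z]" by (cases "padded_tape j x k" rule: rev_cases) auto
    with pads_end w right_pads(2,3) rest invariant.return[of x w j k "rev y" "[z]"] show ?thesis
      by (simp add: c')
  qed
next
  case (return x j k l r)
  from assms(2)[unfolded return] obtain b m q l' r' where c': "c' = (l', q, r')" and
    tr: "pad_trans Return (scan (map Work r @ [RightEnd])) q b m" and
    w: "(l', r') = write_move m b (map Work l @ [LeftEnd]) (tl (map Work r @ [RightEnd]))"
    by (auto elim!: pad_step_cases)
  from tr show ?thesis
  proof cases
    case (return c)
    then obtain r1 where r: "r = c # r1" by (cases r) auto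
    show ?thesis
    proof (cases l)
      case Nil
      with return w r \<open>x \<noteq> []\<close> \<open>w = padded_word j x k\<close> \<open>padded_tape j x k = rev l @ r\<close> invariant.return_end[of x w j k]
      show ?thesis by (simp add: c')
    next
      case (Cons a l1)
      with return w r \<open>x \<noteq> []\<close> \<open>w = padded_word j x k\<close> \<open>padded_tape j x k = rev l @ r\<close> invariant.return[of x w j k l1 "a # r"]
      show ?thesis by (simp add: c')
    qed
  next
    case return_end
    then show ?thesis by (cases r) auto
  qed
next
  case (return_end x j k)
  show ?thesis
    using assms(2) invariant.skip[of x w j k 0 "padded_tape j x k"] return_end(2,3) unfolding return_end(1)
    by (auto elim!: pad_step_cases pad_trans.cases)
next
  case (skip x j k i r)
  from assms(2)[unfolded skip] obtain b m q l' r' where c': "c' = (l', q, r')" and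
    tr: "pad_trans Skip (scan (map Work r @ [RightEnd])) q b m" and
    w: "(l', r') = write_move m b (map Work (replicate i Blank) @ [LeftEnd]) (tl (map Work r @ [RightEnd]))"
    by (auto elim!: pad_step_cases)
  from tr show ?thesis
  proof cases
    case skip
    then obtain r1 where r: "r = Blank # r1" by (cases r) auto
    with skip w \<open>x \<noteq> []\<close> \<open>w = padded_word j x k\<close> \<open>padded_tape j x k = replicate i Blank @ r\<close> invariant.skip[of x w j k "Suc i" r1]
    show ?thesis by (simp add: c' replicate_app_Cons_same)
  next
    case (skip_end a)
    then obtain r1 where r: "r = Letter a # r1" by (cases r) auto
    then have "i = j" using leading_blanks skip(2,4) by blast
    then have "r = map Letter x @ replicate k Blank" using skip(4) by (simp add: padded_tape_def)
    with skip_end w r \<open>i = j\<close> invariant.simulate[OF skip(3) rtranclp.rtrancl_refl] show ?thesis by (simp add: c')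
  qed
next
  case (simulate j x k l p r)
  from assms(2)[unfolded simulate] obtain b' m q' l' r' where c': "c' = (l', q', r')" and
    tr: "pad_trans (Simulate p) (scan (map Work r @ [RightEnd])) q' b' m" and
    w: "(l', r') = write_move m b' (map Work l @ [LeftEnd]) (tl (map Work r @ [RightEnd]))"
    by (auto elim!: pad_step_cases)
  from tr show ?thesis
  proof cases
    case (simulate c q b)
    then obtain r0 where r: "r = c # r0" by (cases r) auto
    obtain l1 r1 where w1: "(l1, r1) = write_move m b l r0" by (metis surj_pair)
    have "tm_step M (l, p, r) (l1, q, r1)"
      unfolding r by (rule tm_stepI[OF simulate(4) w1])
    with \<open>(tm_step M)\<^sup>*\<^sup>* _ (l, p, r)\<close>
    have run: "(tm_step M)\<^sup>*\<^sup>* (replicate j Blank, tm_start M, map Letter x @ replicate k Blank) (l1, q, r1)"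
      by (rule rtranclp.rtrancl_into_rtrancl)
    have "(l', r') = write_move m (Work b) (map Work l @ [LeftEnd]) (map Work r0 @ [RightEnd])"
      using w simulate r by simp
    from simulate_write_move[OF this w1] show ?thesis
      using invariant.simulate[OF \<open>w = padded_word j x k\<close> run] invariant.overflow[OF \<open>w = padded_word j x k\<close> run]
      by (auto simp: c' simulate)
  qed
next
  case (overflow j x k l q r r')
  show ?thesis
    using assms(2) unfolding overflow by (auto elim!: pad_step_cases pad_trans.cases)
qed

text \<open>
  The simulated run starts on a tape with explicit blanks around the input; it accepts the plain input
  because blanks at the ends of the two halves of the tape do not matter.
\<close>

lemma padded_sound:
  assumes "w \<in> lba_lang Y padded"
  shows "erase w \<in> tm_lang X M"
proof -
  from assms obtain q l r where w: "w \<in> lists Y" and q: "q \<in> tm_final M"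
    and run: "reaches ([], PStart, LeftEnd # map Letter w @ [RightEnd]) (l, Simulate q, r)"
    by (auto simp: lba_lang_def padded_def)
  have "invariant w c" if "reaches ([], PStart, LeftEnd # map Letter w @ [RightEnd]) c" for c
    using that by induction (auto intro: invariant.start invariant_step)
  from this[OF run] obtain j x k l1 r1 where x: "w = padded_word j x k"
    and M_run: "(tm_step M)\<^sup>*\<^sup>* (replicate j Blank, tm_start M, map Letter x @ replicate k Blank) (l1, q, r1)"
    by cases auto
  have "blank_equiv (replicate j Blank) ([] :: ('a, 'g) cell list)"
      "blank_equiv (map Letter x @ replicate k Blank) (map Letter x :: ('a, 'g) cell list)"
    using blank_equiv_sym[OF blank_equiv_pad] blank_equiv_sym[OF blank_equiv_pad[of "[]"]] by auto
  from tm_steps_blank_equiv[OF M_run this] have "accepts M (map Letter x)"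
    using q unfolding accepts_def by blast
  moreover have "x \<in> lists X" using w x by (auto simp: padded_word_def)
  ultimately show ?thesis using x by (simp add: tm_lang_accepts padded_word_def)
qed

text \<open>
  The length of the run serves as \<open>N\<close>: each step uses up at most one cell of padding on each side.
\<close>

lemma simulate_run:
  assumes "(tm_step M)\<^sup>*\<^sup>* (l, p, r) (l', q, r')"
  shows "\<exists>N. \<forall>L R. blank_equiv l L \<longrightarrow> blank_equiv r R \<longrightarrow> N \<le> length L \<longrightarrow> N \<le> length R \<longrightarrow>
    (\<exists>L' R'. reaches (map Work L @ [LeftEnd], Simulate p, map Work R @ [RightEnd]) (L', Simulate q, R'))"
  using assms
proof (induction "(l, p, r)" arbitrary: l p r rule: converse_rtranclp_induct)
  case base
  then show ?case by blast
next
  case (step c)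
  obtain l1 p1 r1 where c: "c = (l1, p1, r1)" by (cases c)
  obtain b m where tr: "(p, scan r, p1, b, m) \<in> tm_trans M" "(l1, r1) = write_move m b l (tl r)"
    using step(1) unfolding c tm_step_iff by blast
  obtain N where N: "\<And>L R. blank_equiv l1 L \<Longrightarrow> blank_equiv r1 R \<Longrightarrow> N \<le> length L \<Longrightarrow> N \<le> length R \<Longrightarrow>
    \<exists>L' R'. reaches (map Work L @ [LeftEnd], Simulate p1, map Work R @ [RightEnd]) (L', Simulate q, R')"
    using step(3)[OF c] by blast
  have "\<exists>L' R'. reaches (map Work L @ [LeftEnd], Simulate p, map Work R @ [RightEnd]) (L', Simulate q, R')"
    if L: "blank_equiv l L" and R: "blank_equiv r R" and len: "Suc N \<le> length L" "Suc N \<le> length R" for L R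
  proof -
    obtain a L0 where LL: "L = a # L0" using len by (cases L) auto
    obtain d R0 where RR: "R = d # R0" using len by (cases R) auto
    have d: "d = scan r" using blank_equiv_scan[OF R] RR by simp
    obtain L1 R1 where w: "write_move m b L R0 = (L1, R1)" by (cases "write_move m b L R0")
    have "tm_step padded (map Work L @ [LeftEnd], Simulate p, map Work R @ [RightEnd])
        (map Work L1 @ [LeftEnd], Simulate p1, map Work R1 @ [RightEnd])"
      unfolding RR d list.map append.simps
      by (rule step_padI[OF pad_trans.simulate[OF tr(1)]]) (use w LL in \<open>cases m; auto\<close>)
    moreover have "blank_equiv l1 L1 \<and> blank_equiv r1 R1"
      using blank_equiv_write_move[OF L blank_equiv_tl[OF R], of m b] tr(2)[symmetric] w RR by simp
    moreover have "N \<le> length L1" "N \<le> length R1" using w LL RR len by (cases m; auto)+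
    ultimately show ?thesis using N by (meson converse_rtranclp_into_rtranclp)
  qed
  then show ?case by blast
qed

lemma left_pads_run:
  "reaches (l, LeftPads, replicate j (Letter None) @ r) (replicate j (Work Blank) @ l, LeftPads, r)"
  using tm_sweep[of "replicate j ()" LeftPads "\<lambda>_. Letter None" "\<lambda>_. Work Blank" padded l r] pad_trans.left_pad
  by (simp add: padded_def)

lemma letters_run:
  "x \<in> lists X \<Longrightarrow> reaches (l, Letters, map Letter (map Some x) @ r) (rev (map (Work \<circ> Letter) x) @ l, Letters, r)"
  using tm_sweep[of x Letters "\<lambda>a. Letter (Some a)" "\<lambda>a. Work (Letter a)" padded l r] pad_trans.letter
  by (auto simp: padded_def o_def)

lemma right_pads_run:
  "reaches (l, RightPads, replicate j (Letter None) @ r) (replicate j (Work Blank) @ l, RightPads, r)"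
  using tm_sweep[of "replicate j ()" RightPads "\<lambda>_. Letter None" "\<lambda>_. Work Blank" padded l r] pad_trans.right_pad
  by (simp add: padded_def)

lemma return_run:
  "set (c # l) \<subseteq> tm_tape M \<Longrightarrow>
   reaches (map Work l @ [LeftEnd], Return, Work c # r) ([LeftEnd], Skip, map Work (rev l) @ Work c # r)"
proof (induction l arbitrary: c r)
  case Nil
  have "reaches ([LeftEnd], Return, Work c # r) ([], Return, LeftEnd # Work c # r)"
    by (rule r_into_rtranclp, rule step_padI[OF pad_trans.return]) (use Nil in auto)
  also have "tm_step padded \<dots> ([LeftEnd], Skip, Work c # r)"
    by (rule step_padI[OF pad_trans.return_end]) simp
  finally show ?case by simp
next
  case (Cons a l)
  have "tm_step padded (map Work (a # l) @ [LeftEnd], Return, Work c # r) (map Work l @ [LeftEnd], Return, Work a # Work c # r)"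
    by (rule step_padI[OF pad_trans.return]) (use Cons in auto)
  also have "reaches \<dots> ([LeftEnd], Skip, map Work (rev l) @ Work a # Work c # r)"
    by (rule Cons.IH) (use Cons in auto)
  finally show ?case by simp
qed

lemma skip_run:
  "reaches (l, Skip, replicate j (Work Blank) @ r) (replicate j (Work Blank) @ l, Skip, r)"
  using tm_sweep[of "replicate j ()" Skip "\<lambda>_. Work Blank" "\<lambda>_. Work Blank" padded l r] pad_trans.skip
  by (simp add: padded_def)

lemma format_run:
  assumes x: "x \<noteq> []" "x \<in> lists X"
  shows "reaches ([], PStart, LeftEnd # map Letter (padded_word j x (Suc k)) @ [RightEnd])
    (map Work (replicate j Blank) @ [LeftEnd], Simulate (tm_start M), map Work (map Letter x @ replicate (Suc k) Blank) @ [RightEnd])"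
proof -
  obtain a y where y: "x = a # y" using x by (cases x) auto
  define L :: "('a, 'g) cell list" where "L = replicate k Blank @ rev (map Letter x) @ replicate j Blank"
  have "tm_step padded ([], PStart, LeftEnd # map Letter (padded_word j x (Suc k)) @ [RightEnd])
      ([LeftEnd], LeftPads, map Letter (padded_word j x (Suc k)) @ [RightEnd])"
    by (rule step_padI[OF pad_trans.start]) simp
  also have "map Letter (padded_word j x (Suc k)) @ [RightEnd] =
      replicate j (Letter None) @ Letter (Some a) # map Letter (map Some y) @ replicate (Suc k) (Letter None) @ [RightEnd]"
    by (simp add: padded_word_def y)
  also have "reaches ([LeftEnd], LeftPads, \<dots>) (replicate j (Work Blank) @ [LeftEnd], LeftPads,
      Letter (Some a) # map Letter (map Some y) @ replicate (Suc k) (Letter None) @ [RightEnd])"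
    by (rule left_pads_run)
  also have "tm_step padded \<dots> (Work (Letter a) # replicate j (Work Blank) @ [LeftEnd], Letters,
      map Letter (map Some y) @ replicate (Suc k) (Letter None) @ [RightEnd])"
    by (rule step_padI[OF pad_trans.first_letter]) (use x y in auto)
  also have "reaches \<dots> (rev (map (Work \<circ> Letter) y) @ Work (Letter a) # replicate j (Work Blank) @ [LeftEnd], Letters,
      replicate (Suc k) (Letter None) @ [RightEnd])"
    by (rule letters_run) (use x y in auto)
  also have "rev (map (Work \<circ> Letter) y) @ Work (Letter a) # replicate j (Work Blank) @ [LeftEnd] =
      map Work (rev (map Letter x) @ replicate j Blank) @ [LeftEnd]"
    by (simp add: y rev_map)
  also have "tm_step padded (map Work (rev (map Letter x) @ replicate j Blank) @ [LeftEnd], Letters, replicate (Suc k) (Letter None) @ [RightEnd])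
      (Work Blank # map Work (rev (map Letter x) @ replicate j Blank) @ [LeftEnd], RightPads, replicate k (Letter None) @ [RightEnd])"
    unfolding replicate.simps append.simps by (rule step_padI[OF pad_trans.first_right_pad]) simp
  also have "reaches \<dots> (replicate k (Work Blank) @ Work Blank # map Work (rev (map Letter x) @ replicate j Blank) @ [LeftEnd],
      RightPads, [RightEnd])"
    by (rule right_pads_run)
  also have "replicate k (Work Blank) @ Work Blank # map Work (rev (map Letter x) @ replicate j Blank) @ [LeftEnd] =
      map Work (Blank # L) @ [LeftEnd]"
    by (simp add: L_def replicate_app_Cons_same)
  also have "tm_step padded (map Work (Blank # L) @ [LeftEnd], RightPads, [RightEnd]) (map Work L @ [LeftEnd], Return, [Work Blank, RightEnd])"
    by (rule step_padI[OF pad_trans.pads_end]) simp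
  also have "reaches \<dots> ([LeftEnd], Skip, map Work (rev L) @ [Work Blank, RightEnd])"
    by (rule return_run) (use x in \<open>auto simp: L_def tape_in\<close>)
  also have "map Work (rev L) @ [Work Blank, RightEnd] =
      replicate j (Work Blank) @ Work (Letter a) # map Work (map Letter y @ replicate (Suc k) Blank) @ [RightEnd]"
    by (simp add: L_def y replicate_app_Cons_same)
  also have "reaches ([LeftEnd], Skip, \<dots>) (replicate j (Work Blank) @ [LeftEnd], Skip,
      Work (Letter a) # map Work (map Letter y @ replicate (Suc k) Blank) @ [RightEnd])"
    by (rule skip_run)
  also have "tm_step padded \<dots> (replicate j (Work Blank) @ [LeftEnd], Simulate (tm_start M),
      Work (Letter a) # map Work (map Letter y @ replicate (Suc k) Blank) @ [RightEnd])"
    by (rule step_padI[OF pad_trans.skip_end]) (use x y in auto)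
  finally show ?thesis by (simp add: y padded_word_def)
qed

lemma padded_complete:
  assumes "x \<in> tm_lang X M" "x \<noteq> []"
  shows "\<exists>w\<in>lba_lang Y padded. erase w = x"
proof -
  from assms obtain q l r where x: "x \<in> lists X" and q: "q \<in> tm_final M"
    and run: "(tm_step M)\<^sup>*\<^sup>* ([], tm_start M, map Letter x) (l, q, r)"
    by (auto simp: tm_lang_def)
  from simulate_run[OF run] obtain N where N: "\<And>L R. blank_equiv [] L \<Longrightarrow> blank_equiv (map Letter x) R \<Longrightarrow>
      N \<le> length L \<Longrightarrow> N \<le> length R \<Longrightarrow>
      \<exists>L' R'. reaches (map Work L @ [LeftEnd], Simulate (tm_start M), map Work R @ [RightEnd]) (L', Simulate q, R')"
    by blast
  obtain L' R' where "reaches (map Work (replicate N Blank) @ [LeftEnd], Simulate (tm_start M),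
      map Work (map Letter x @ replicate (Suc N) Blank) @ [RightEnd]) (L', Simulate q, R')"
    using N[of "replicate N Blank" "map Letter x @ replicate (Suc N) Blank"]
      blank_equiv_pad[of "[]" N] blank_equiv_pad[of "map Letter x" "Suc N"] by auto
  with format_run[OF assms(2) x, of N N]
  have "reaches ([], PStart, LeftEnd # map Letter (padded_word N x (Suc N)) @ [RightEnd]) (L', Simulate q, R')"
    by (rule rtranclp_trans)
  moreover have "padded_word N x (Suc N) \<in> lists Y" using x by (auto simp: padded_word_def)
  ultimately have "padded_word N x (Suc N) \<in> lba_lang Y padded"
    using q by (auto simp: lba_lang_def padded_def)
  moreover have "erase (padded_word N x (Suc N)) = x" by (simp add: padded_word_def)
  ultimately show ?thesis by blast
qed

lemma erase_padded:
  assumes "[] \<notin> tm_lang X M"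
  shows "erase ` lba_lang Y padded = tm_lang X M"
proof (intro subset_antisym subsetI)
  fix x assume "x \<in> erase ` lba_lang Y padded"
  then show "x \<in> tm_lang X M" using padded_sound by (elim imageE) simp
next
  fix x assume x: "x \<in> tm_lang X M"
  then have "x \<noteq> []" using assms by (intro notI) simp
  from padded_complete[OF x this] show "x \<in> erase ` lba_lang Y padded"
    by (elim bexE) (rule image_eqI[OF HOL.sym])
qed

end

lemma recursively_enumerable_padding:
  assumes "L \<in> languages RE X" "finite X" "[] \<notin> L"
  shows "\<exists>L'\<in>languages CS (insert None (Some ` X)). erase ` L' = L"
proof -
  from assms obtain M :: "(nat, 'a, nat) tm" where LM: "tm_over X M" "L = tm_lang X M" by auto
  interpret padding X M by unfold_locales (use LM assms in auto)
  have "erase ` lba_lang Y padded = L" using erase_padded LM assms(3) by simp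
  with context_sensitiveI[OF padded_over] show ?thesis by (rule bexI[rotated])
qed

section \<open>Erasing a letter from a context-sensitive language\<close>

text \<open>
  To accept the erased words of a language of a linearly bounded automaton, a Turing machine inserts
  padding into its input, writes the endmarkers and runs the automaton. Inserting a cell requires
  shifting all cells on one side of it. This is done by local moves: \<open>Roam\<close> walks over the tape, \<open>Insert\<close>
  adds a padding cell at the left end, and \<open>Carry\<close> exchanges a letter with the padding cell to its left.
  None of these moves changes the erased word, so they may be made in any order. \<open>Place\<close> walks to the
  left end to write the left endmarker once the right one has been written.
\<close>

datatype ('q, 'a) unpad_frame = Roam | Insert | Carry 'a | Place | Play 'q

text \<open>
  The proper letters of the input stand for themselves, so that the input need not be rewritten. The
  blank symbol of the automaton is encoded by a cell other than \<open>Blank\<close>, so a cell is \<open>Blank\<close>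
  only as long as nothing has been written on it.
\<close>

fun enc :: "('a option, 'g) cell \<Rightarrow> ('a, ('a option, 'g) cell) cell" where
  "enc (Letter (Some x)) = Letter x"
| "enc c = Work c"

lemma enc_inj: "enc c = enc d \<Longrightarrow> c = d"
  by (induction c rule: enc.induct; induction d rule: enc.induct) auto

lemma enc_not_Blank [simp]: "enc c \<noteq> Blank" "Blank \<noteq> enc c"
  by (induction c rule: enc.induct) auto

text \<open>
  The tapes of linearly bounded automata: the head is on one of the endmarkers or strictly between them.
\<close>

inductive bounded_tape :: "('a, 'g) cell list \<Rightarrow> ('a, 'g) cell list \<Rightarrow> bool" where
  left: "{LeftEnd, RightEnd} \<inter> set r = {} \<Longrightarrow> bounded_tape [] (LeftEnd # r @ [RightEnd])"
| inside: "{LeftEnd, RightEnd} \<inter> set (l @ c # r) = {} \<Longrightarrow> bounded_tape (l @ [LeftEnd]) (c # r @ [RightEnd])"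
| right: "{LeftEnd, RightEnd} \<inter> set l = {} \<Longrightarrow> bounded_tape (l @ [LeftEnd]) [RightEnd]"

lemma bounded_tape_right_ne: "bounded_tape l r \<Longrightarrow> r \<noteq> []"
  by (cases rule: bounded_tape.cases) auto

lemma bounded_tape_left_ne: "bounded_tape l r \<Longrightarrow> scan r \<noteq> LeftEnd \<Longrightarrow> l \<noteq> []"
  by (cases rule: bounded_tape.cases) auto

lemma bounded_tape_step:
  assumes lba: "lba_over X M" and step: "tm_step M (l, p, r) (l', q, r')" and b: "bounded_tape l r"
  shows "bounded_tape l' r'"
proof -
  from step obtain b m where tr: "(p, scan r, q, b, m) \<in> tm_trans M" and w: "(l', r') = write_move m b l (tl r)"
    unfolding tm_step_iff by blast
  have ends: "scan r = LeftEnd \<longleftrightarrow> b = LeftEnd" "scan r = RightEnd \<longleftrightarrow> b = RightEnd"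
      "scan r = LeftEnd \<Longrightarrow> m \<noteq> MoveLeft" "scan r = RightEnd \<Longrightarrow> m \<noteq> MoveRight"
    using lba tr unfolding lba_over_def by auto
  from b show ?thesis
  proof cases
    case (left r0)
    then have "b = LeftEnd" "m \<noteq> MoveLeft" using ends by auto
    then consider "l' = []" "r' = LeftEnd # r0 @ [RightEnd]" | "l' = [LeftEnd]" "r' = r0 @ [RightEnd]"
      using w left by (cases m) auto
    then show ?thesis
    proof cases
      case 1
      with bounded_tape.left[OF left(3)] show ?thesis by simp
    next
      case 2
      show ?thesis
      proof (cases r0)
        case Nil
        with 2 bounded_tape.right[of "[]"] show ?thesis by simp
      next
        case (Cons c r1)
        with 2 left bounded_tape.inside[of "[]" c r1] show ?thesis by simp
      qed
    qed
  next
    case (inside l0 c r0)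
    then have clean: "b \<noteq> LeftEnd" "b \<noteq> RightEnd" using ends by auto
    consider (S) "l' = l0 @ [LeftEnd]" "r' = b # r0 @ [RightEnd]" | (R) "l' = b # l0 @ [LeftEnd]" "r' = r0 @ [RightEnd]"
      | (L) "l' = tl (l0 @ [LeftEnd])" "r' = scan (l0 @ [LeftEnd]) # b # r0 @ [RightEnd]"
      using w inside by (cases m) auto
    then show ?thesis
    proof cases
      case S
      with inside clean bounded_tape.inside[of l0 b r0] show ?thesis by simp
    next
      case R
      show ?thesis
      proof (cases r0)
        case Nil
        with R inside clean bounded_tape.right[of "b # l0"] show ?thesis by simp
      next
        case (Cons d r1)
        with R inside clean bounded_tape.inside[of "b # l0" d r1] show ?thesis by simp
      qed
    next
      case L
      show ?thesis
      proof (cases l0)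
        case Nil
        with L inside clean bounded_tape.left[of "b # r0"] show ?thesis by simp
      next
        case (Cons d l1)
        with L inside clean bounded_tape.inside[of l1 d "b # r0"] show ?thesis by simp
      qed
    qed
  next
    case (right l0)
    then have "b = RightEnd" "m \<noteq> MoveRight" using ends by auto
    then consider "l' = l0 @ [LeftEnd]" "r' = [RightEnd]"
      | "l' = tl (l0 @ [LeftEnd])" "r' = [scan (l0 @ [LeftEnd]), RightEnd]"
      using w right by (cases m) auto
    then show ?thesis
    proof cases
      case 1
      with bounded_tape.right[OF right(3)] show ?thesis by simp
    next
      case 2
      show ?thesis
      proof (cases l0)
        case Nil
        with 2 bounded_tape.left[of "[]"] show ?thesis by simp
      next
        case (Cons d l1)
        with 2 right bounded_tape.inside[of l1 d "[]"] show ?thesis by simp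
      qed
    qed
  qed
qed

locale unpadding =
  fixes X :: "'a set" and M :: "('q, 'a option, 'g) tm"
  assumes M: "lba_over (insert None (Some ` X)) M" and X: "finite X"
begin

abbreviation Y :: "'a option set" where "Y \<equiv> insert None (Some ` X)"

abbreviation enc_word :: "'a option list \<Rightarrow> ('a, ('a option, 'g) cell) cell list" where
  "enc_word u \<equiv> map (\<lambda>y. enc (Letter y)) u"

inductive unpad_trans :: "('q, 'a) unpad_frame \<Rightarrow> ('a, ('a option, 'g) cell) cell \<Rightarrow> ('q, 'a) unpad_frame
    \<Rightarrow> ('a, ('a option, 'g) cell) cell \<Rightarrow> move \<Rightarrow> bool" where
  roam_right: "y \<in> Y \<Longrightarrow> unpad_trans Roam (enc (Letter y)) Roam (enc (Letter y)) MoveRight"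
| roam_left: "y \<in> Y \<Longrightarrow> unpad_trans Roam (enc (Letter y)) Insert (enc (Letter y)) MoveLeft"
| lift: "x \<in> X \<Longrightarrow> unpad_trans Roam (enc (Letter (Some x))) (Carry x) (enc (Letter None)) MoveLeft"
| extend: "unpad_trans Roam Blank Roam (enc (Letter None)) MoveRight"
| right_end: "unpad_trans Roam Blank Place (enc RightEnd) MoveLeft"
| stay: "y \<in> Y \<Longrightarrow> unpad_trans Insert (enc (Letter y)) Roam (enc (Letter y)) Stay"
| insert: "unpad_trans Insert Blank Roam (enc (Letter None)) Stay"
| drop: "x \<in> X \<Longrightarrow> unpad_trans (Carry x) (enc (Letter None)) Roam (enc (Letter (Some x))) Stay"
| place: "y \<in> Y \<Longrightarrow> unpad_trans Place (enc (Letter y)) Place (enc (Letter y)) MoveLeft"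
| left_end: "unpad_trans Place Blank (Play (tm_start M)) (enc LeftEnd) Stay"
| play: "(p, c, q, b, m) \<in> tm_trans M \<Longrightarrow> unpad_trans (Play p) (enc c) (Play q) (enc b) m"

definition unpadded :: "(('q, 'a) unpad_frame, 'a, ('a option, 'g) cell) tm" where
  "unpadded = \<lparr>tm_states = {Roam, Insert, Place} \<union> Carry ` X \<union> Play ` tm_states M,
     tm_tape = insert Blank (enc ` tm_tape M), tm_start = Roam, tm_final = Play ` tm_final M,
     tm_trans = {(p, a, q, b, m). unpad_trans p a q b m}\<rparr>"

abbreviation reaches where "reaches \<equiv> (tm_step unpadded)\<^sup>*\<^sup>*"

lemma M_in:
  "(p, a, q, b, m) \<in> tm_trans M \<Longrightarrow> p \<in> tm_states M \<and> a \<in> tm_tape M \<and> q \<in> tm_states M \<and> b \<in> tm_tape M"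
  "y \<in> Y \<Longrightarrow> Letter y \<in> tm_tape M" "LeftEnd \<in> tm_tape M" "RightEnd \<in> tm_tape M" "tm_start M \<in> tm_states M"
  using M unfolding lba_over_def tm_over_def by auto

lemma unpad_trans_over:
  "unpad_trans p a q b m \<Longrightarrow> p \<in> tm_states unpadded \<and> a \<in> tm_tape unpadded \<and> q \<in> tm_states unpadded \<and> b \<in> tm_tape unpadded"
proof (induction rule: unpad_trans.induct)
  case (play p c q b m)
  from M_in(1)[OF play] show ?case by (simp add: unpadded_def)
qed (use M_in in \<open>auto simp: unpadded_def simp del: enc.simps intro!: imageI\<close>)

lemma unpadded_over: "tm_over X unpadded"
proof -
  have "tm_trans unpadded \<subseteq> tm_states unpadded \<times> tm_tape unpadded \<times> tm_states unpadded \<times> tm_tape unpadded \<times> UNIV"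
  proof
    fix t assume t: "t \<in> tm_trans unpadded"
    obtain p a q b m where tt: "t = (p, a, q, b, m)" by (cases t)
    with t have "unpad_trans p a q b m" by (simp add: unpadded_def)
    from unpad_trans_over[OF this]
    show "t \<in> tm_states unpadded \<times> tm_tape unpadded \<times> tm_states unpadded \<times> tm_tape unpadded \<times> UNIV"
      by (simp add: tt)
  qed
  moreover have "finite (tm_states unpadded)" "finite (tm_tape unpadded)" "tm_final unpadded \<subseteq> tm_states unpadded"
    using M X by (auto simp: unpadded_def tm_over_def lba_over_def)
  moreover have "Letter x \<in> enc ` tm_tape M" if "x \<in> X" for x
    using that M_in(2)[of "Some x"] by (intro image_eqI[of _ _ "Letter (Some x)"]) auto
  ultimately show ?thesis
    unfolding tm_over_def by (auto simp: unpadded_def)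
qed

lemma step_unpadI:
  "unpad_trans p a q b m \<Longrightarrow> (l', r') = write_move m b l r \<Longrightarrow> tm_step unpadded (l, p, a # r) (l', q, r')"
  by (rule tm_stepI) (simp_all add: unpadded_def)

lemma step_unpad_blankI:
  "unpad_trans p Blank q b m \<Longrightarrow> (l', r') = write_move m b l [] \<Longrightarrow> tm_step unpadded (l, p, []) (l', q, r')"
  unfolding tm_step_iff by (auto simp: unpadded_def)

lemma unpad_step_cases:
  assumes "tm_step unpadded (l, p, r) c'"
  obtains b m q l' r' where "c' = (l', q, r')" "unpad_trans p (scan r) q b m" "(l', r') = write_move m b l (tl r)"
  using assms by (cases c') (auto simp: tm_step_iff unpadded_def)

text \<open>
  The cases \<open>insert_end\<close> and \<open>place_end\<close> are those where the head has just left the word at its left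
  end. In state \<open>Roam\<close> a blank is scanned only at the right end, since every move to the left enters
  another state; this is why \<open>Roam\<close> may write the right endmarker on any blank that it sees.
\<close>

inductive invariant for w :: "'a list" where
  roam: "u1 \<in> lists Y \<Longrightarrow> u2 \<in> lists Y \<Longrightarrow> erase (rev u1 @ u2) = w \<Longrightarrow> invariant w (enc_word u1, Roam, enc_word u2)"
| insert: "u1 \<in> lists Y \<Longrightarrow> u2 \<in> lists Y \<Longrightarrow> erase (rev u1 @ u2) = w \<Longrightarrow> invariant w (enc_word u1, Insert, enc_word u2)"
| insert_end: "u \<in> lists Y \<Longrightarrow> erase u = w \<Longrightarrow> invariant w ([], Insert, Blank # enc_word u)"
| carry: "u1 \<in> lists Y \<Longrightarrow> u2 \<in> lists Y \<Longrightarrow> y \<in> Y \<Longrightarrow> x \<in> X \<Longrightarrow> erase (rev u1 @ y # Some x # u2) = w \<Longrightarrow>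
    invariant w (enc_word u1, Carry x, enc_word (y # None # u2))"
| carry_end: "invariant w ([], Carry x, Blank # r)"
| place: "u1 \<in> lists Y \<Longrightarrow> u2 \<in> lists Y \<Longrightarrow> erase (rev u1 @ u2) = w \<Longrightarrow>
    invariant w (enc_word u1, Place, enc_word u2 @ [enc RightEnd])"
| place_end: "u \<in> lists Y \<Longrightarrow> erase u = w \<Longrightarrow> invariant w ([], Place, Blank # enc_word u @ [enc RightEnd])"
| play: "u \<in> lists Y \<Longrightarrow> erase u = w \<Longrightarrow>
    (tm_step M)\<^sup>*\<^sup>* ([], tm_start M, LeftEnd # map Letter u @ [RightEnd]) (l, p, r) \<Longrightarrow> bounded_tape l r \<Longrightarrow>
    invariant w (map enc l, Play p, map enc r)"

lemma enc_Letter_eq: "enc (Letter y) = enc (Letter y') \<longleftrightarrow> y = y'"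
  using enc_inj by blast

lemma scan_enc_word: "scan (enc_word u) = enc (Letter y) \<longleftrightarrow> (\<exists>u'. u = y # u')"
  by (cases u) (auto simp: enc_Letter_eq)

lemma scan_enc_word_Blank: "scan (enc_word u) = Blank \<longleftrightarrow> u = []"
  by (cases u) auto

lemma write_move_enc:
  assumes "bounded_tape l r" "scan r = LeftEnd \<Longrightarrow> m \<noteq> MoveLeft" "(l1, r1) = write_move m b l (tl r)"
  shows "(map enc l1, map enc r1) = write_move m (enc b) (map enc l) (tl (map enc r))"
proof (cases m)
  case MoveLeft
  then obtain a l0 where "l = a # l0" using assms(2) bounded_tape_left_ne[OF assms(1)] by (cases l) auto
  with MoveLeft assms(3) show ?thesis by (simp add: map_tl)
qed (use assms(3) in \<open>simp_all add: map_tl\<close>)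

lemma scan_enc: "bounded_tape l r \<Longrightarrow> scan (map enc r) = enc (scan r)"
  using bounded_tape_right_ne by (cases r) auto

lemma trans_not_left: "(p, c, q, b, m) \<in> tm_trans M \<Longrightarrow> c = LeftEnd \<Longrightarrow> m \<noteq> MoveLeft"
  using M unfolding lba_over_def by auto

lemma invariant_step:
  assumes "invariant w c" "tm_step unpadded c c'"
  shows "invariant w c'"
  using assms(1)
proof cases
  case (roam u1 u2)
  from assms(2)[unfolded roam(1)] obtain b m q l' r' where c': "c' = (l', q, r')" and
    tr: "unpad_trans Roam (scan (enc_word u2)) q b m" and
    w: "(l', r') = write_move m b (enc_word u1) (tl (enc_word u2))"
    by (elim unpad_step_cases) blast
  from tr show ?thesis
  proof cases
    case (roam_right y)
    then obtain u where "u2 = y # u" by (auto simp: scan_enc_word)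
    with roam_right w roam invariant.roam[of "y # u1" u w] show ?thesis by (simp add: c')
  next
    case (roam_left y)
    then obtain u where u: "u2 = y # u" by (auto simp: scan_enc_word)
    show ?thesis
    proof (cases u1)
      case Nil
      with u roam_left w roam invariant.insert_end[of u2 w] show ?thesis by (simp add: c')
    next
      case (Cons z u')
      with u roam_left w roam invariant.insert[of u' "z # u2" w] show ?thesis by (simp add: c')
    qed
  next
    case (lift x)
    then obtain u where u: "u2 = Some x # u" by (auto simp: scan_enc_word simp del: enc.simps)
    show ?thesis
    proof (cases u1)
      case Nil
      with u lift w roam show ?thesis by (simp add: c' invariant.carry_end)
    next
      case (Cons z u')
      with u lift w roam invariant.carry[of u' u z x w] show ?thesis by (simp add: c')
    qed
  next
    case extend
    then have "u2 = []" by (simp add: scan_enc_word_Blank)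
    with extend w roam invariant.roam[of "None # u1" "[]" w] show ?thesis by (simp add: c')
  next
    case right_end
    then have u: "u2 = []" by (simp add: scan_enc_word_Blank)
    show ?thesis
    proof (cases u1)
      case Nil
      with u right_end w roam invariant.place_end[of "[]" w] show ?thesis by (simp add: c')
    next
      case (Cons z u')
      with u right_end w roam invariant.place[of u' "[z]" w] show ?thesis by (simp add: c')
    qed
  qed
next
  case (insert u1 u2)
  from assms(2)[unfolded insert(1)] obtain b m q l' r' where c': "c' = (l', q, r')" and
    tr: "unpad_trans Insert (scan (enc_word u2)) q b m" and
    w: "(l', r') = write_move m b (enc_word u1) (tl (enc_word u2))"
    by (elim unpad_step_cases) blast
  from tr show ?thesis
  proof cases
    case (stay y)
    then obtain u where "u2 = y # u" by (auto simp: scan_enc_word)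
    with stay w insert invariant.roam[of u1 u2 w] show ?thesis by (simp add: c')
  next
    case insert': insert
    then have "u2 = []" by (simp add: scan_enc_word_Blank)
    with insert' w insert invariant.roam[of u1 "[None]" w] show ?thesis by (simp add: c')
  qed
next
  case (insert_end u)
  from assms(2)[unfolded insert_end(1)] obtain b m q l' r' where c': "c' = (l', q, r')" and
    tr: "unpad_trans Insert Blank q b m" and w: "(l', r') = write_move m b [] (enc_word u)"
    by (elim unpad_step_cases) simp
  from tr show ?thesis
  proof cases
    case insert
    with w insert_end invariant.roam[of "[]" "None # u" w] show ?thesis by (simp add: c')
  qed auto
next
  case (carry u1 u2 y x)
  from assms(2)[unfolded carry(1)] obtain b m q l' r' where c': "c' = (l', q, r')" and
    tr: "unpad_trans (Carry x) (enc (Letter y)) q b m" and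
    w: "(l', r') = write_move m b (enc_word u1) (enc_word (None # u2))"
    by (elim unpad_step_cases) simp
  from tr show ?thesis
  proof cases
    case drop
    then have "y = None" by (metis enc_Letter_eq)
    with drop w carry invariant.roam[of u1 "Some x # None # u2" w] show ?thesis by (simp add: c')
  qed
next
  case (carry_end x r)
  from assms(2)[unfolded carry_end] obtain q b m where "unpad_trans (Carry x) Blank q b m"
    by (elim unpad_step_cases) simp
  then show ?thesis by cases auto
next
  case (place u1 u2)
  from assms(2)[unfolded place(1)] obtain b m q l' r' where c': "c' = (l', q, r')" and
    tr: "unpad_trans Place (scan (enc_word u2 @ [enc RightEnd])) q b m" and
    w: "(l', r') = write_move m b (enc_word u1) (tl (enc_word u2 @ [enc RightEnd]))"
    by (elim unpad_step_cases) blast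
  from tr show ?thesis
  proof cases
    case (place y)
    obtain u where u: "u2 = y # u"
    proof (cases u2)
      case Nil
      with place(1) have "enc (RightEnd :: ('a option, 'g) cell) = enc (Letter y)" by (simp only: list.map append.simps scan_simps)
      from enc_inj[OF this] show ?thesis by simp
    next
      case (Cons z u)
      with place(1) have "enc (Letter z :: ('a option, 'g) cell) = enc (Letter y)" by (simp only: list.map append.simps scan_simps)
      with Cons that show ?thesis by (simp add: enc_Letter_eq)
    qed
    show ?thesis
    proof (cases u1)
      case Nil
      with u place w \<open>u1 \<in> lists Y\<close> \<open>u2 \<in> lists Y\<close> \<open>erase (rev u1 @ u2) = w\<close> invariant.place_end[of u2 w]
      show ?thesis by (simp add: c')
    next
      case (Cons z u')
      with u place w \<open>u1 \<in> lists Y\<close> \<open>u2 \<in> lists Y\<close> \<open>erase (rev u1 @ u2) = w\<close> invariant.place[of u' "z # u2" w]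
      show ?thesis by (simp add: c')
    qed
  next
    case left_end
    then show ?thesis by (cases u2) auto
  qed
next
  case (place_end u)
  from assms(2)[unfolded place_end(1)] obtain b m q l' r' where c': "c' = (l', q, r')" and
    tr: "unpad_trans Place Blank q b m" and w: "(l', r') = write_move m b [] (enc_word u @ [enc RightEnd])"
    by (elim unpad_step_cases) simp
  from tr show ?thesis
  proof cases
    case left_end
    have "bounded_tape [] (LeftEnd # map Letter u @ [RightEnd])"
      by (rule bounded_tape.left) auto
    from invariant.play[OF place_end(2,3) rtranclp.rtrancl_refl this] left_end w
    show ?thesis by (simp add: c' o_def)
  qed auto
next
  case (play u l p r)
  from assms(2)[unfolded play(1)] obtain b m q l' r' where c': "c' = (l', q, r')" and
    tr: "unpad_trans (Play p) (scan (map enc r)) q b m" and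
    w: "(l', r') = write_move m b (map enc l) (tl (map enc r))"
    by (elim unpad_step_cases) blast
  from tr show ?thesis
  proof cases
    case play': (play c q0 b0)
    then have c: "c = scan r" using scan_enc[OF play(5)] enc_inj by metis
    obtain l1 r1 where w1: "(l1, r1) = write_move m b0 l (tl r)" by (metis surj_pair)
    have step: "tm_step M (l, p, r) (l1, q0, r1)"
      unfolding tm_step_iff using play'(4) w1 unfolding c by blast
    have "(l', r') = (map enc l1, map enc r1)"
      using write_move_enc[OF play(5) trans_not_left[OF play'(4)[unfolded c]] w1] w play'(3) by simp
    with invariant.play[OF play(2,3) rtranclp.rtrancl_into_rtrancl[OF play(4) step] bounded_tape_step[OF M step play(5)]]
    show ?thesis by (simp add: c' play'(2))
  qed
qed

lemma unpadded_sound: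
  assumes "w \<in> tm_lang X unpadded"
  shows "w \<in> erase ` lba_lang Y M"
proof -
  from assms obtain q l r where w: "w \<in> lists X" and q: "q \<in> tm_final M"
    and run: "reaches ([], Roam, map Letter w) (l, Play q, r)"
    by (auto simp: tm_lang_def unpadded_def)
  have "map Some w \<in> lists Y" using w by auto
  then have start: "invariant w ([], Roam, map Letter w)"
    using invariant.roam[of "[]" "map Some w" w] by (simp add: o_def)
  have "invariant w c" if "reaches ([], Roam, map Letter w) c" for c
    using that by induction (auto intro: start invariant_step)
  from this[OF run] obtain u l r where "u \<in> lists Y" "erase u = w"
    "(tm_step M)\<^sup>*\<^sup>* ([], tm_start M, LeftEnd # map Letter u @ [RightEnd]) (l, q, r)"
    by cases auto
  with q have "u \<in> lba_lang Y M" by (auto simp: lba_lang_def)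
  then show ?thesis using \<open>erase u = w\<close> by (rule image_eqI[OF HOL.sym, rotated])
qed

text \<open>
  Padding is inserted in front of the scanned cell by adding a cell at the left end and letting it pass
  the cells of \<open>u1\<close> one after another.
\<close>

lemma insert_run:
  "u1 \<in> lists Y \<Longrightarrow> y \<in> Y \<Longrightarrow> reaches (enc_word u1, Roam, enc_word (y # u2))
     (enc_word (None # u1), Roam, enc_word (y # u2))"
proof (induction u1 arbitrary: y u2)
  case Nil
  have "reaches ([], Roam, enc_word (y # u2)) ([], Insert, Blank # enc_word (y # u2))"
    unfolding list.map o_apply by (rule r_into_rtranclp, rule step_unpadI[OF unpad_trans.roam_left]) (use Nil in auto)
  also have "tm_step unpadded \<dots> ([], Roam, enc_word (None # y # u2))"
    by (rule step_unpadI[OF unpad_trans.insert]) simp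
  also have "tm_step unpadded \<dots> (enc_word [None], Roam, enc_word (y # u2))"
    unfolding list.map o_apply by (rule step_unpadI[OF unpad_trans.roam_right]) auto
  finally show ?case by simp
next
  case (Cons z u1)
  have z: "z \<in> Y" "u1 \<in> lists Y" using Cons.prems by auto
  have "reaches (enc_word (z # u1), Roam, enc_word (y # u2)) (enc_word u1, Insert, enc_word (z # y # u2))"
    unfolding list.map o_apply by (rule r_into_rtranclp, rule step_unpadI[OF unpad_trans.roam_left]) (use Cons in auto)
  also have "tm_step unpadded \<dots> (enc_word u1, Roam, enc_word (z # y # u2))"
    unfolding list.map o_apply by (rule step_unpadI[OF unpad_trans.stay]) (use z in auto)
  also have "reaches \<dots> (enc_word (None # u1), Roam, enc_word (z # y # u2))"
    by (rule Cons.IH) (use z in auto)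
  also have "reaches \<dots> (enc_word (None # z # u1), Roam, enc_word (y # u2))"
  proof (cases z)
    case None
    show ?thesis
      unfolding list.map o_apply None
      by (rule r_into_rtranclp, rule step_unpadI[OF unpad_trans.roam_right]) auto
  next
    case (Some x)
    have "reaches (enc_word (None # u1), Roam, enc_word (z # y # u2)) (enc_word u1, Carry x, enc_word (None # None # y # u2))"
      unfolding list.map o_apply Some
      by (rule r_into_rtranclp, rule step_unpadI[OF unpad_trans.lift]) (use z Some in auto)
    also have "tm_step unpadded \<dots> (enc_word u1, Roam, enc_word (z # None # y # u2))"
      unfolding list.map o_apply Some
      by (rule step_unpadI[OF unpad_trans.drop]) (use z Some in auto)
    also have "tm_step unpadded \<dots> (enc_word (z # u1), Roam, enc_word (None # y # u2))"
      unfolding list.map o_apply by (rule step_unpadI[OF unpad_trans.roam_right]) (use z in auto)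
    also have "tm_step unpadded \<dots> (enc_word (None # z # u1), Roam, enc_word (y # u2))"
      unfolding list.map o_apply by (rule step_unpadI[OF unpad_trans.roam_right]) auto
    finally show ?thesis .
  qed
  finally show ?case .
qed

text \<open>
  The padding of \<open>u\<close> is inserted from left to right.
\<close>

lemma spread_run:
  "u \<in> lists Y \<Longrightarrow> u1 \<in> lists Y \<Longrightarrow> reaches (enc_word u1, Roam, map Letter (erase u)) (enc_word (rev u @ u1), Roam, [])"
proof (induction u arbitrary: u1 rule: erase.induct)
  case 1
  then show ?case by simp
next
  case (2 u)
  have "reaches (enc_word u1, Roam, map Letter (erase u)) (enc_word (None # u1), Roam, map Letter (erase u))"
  proof (cases "erase u")
    case Nil
    then show ?thesis
      by (auto intro!: r_into_rtranclp step_unpad_blankI[OF unpad_trans.extend])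
  next
    case (Cons x w)
    have "Some x \<in> set u" using arg_cong[OF Cons, of set]
    proof -
      have "x \<in> set (erase u)" by (simp add: Cons)
      then show ?thesis by (induction u rule: erase.induct) auto
    qed
    then have "Some x \<in> Y" using 2(2) by auto
    from insert_run[OF 2(3) this, of "map Some w"] show ?thesis by (simp add: Cons o_def)
  qed
  also have "reaches \<dots> (enc_word (rev u @ None # u1), Roam, [])"
    by (rule 2(1)) (use 2 in auto)
  finally show ?case by simp
next
  case (3 x u)
  have "reaches (enc_word u1, Roam, enc (Letter (Some x)) # map Letter (erase u)) (enc_word (Some x # u1), Roam, map Letter (erase u))"
    by (rule r_into_rtranclp, rule step_unpadI[OF unpad_trans.roam_right]) (use 3 in auto)
  also have "reaches \<dots> (enc_word (rev u @ Some x # u1), Roam, [])"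
    by (rule 3(1)) (use 3 in auto)
  finally show ?case by simp
qed

lemma place_run:
  "u \<in> lists Y \<Longrightarrow> y \<in> Y \<Longrightarrow> reaches (enc_word u, Place, enc (Letter y) # r) ([], Place, Blank # enc_word (rev u) @ enc (Letter y) # r)"
proof (induction u arbitrary: y r)
  case Nil
  have "tm_step unpadded ([], Place, enc (Letter y) # r) ([], Place, Blank # enc (Letter y) # r)"
    by (rule step_unpadI[OF unpad_trans.place]) (use Nil in auto)
  then show ?case by (auto intro: r_into_rtranclp)
next
  case (Cons z u)
  have "reaches (enc_word (z # u), Place, enc (Letter y) # r) (enc_word u, Place, enc (Letter z) # enc (Letter y) # r)"
    by (rule r_into_rtranclp, rule step_unpadI[OF unpad_trans.place]) (use Cons in auto)
  also have "reaches \<dots> ([], Place, Blank # enc_word (rev u) @ enc (Letter z) # enc (Letter y) # r)"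
    by (rule Cons.IH) (use Cons in auto)
  finally show ?case by simp
qed

lemma play_run:
  assumes "(tm_step M)\<^sup>*\<^sup>* (l0, p0, r0) (l, p, r)" "bounded_tape l0 r0"
  shows "reaches (map enc l0, Play p0, map enc r0) (map enc l, Play p, map enc r) \<and> bounded_tape l r"
  using assms(1)
proof (induction "(l0, p0, r0)" "(l, p, r)" arbitrary: l p r rule: rtranclp.induct)
  case rtrancl_refl
  then show ?case using assms(2) by simp
next
  case (rtrancl_into_rtrancl c)
  obtain l1 p1 r1 where c: "c = (l1, p1, r1)" by (cases c)
  note IH = rtrancl_into_rtrancl(2)[OF c]
  have step: "tm_step M (l1, p1, r1) (l, p, r)" using rtrancl_into_rtrancl(3) c by simp
  then obtain b m where tr: "(p1, scan r1, p, b, m) \<in> tm_trans M" and w: "(l, r) = write_move m b l1 (tl r1)"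
    unfolding tm_step_iff by blast
  have "(map enc l, map enc r) = write_move m (enc b) (map enc l1) (tl (map enc r1))"
    by (rule write_move_enc[OF conjunct2[OF IH] trans_not_left[OF tr] w])
  moreover have "(Play p1, scan (map enc r1), Play p, enc b, m) \<in> tm_trans unpadded"
    using unpad_trans.play[OF tr] scan_enc[OF conjunct2[OF IH]] by (simp add: unpadded_def)
  ultimately have "tm_step unpadded (map enc l1, Play p1, map enc r1) (map enc l, Play p, map enc r)"
    unfolding tm_step_iff by blast
  with IH bounded_tape_step[OF M step] show ?case by (auto intro: rtranclp.rtrancl_into_rtrancl)
qed

lemma unpadded_complete:
  assumes "u \<in> lba_lang Y M"
  shows "erase u \<in> tm_lang X unpadded"
proof -
  from assms obtain q l r where u: "u \<in> lists Y" and q: "q \<in> tm_final M"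
    and run: "(tm_step M)\<^sup>*\<^sup>* ([], tm_start M, LeftEnd # map Letter u @ [RightEnd]) (l, q, r)"
    by (auto simp: lba_lang_def)
  have "reaches ([], Roam, map Letter (erase u)) (enc_word (rev u), Roam, [])"
    using spread_run[OF u, of "[]"] by simp
  also have "reaches \<dots> ([], Place, Blank # enc_word u @ [enc RightEnd])"
  proof (cases u rule: rev_cases)
    case Nil
    then show ?thesis
      by (auto intro!: r_into_rtranclp step_unpad_blankI[OF unpad_trans.right_end])
  next
    case (snoc u' y)
    have "reaches (enc_word (rev u), Roam, []) (enc_word (rev u'), Place, enc (Letter y) # [enc RightEnd])"
      by (rule r_into_rtranclp, rule step_unpad_blankI[OF unpad_trans.right_end]) (simp add: snoc)
    also have "reaches \<dots> ([], Place, Blank # enc_word (rev (rev u')) @ enc (Letter y) # [enc RightEnd])"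
      by (rule place_run) (use u snoc in auto)
    finally show ?thesis by (simp add: snoc)
  qed
  also have "tm_step unpadded \<dots> ([], Play (tm_start M), enc LeftEnd # enc_word u @ [enc RightEnd])"
    by (rule step_unpadI[OF unpad_trans.left_end]) simp
  also have "reaches \<dots> (map enc l, Play q, map enc r)"
  proof -
    have "bounded_tape [] (LeftEnd # map Letter u @ [RightEnd])"
      by (rule bounded_tape.left) auto
    from play_run[OF run this] show ?thesis by (simp add: o_def)
  qed
  finally have "reaches ([], Roam, map Letter (erase u)) (map enc l, Play q, map enc r)" .
  moreover have "erase u \<in> lists X"
    using u by (induction u rule: erase.induct) auto
  ultimately show ?thesis using q by (auto simp: tm_lang_def unpadded_def)
qed

lemma unpadded_lang: "tm_lang X unpadded = erase ` lba_lang Y M"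
  using unpadded_sound unpadded_complete by (intro subset_antisym subsetI) (assumption | elim imageE | simp)+

end

section \<open>Substitution closure of all four classes\<close>

lemma recursively_enumerable_erase:
  assumes "L \<in> languages CS (insert None (Some ` X))" "finite X"
  shows "erase ` L \<in> languages RE X"
proof -
  from assms obtain M :: "(nat, 'a option, nat) tm" where LM: "lba_over (insert None (Some ` X)) M"
    "L = lba_lang (insert None (Some ` X)) M" by auto
  interpret unpadding X M by unfold_locales (use LM assms in auto)
  from recursively_enumerableI[OF unpadded_over] show ?thesis by (simp only: unpadded_lang LM(2))
qed

lemma erase_path_lang:
  assumes "\<And>s v t. (s, v, t) \<in> D \<Longrightarrow> erase ` K' v = K v"
  shows "path_lang D K s w t \<longleftrightarrow> (\<exists>w'. path_lang D K' s w' t \<and> erase w' = w)"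
proof
  assume "path_lang D K s w t"
  then show "\<exists>w'. path_lang D K' s w' t \<and> erase w' = w"
  proof induction
    case Nil
    show ?case by (intro exI[of _ "[]"]) (simp add: path_lang.Nil)
  next
    case (Snoc u t v t' x)
    then obtain u' where u': "path_lang D K' s u' t" "erase u' = u" by blast
    from Snoc assms have "x \<in> erase ` K' v" by simp
    then obtain x' where "x' \<in> K' v" "erase x' = x" by blast
    with u' path_lang.Snoc[OF u'(1) Snoc(2)] show ?case by (intro exI[of _ "u' @ x'"]) simp
  qed
next
  assume "\<exists>w'. path_lang D K' s w' t \<and> erase w' = w"
  then obtain w' where "path_lang D K' s w' t" "erase w' = w" by blast
  then show "path_lang D K s w t"
  proof (induction arbitrary: w)
    case Nil
    then show ?case by (auto intro: path_lang.Nil)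
  next
    case (Snoc u t v t' x)
    have "erase x \<in> K v" using assms[OF Snoc(2)] Snoc(3) by blast
    from path_lang.Snoc[OF Snoc.IH[OF HOL.refl] Snoc(2) this] Snoc(5) show ?case by simp
  qed
qed

text \<open>
  Padding and erasing reduce the statement to context-sensitive languages, because erasing commutes with
  concatenation and with letter-to-letter maps.
\<close>

lemma recursively_enumerable_subst:
  fixes L :: "'v \<Rightarrow> 'a list set" and D :: "('s \<times> 'v \<times> 's) set" and Y :: "'b set"
  assumes D: "finite D" and Y: "finite Y"
    and L: "\<And>s v t. (s, v, t) \<in> D \<Longrightarrow> L v \<in> languages RE (X v) \<and> finite (X v) \<and> [] \<notin> L v"
    and f: "\<And>s v t. (s, v, t) \<in> D \<Longrightarrow> f v ` X v \<subseteq> Y"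
  shows "subst_lang D (\<lambda>v. map (f v) ` L v) s0 F \<in> languages RE Y"
proof -
  have "\<exists>L'. (\<exists>s t. (s, v, t) \<in> D) \<longrightarrow> L' \<in> languages CS (insert None (Some ` X v)) \<and> erase ` L' = L v" for v
    using L recursively_enumerable_padding by metis
  then obtain L' where L': "\<And>s v t. (s, v, t) \<in> D \<Longrightarrow>
      L' v \<in> languages CS (insert None (Some ` X v)) \<and> erase ` L' v = L v"
    by metis
  have "subst_lang D (\<lambda>v. map (map_option (f v)) ` L' v) s0 F \<in> languages CS (insert None (Some ` Y))"
  proof (rule context_sensitive_subst)
    fix s v t assume d: "(s, v, t) \<in> D"
    have "[] \<notin> L' v"
    proof
      assume "[] \<in> L' v"
      then have "erase [] \<in> L v" using L'[OF d] by blast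
      then show False using L[OF d] by simp
    qed
    then show "L' v \<in> languages CS (insert None (Some ` X v)) \<and> [] \<notin> L' v" using L'[OF d] by blast
    show "map_option (f v) ` insert None (Some ` X v) \<subseteq> insert None (Some ` Y)" using f[OF d] by auto
  qed (use D Y in simp_all)
  from recursively_enumerable_erase[OF this Y]
  have "erase ` subst_lang D (\<lambda>v. map (map_option (f v)) ` L' v) s0 F \<in> languages RE Y" .
  moreover have "path_lang D (\<lambda>v. map (f v) ` L v) s0 w t \<longleftrightarrow>
      (\<exists>w'. path_lang D (\<lambda>v. map (map_option (f v)) ` L' v) s0 w' t \<and> erase w' = w)" for w t
  proof (rule erase_path_lang)
    fix s v t assume "(s, v, t) \<in> D"
    from L'[OF this] have "L v = erase ` L' v" by simp
    then show "erase ` map (map_option (f v)) ` L' v = map (f v) ` L v"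
      by (simp add: image_image erase_map_option)
  qed
  then have "erase ` subst_lang D (\<lambda>v. map (map_option (f v)) ` L' v) s0 F = subst_lang D (\<lambda>v. map (f v) ` L v) s0 F"
    unfolding subst_lang_def by (auto simp: image_iff)
  ultimately show ?thesis by simp
qed

lemma languages_lists: "L \<in> languages C X \<Longrightarrow> L \<subseteq> lists X"
  by (cases C) (auto simp: fsa_lang_def pda_lang_def lba_lang_def tm_lang_def)

theorem languages_subst:
  fixes L :: "'v \<Rightarrow> 'a list set" and D :: "('s \<times> 'v \<times> 's) set" and Y :: "'b set"
  assumes "finite D" "finite Y"
    and "\<And>s v t. (s, v, t) \<in> D \<Longrightarrow> L v \<in> languages C (X v) \<and> finite (X v) \<and> [] \<notin> L v"
    and "\<And>s v t. (s, v, t) \<in> D \<Longrightarrow> f v ` X v \<subseteq> Y"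
  shows "subst_lang D (\<lambda>v. map (f v) ` L v) s0 F \<in> languages C Y"
proof (cases C)
  case Regular
  then show ?thesis using assms regular_subst[of D L X f Y s0 F] by blast
next
  case CF
  then show ?thesis using assms context_free_subst[of D L X f Y s0 F] by blast
next
  case CS
  then show ?thesis using assms context_sensitive_subst[of D Y L X f s0 F] by blast
next
  case RE
  then show ?thesis using assms recursively_enumerable_subst[of D Y L X f s0 F] by blast
qed

text \<open>
  The special case of a graph with one edge. It serves to bring languages over different alphabets to a
  common one.
\<close>

lemma languages_map:
  assumes "L \<in> languages C X" "finite X" "[] \<notin> L" "finite Y" "f ` X \<subseteq> Y"
  shows "map f ` L \<in> languages C Y"
proof -
  let ?D = "{(False, (), True)}"
  have path: "path_lang ?D (\<lambda>_. map f ` L) False w t \<longleftrightarrow> (if t then w \<in> map f ` L else w = [])" for w t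
  proof
    assume "path_lang ?D (\<lambda>_. map f ` L) False w t"
    then show "if t then w \<in> map f ` L else w = []" by induction auto
  next
    assume "if t then w \<in> map f ` L else w = []"
    then show "path_lang ?D (\<lambda>_. map f ` L) False w t"
      using path_lang.Nil[of ?D "\<lambda>_. map f ` L" False]
        path_lang.Snoc[OF path_lang.Nil, of False "()" True ?D w "\<lambda>_. map f ` L"]
      by (cases t) auto
  qed
  have "subst_lang ?D (\<lambda>v. map ((\<lambda>_. f) v) ` (\<lambda>_. L) v) False {True} \<in> languages C Y"
    by (rule languages_subst[where X = "\<lambda>_. X"]) (use assms in auto)
  moreover have "subst_lang ?D (\<lambda>_. map f ` L) False {True} = map f ` L"
    unfolding subst_lang_def using path by auto
  ultimately show ?thesis by simp
qed

section \<open>Words and their values\<close>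

lemma word_val_simps [simp]:
  "word_val G [] = \<one>\<^bsub>G\<^esub>" "word_val G (x # w) = x \<otimes>\<^bsub>G\<^esub> word_val G w"
  by (simp_all add: word_val_def)

lemma (in group) word_val_closed: "w \<in> lists (carrier G) \<Longrightarrow> word_val G w \<in> carrier G"
  by (induction w) auto

lemma (in group) word_val_append:
  "u \<in> lists (carrier G) \<Longrightarrow> w \<in> lists (carrier G) \<Longrightarrow> word_val G (u @ w) = word_val G u \<otimes> word_val G w"
  by (induction u) (auto simp: word_val_closed m_assoc in_lists_conv_set)

lemma word_val_hom:
  assumes "group G" "group H" "h \<in> hom G H" "w \<in> lists (carrier G)"
  shows "word_val H (map h w) = h (word_val G w)"
  using assms(4)
proof (induction w)
  case Nil
  then show ?case using hom_one[OF assms(3,1,2)] by simp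
next
  case (Cons a w)
  then show ?case using hom_mult[OF assms(3)] group.word_val_closed[OF assms(1)] by auto
qed

text \<open>
  The language alone makes \<open>X\<close> a generating set, as the empty word takes care of the identity.
\<close>

lemma epiCI:
  assumes "group G" "finite X" "X \<subseteq> carrier G" "L \<in> languages C X"
    and nontriv: "\<And>w. w \<in> L \<Longrightarrow> word_val G w \<noteq> \<one>\<^bsub>G\<^esub>"
    and onto: "\<And>h. h \<in> carrier G \<Longrightarrow> h \<noteq> \<one>\<^bsub>G\<^esub> \<Longrightarrow> \<exists>w\<in>L. word_val G w = h"
  shows "epiC C G"
proof -
  have L: "L \<subseteq> lists X" using languages_lists[OF assms(4)] .
  have "h \<in> word_val G ` lists X" if "h \<in> carrier G" for h
  proof (cases "h = \<one>\<^bsub>G\<^esub>")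
    case True
    then show ?thesis by (intro image_eqI[of _ _ "[]"]) auto
  next
    case False
    with onto[OF that] L show ?thesis by blast
  qed
  moreover have "word_val G w \<in> carrier G" if "w \<in> lists X" for w
    using that assms(3) by (intro group.word_val_closed[OF assms(1)]) auto
  ultimately have "word_val G ` lists X = carrier G" by blast
  moreover have "\<forall>w\<in>L. word_val G w \<noteq> \<one>\<^bsub>G\<^esub>" using nontriv by blast
  moreover have "\<forall>h\<in>carrier G - {\<one>\<^bsub>G\<^esub>}. \<exists>w\<in>L. word_val G w = h" using onto by simp
  ultimately show ?thesis
    unfolding epiC_def using assms(1-4) L by (intro conjI exI[of _ X] exI[of _ L]) simp_all
qed

lemma epiCE:
  assumes "epiC C G"
  obtains X L where "group G" "finite X" "X \<subseteq> carrier G" "L \<in> languages C X" "L \<subseteq> lists X" "[] \<notin> L"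
    "\<And>w. w \<in> L \<Longrightarrow> word_val G w \<noteq> \<one>\<^bsub>G\<^esub>"
    "\<And>h. h \<in> carrier G \<Longrightarrow> h \<noteq> \<one>\<^bsub>G\<^esub> \<Longrightarrow> \<exists>w\<in>L. word_val G w = h"
proof -
  from assms obtain X L where *: "group G" "finite X" "X \<subseteq> carrier G" "L \<in> languages C X" "L \<subseteq> lists X"
    "\<forall>w\<in>L. word_val G w \<noteq> \<one>\<^bsub>G\<^esub>" "\<forall>h\<in>carrier G - {\<one>\<^bsub>G\<^esub>}. \<exists>w\<in>L. word_val G w = h"
    unfolding epiC_def by blast
  have "[] \<notin> L" using *(6) by force
  from that[OF *(1-5) this] *(6,7) show thesis by simp
qed

section \<open>Extensions\<close>

lemma epiC_extension:
  fixes E (structure)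
  assumes N: "N \<lhd> E" and epiN: "epiC C (E\<lparr>carrier := N\<rparr>)" and epiQ: "epiC C (E Mod N)"
  shows "epiC C E"
proof -
  interpret normal N E by fact
  have grpQ: "group (E Mod N)" by (rule factorgroup_is_group)
  from epiN obtain A K where A: "finite A" "A \<subseteq> N" "K \<in> languages C A" "K \<subseteq> lists A" "[] \<notin> K"
    and K_nontriv: "\<And>w. w \<in> K \<Longrightarrow> word_val (E\<lparr>carrier := N\<rparr>) w \<noteq> \<one>"
    and K_onto: "\<And>h. h \<in> N \<Longrightarrow> h \<noteq> \<one> \<Longrightarrow> \<exists>w\<in>K. word_val (E\<lparr>carrier := N\<rparr>) w = h"
    by (elim epiCE) simp
  from epiQ obtain B L where B: "finite B" "B \<subseteq> carrier (E Mod N)" "L \<in> languages C B" "L \<subseteq> lists B" "[] \<notin> L"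
    and L_nontriv: "\<And>w. w \<in> L \<Longrightarrow> word_val (E Mod N) w \<noteq> N"
    and L_onto: "\<And>h. h \<in> carrier (E Mod N) \<Longrightarrow> h \<noteq> N \<Longrightarrow> \<exists>w\<in>L. word_val (E Mod N) w = h"
    by (elim epiCE) (simp add: FactGroup_def)
  have valN: "word_val (E\<lparr>carrier := N\<rparr>) w = word_val E w" for w
    by (induction w) auto
  define s where "s c = (SOME x. x \<in> carrier E \<and> N #> x = c)" for c
  have s: "s c \<in> carrier E" "N #> s c = c" if "c \<in> carrier (E Mod N)" for c
  proof -
    have "\<exists>x. x \<in> carrier E \<and> N #> x = c" using that by (auto simp: FactGroup_def RCOSETS_def)
    from someI_ex[OF this] show "s c \<in> carrier E" "N #> s c = c" by (auto simp: s_def)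
  qed
  have hom: "(\<lambda>x. N #> x) \<in> hom E (E Mod N)"
    by (rule r_coset_hom_Mod)
  have lift: "N #> word_val E (map s w) = word_val (E Mod N) w" and lift_lists: "map s w \<in> lists (carrier E)"
    if "w \<in> L" for w
  proof -
    have w: "w \<in> lists (carrier (E Mod N))" using that B by auto
    then show *: "map s w \<in> lists (carrier E)" using s(1) by auto
    have "map (\<lambda>x. N #> x) (map s w) = w" using w s(2) by (induction w) auto
    then show "N #> word_val E (map s w) = word_val (E Mod N) w"
      using word_val_hom[OF is_group grpQ hom *] by simp
  qed
  define Y where "Y = A \<union> s ` B"
  have Y: "finite Y" "Y \<subseteq> carrier E"
    using A B s(1) subset by (auto simp: Y_def)
  \<comment> \<open>The paths from 0 to 1 or 2 spell K, s(L) and K s(L); True is the label of the quotient.\<close>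
  define D :: "(nat \<times> bool \<times> nat) set" where "D = {(0, False, 1), (0, True, 2), (1, True, 2)}"
  define J where "J v = (if v then map s ` L else map id ` K)" for v
  have "map s ` L \<in> languages C Y"
    by (rule languages_map[OF B(3,1,5) Y(1)]) (simp add: Y_def)
  moreover have "map id ` K \<in> languages C Y"
    by (rule languages_map[OF A(3,1,5) Y(1)]) (simp add: Y_def)
  ultimately have J: "J v \<in> languages C Y \<and> finite Y \<and> [] \<notin> J v" for v
    using A(5) B(5) Y(1) by (auto simp: J_def)
  have "subst_lang D (\<lambda>v. map id ` J v) 0 {1, 2} \<in> languages C Y"
    using J Y by (intro languages_subst[where X = "\<lambda>_. Y"]) (auto simp: D_def)
  then have lang: "subst_lang D J 0 {1, 2} \<in> languages C Y" by simp
  have pathI: "path_lang D J 0 w 1" if "w \<in> K" for w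
    using path_lang.Snoc[OF path_lang.Nil, of 0 False 1 D w J] that by (simp add: D_def J_def)
  have pathI2: "path_lang D J 0 (map s w) 2" if "w \<in> L" for w
    using path_lang.Snoc[OF path_lang.Nil, of 0 True 2 D "map s w" J] that by (simp add: D_def J_def)
  have pathI3: "path_lang D J 0 (u @ map s w) 2" if "u \<in> K" "w \<in> L" for u w
    using path_lang.Snoc[OF pathI[OF that(1)], of True 2 "map s w"] that by (simp add: D_def J_def)
  have pathD: "(t = 0 \<and> w = []) \<or> (t = 1 \<and> w \<in> K) \<or>
      (t = 2 \<and> (w \<in> map s ` L \<or> (\<exists>u\<in>K. \<exists>x\<in>map s ` L. w = u @ x)))" if "path_lang D J 0 w t" for w t
    using that
  proof induction
    case (Snoc u t v t' x)
    from Snoc(2) consider "t = 0" "\<not> v" "t' = 1" | "t = 0" "v" "t' = 2" | "t = 1" "v" "t' = 2"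
      by (auto simp: D_def)
    then show ?case
    proof cases
      case 3
      then have "u \<in> K" "x \<in> map s ` L" using Snoc.IH Snoc(3) by (auto simp: J_def)
      then have "\<exists>u'\<in>K. \<exists>x'\<in>map s ` L. u @ x = u' @ x'" by blast
      then show ?thesis using 3 by simp
    qed (use Snoc.IH Snoc(3) in \<open>auto simp: J_def\<close>)
  qed simp
  have outside: "word_val E (u @ map s y) \<notin> N" if "u = [] \<or> u \<in> K" "y \<in> L" for u y
  proof
    assume *: "word_val E (u @ map s y) \<in> N"
    have u: "u \<in> lists N" using that(1) A by auto
    have uE: "u \<in> lists (carrier E)" using u subset by auto
    have "word_val E u \<in> N" using u by (induction u) auto
    moreover have "word_val E u \<otimes> word_val E (map s y) \<in> N"
      using * word_val_append[OF uE lift_lists[OF that(2)]] by simp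
    ultimately have "inv (word_val E u) \<otimes> (word_val E u \<otimes> word_val E (map s y)) \<in> N" by simp
    then have "word_val E (map s y) \<in> N"
      using word_val_closed[OF uE] word_val_closed[OF lift_lists[OF that(2)]] by (simp add: m_assoc [symmetric])
    then have "N #> word_val E (map s y) = N"
      by (rule rcos_const[OF is_group])
    with lift[OF that(2)] L_nontriv[OF that(2)] show False by simp
  qed
  show ?thesis
  proof (rule epiCI[OF is_group Y lang])
    fix w assume "w \<in> subst_lang D J 0 {1, 2}"
    then obtain t where "t \<in> {1, 2}" "path_lang D J 0 w t" by (auto simp: subst_lang_def)
    with pathD[OF this(2)] consider "w \<in> K" | "w \<in> map s ` L" | "\<exists>u\<in>K. \<exists>x\<in>map s ` L. w = u @ x" by auto
    then show "word_val E w \<noteq> \<one>"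
    proof cases
      case 1
      then show ?thesis using K_nontriv valN by simp
    next
      case 2
      then obtain y where y: "w = [] @ map s y" "y \<in> L" by auto
      from outside[of "[]" y] y one_closed show ?thesis by (intro notI) simp
    next
      case 3
      then obtain u y where y: "w = u @ map s y" "u \<in> K" "y \<in> L" by blast
      from outside[of u y] y one_closed show ?thesis by (intro notI) simp
    qed
  next
    fix h assume h: "h \<in> carrier E" "h \<noteq> \<one>"
    have "\<exists>w t. t \<in> {1, 2} \<and> path_lang D J 0 w t \<and> word_val E w = h"
    proof (cases "h \<in> N")
      case True
      then obtain w where "w \<in> K" "word_val E w = h" using K_onto h(2) valN by auto
      with pathI show ?thesis by blast
    next
      case False
      have "N #> h \<in> carrier (E Mod N)" using h by (auto simp: FactGroup_def RCOSETS_def)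
      moreover have "N #> h \<noteq> N" using False h rcos_self[OF h(1) subgroup_axioms] by auto
      ultimately obtain y where y: "y \<in> L" "word_val (E Mod N) y = N #> h" using L_onto by blast
      define x where "x = word_val E (map s y)"
      have x: "x \<in> carrier E" using lift_lists[OF y(1)] by (simp add: x_def word_val_closed)
      have "h \<in> N #> x" using lift[OF y(1)] y(2) rcos_self[OF h(1) subgroup_axioms] by (simp add: x_def)
      then obtain n where n: "n \<in> N" "h = n \<otimes> x" by (auto simp: r_coset_def)
      show ?thesis
      proof (cases "n = \<one>")
        case True
        with pathI2[OF y(1)] n x show ?thesis by (auto simp: x_def)
      next
        case False
        then obtain u where u: "u \<in> K" "word_val E u = n" using K_onto n(1) valN by auto
        have "u \<in> lists (carrier E)" using u A subset by auto
        from word_val_append[OF this lift_lists[OF y(1)]] pathI3[OF u(1) y(1)] n(2) u(2)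
        show ?thesis by (auto simp: x_def)
      qed
    qed
    then show "\<exists>w\<in>subst_lang D J 0 {1, 2}. word_val E w = h" by (auto simp: subst_lang_def)
  qed
qed

section \<open>Presented groups\<close>

definition pres_class :: "'x set \<Rightarrow> 'x group_word set \<Rightarrow> 'x group_word \<Rightarrow> 'x group_word set" where
  "pres_class X R w = {u. pres_eq X R w u}"

locale presentation =
  fixes X :: "'x set" and R :: "'x group_word set"
  assumes R: "R \<subseteq> group_words X"
begin

abbreviation eqv (infix "\<approx>" 50) where "u \<approx> w \<equiv> pres_eq X R u w"

abbreviation P where "P \<equiv> presented_group X R"

abbreviation word_class where "word_class \<equiv> pres_class X R"

lemma eqv_words: "u \<approx> w \<Longrightarrow> u \<in> group_words X \<and> w \<in> group_words X"
proof (induction rule: pres_eq.induct)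
  case (relator u w r)
  then have "r \<in> group_words X" using R by blast
  with relator show ?case by simp
qed auto

lemma eqv_context:
  "u \<approx> w \<Longrightarrow> a \<in> group_words X \<Longrightarrow> b \<in> group_words X \<Longrightarrow> a @ u @ b \<approx> a @ w @ b"
proof (induction rule: pres_eq.induct)
  case (refl w)
  then show ?case by (intro pres_eq.refl) simp
next
  case (sym u w)
  then show ?case by (blast intro: pres_eq.sym)
next
  case (trans u v w)
  then show ?case by (blast intro: pres_eq.trans)
next
  case (cancel u w x b')
  then show ?case using pres_eq.cancel[of "a @ u" X "w @ b" x R b'] by simp
next
  case (relator u w r)
  then show ?case using pres_eq.relator[of "a @ u" X "w @ b" r R] by simp
qed

lemma eqv_append: "u \<approx> u' \<Longrightarrow> w \<approx> w' \<Longrightarrow> u @ w \<approx> u' @ w'"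
  using eqv_context[of u u' "[]" w] eqv_context[of w w' u' "[]"] eqv_words[of u u'] eqv_words[of w w']
  by (auto intro: pres_eq.trans)

lemma word_class_eq_iff: "u \<in> group_words X \<Longrightarrow> word_class u = word_class w \<longleftrightarrow> u \<approx> w"
  unfolding pres_class_def using pres_eq.refl[of u X R] by (auto intro: pres_eq.sym pres_eq.trans)

lemma carrier_P: "carrier P = word_class ` group_words X"
  unfolding presented_group_def pres_class_def quotient_def by auto

lemma word_class_in [simp]: "w \<in> group_words X \<Longrightarrow> word_class w \<in> carrier P"
  by (simp add: carrier_P)

lemma one_P: "\<one>\<^bsub>P\<^esub> = word_class []"
  by (simp add: presented_group_def pres_class_def)

lemma mult_P:
  assumes "u \<in> group_words X" "w \<in> group_words X"
  shows "word_class u \<otimes>\<^bsub>P\<^esub> word_class w = word_class (u @ w)"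
proof -
  have "{z. \<exists>a\<in>word_class u. \<exists>b\<in>word_class w. a @ b \<approx> z} = word_class (u @ w)"
    unfolding pres_class_def
    using assms eqv_append pres_eq.refl by (blast intro: pres_eq.trans pres_eq.sym)
  then show ?thesis by (simp add: presented_group_def)
qed

definition inv_word :: "'x group_word \<Rightarrow> 'x group_word" where
  "inv_word w = rev (map (\<lambda>(x, b). (x, \<not> b)) w)"

lemma inv_word: "w \<in> group_words X \<Longrightarrow> inv_word w \<in> group_words X \<and> inv_word w @ w \<approx> []"
proof (induction w)
  case Nil
  then show ?case by (auto simp: inv_word_def intro: pres_eq.refl)
next
  case (Cons a w)
  obtain x b where a: "a = (x, b)" by (cases a)
  have xw: "x \<in> X" "w \<in> group_words X" using Cons.prems a by auto
  then have iw: "inv_word w \<in> group_words X" "inv_word w @ w \<approx> []" using Cons.IH by auto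
  have "inv_word w @ [(x, \<not> b), (x, \<not> \<not> b)] @ w \<approx> inv_word w @ w"
    using iw xw by (intro pres_eq.cancel)
  then have "inv_word (a # w) @ a # w \<approx> inv_word w @ w"
    by (simp add: inv_word_def a)
  then show ?case
    using iw xw by (auto simp: inv_word_def a intro: pres_eq.trans)
qed

lemma group_P: "group P"
proof (rule groupI)
  fix x assume "x \<in> carrier P"
  then obtain w where w: "x = word_class w" "w \<in> group_words X" by (auto simp: carrier_P)
  show "\<one>\<^bsub>P\<^esub> \<otimes>\<^bsub>P\<^esub> x = x" using w by (simp add: one_P mult_P)
  have "word_class (inv_word w) \<otimes>\<^bsub>P\<^esub> x = \<one>\<^bsub>P\<^esub>"
    using w inv_word[OF w(2)] by (simp add: one_P mult_P word_class_eq_iff)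
  then show "\<exists>y\<in>carrier P. y \<otimes>\<^bsub>P\<^esub> x = \<one>\<^bsub>P\<^esub>"
    by (rule bexI) (use inv_word[OF w(2)] in simp)
  fix y z assume "y \<in> carrier P" "z \<in> carrier P"
  then obtain u v where "y = word_class u" "u \<in> group_words X" "z = word_class v" "v \<in> group_words X"
    by (auto simp: carrier_P)
  with w show "x \<otimes>\<^bsub>P\<^esub> y \<in> carrier P" "x \<otimes>\<^bsub>P\<^esub> y \<otimes>\<^bsub>P\<^esub> z = x \<otimes>\<^bsub>P\<^esub> (y \<otimes>\<^bsub>P\<^esub> z)"
    by (simp_all add: mult_P)
qed (simp add: one_P)

lemma inv_letter:
  assumes "x \<in> X"
  shows "word_class [(x, False)] = inv\<^bsub>P\<^esub> word_class [(x, True)]"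
proof -
  have "word_class [(x, False)] \<otimes>\<^bsub>P\<^esub> word_class [(x, True)] = \<one>\<^bsub>P\<^esub>"
    using assms pres_eq.cancel[of "[]" X "[]" x R False] by (simp add: one_P mult_P word_class_eq_iff)
  from group.inv_equality[OF group_P this] assms show ?thesis by simp
qed

end

section \<open>Pilings\<close>

text \<open>
  A piling has a stack for every vertex. The entry \<open>Some h\<close> is a syllable of that vertex, the entry \<open>None\<close>
  a marker for a syllable of another, nonadjacent vertex. A syllable is on top of its stack exactly if
  only syllables of adjacent vertices have been pushed after it, so the tops of the stacks show which
  syllables can be moved to the end. Syllables of adjacent vertices use disjoint stacks apart from
  markers, which are indistinguishable; this makes their pushes commute.
\<close>

locale pilings =
  fixes V :: "'v set" and adj :: "'v \<Rightarrow> 'v \<Rightarrow> bool" and H :: "'v \<Rightarrow> ('h, 'n) monoid_scheme"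
  assumes adj_sym: "adj u v \<Longrightarrow> adj v u" and adj_irrefl: "\<not> adj v v"
    and H: "v \<in> V \<Longrightarrow> group (H v)"
begin

definition push :: "'v \<Rightarrow> 'h \<Rightarrow> ('v \<Rightarrow> 'h option list) \<Rightarrow> 'v \<Rightarrow> 'h option list" where
  "push v h \<pi> = (\<lambda>u. if adj u v then \<pi> u else (if u = v then Some h else None) # \<pi> u)"

definition pop :: "'v \<Rightarrow> ('v \<Rightarrow> 'h option list) \<Rightarrow> 'v \<Rightarrow> 'h option list" where
  "pop v \<pi> = (\<lambda>u. if adj u v then \<pi> u else tl (\<pi> u))"

definition push_reduced :: "'v \<Rightarrow> 'h \<Rightarrow> ('v \<Rightarrow> 'h option list) \<Rightarrow> 'v \<Rightarrow> 'h option list" where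
  "push_reduced v h \<pi> = (if h = \<one>\<^bsub>H v\<^esub> then \<pi> else push v h \<pi>)"

definition exposed :: "('v \<Rightarrow> 'h option list) \<Rightarrow> 'v set" where
  "exposed \<pi> = {v. \<exists>h s. \<pi> v = Some h # s}"

text \<open>
  Multiplication on the right by \<open>g\<close>: if the vertex is exposed, then \<open>g\<close> is merged with the syllable on
  top, and the result is dropped if it is trivial.
\<close>

definition act :: "'v \<Rightarrow> 'h \<Rightarrow> ('v \<Rightarrow> 'h option list) \<Rightarrow> 'v \<Rightarrow> 'h option list" where
  "act v g \<pi> = (case \<pi> v of Some h # _ \<Rightarrow> push_reduced v (h \<otimes>\<^bsub>H v\<^esub> g) (pop v \<pi>)
                          | _ \<Rightarrow> push_reduced v g \<pi>)"

text \<open>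
  Only those pilings are considered that arise from the empty one by pushing nontrivial syllables at
  unexposed vertices, that is, from reduced sequences. Popping then undoes a push.
\<close>

inductive_set Pilings :: "('v \<Rightarrow> 'h option list) set" where
  empty: "(\<lambda>_. []) \<in> Pilings"
| push: "\<pi> \<in> Pilings \<Longrightarrow> v \<in> V \<Longrightarrow> h \<in> carrier (H v) \<Longrightarrow> h \<noteq> \<one>\<^bsub>H v\<^esub> \<Longrightarrow> v \<notin> exposed \<pi> \<Longrightarrow> push v h \<pi> \<in> Pilings"

lemma exposed_push: "exposed (push v h \<pi>) = insert v {u \<in> exposed \<pi>. adj u v}"
  using adj_irrefl by (auto simp: exposed_def push_def)

lemma exposed_empty: "exposed (\<lambda>_. []) = {}"
  by (simp add: exposed_def)

lemma pop_push: "pop v (push v h \<pi>) = \<pi>"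
  by (auto simp: pop_def push_def)

lemma push_commute: "adj v w \<Longrightarrow> push v g (push w h \<pi>) = push w h (push v g \<pi>)"
  using adj_sym adj_irrefl by (auto simp: push_def fun_eq_iff)

lemma push_reduced_commute:
  "adj v w \<Longrightarrow> push_reduced v g (push_reduced w h \<pi>) = push_reduced w h (push_reduced v g \<pi>)"
  using push_commute[of v w g h \<pi>] by (simp add: push_reduced_def)

lemma exposed_push_reduced_adj: "adj v w \<Longrightarrow> v \<in> exposed (push_reduced w h \<pi>) \<longleftrightarrow> v \<in> exposed \<pi>"
  using adj_irrefl by (auto simp: push_reduced_def exposed_push)

lemma push_reduced_Pilings:
  "\<pi> \<in> Pilings \<Longrightarrow> v \<in> V \<Longrightarrow> h \<in> carrier (H v) \<Longrightarrow> v \<notin> exposed \<pi> \<Longrightarrow> push_reduced v h \<pi> \<in> Pilings"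
  by (simp add: push_reduced_def Pilings.push)

text \<open>
  With trivial syllables omitted by \<open>push_reduced\<close>, the action is multiplication on the syllable of
  \<open>v\<close>. Since every piling has the form \<open>push_reduced v h \<pi>\<close> with \<open>v\<close> not exposed (\<open>decomp\<close>), the laws of an
  action follow from those of the vertex group.
\<close>

lemma act_push_reduced:
  assumes "v \<in> V" "g \<in> carrier (H v)" "h \<in> carrier (H v)" "v \<notin> exposed \<pi>"
  shows "act v g (push_reduced v h \<pi>) = push_reduced v (h \<otimes>\<^bsub>H v\<^esub> g) \<pi>"
proof (cases "h = \<one>\<^bsub>H v\<^esub>")
  case True
  interpret group "H v" by (rule H[OF assms(1)])
  show ?thesis
    using True assms by (auto simp: act_def push_reduced_def exposed_def split: list.splits option.splits)
next
  case False
  then have "push_reduced v h \<pi> v = Some h # \<pi> v" "push_reduced v h \<pi> = push v h \<pi>"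
    using adj_irrefl by (auto simp: push_reduced_def push_def)
  then show ?thesis by (simp add: act_def pop_push)
qed

text \<open>
  Only syllables of vertices adjacent to \<open>v\<close> have been pushed after the one on top of the stack of \<open>v\<close>,
  and pushes at adjacent vertices commute, so that syllable can be pushed last.
\<close>

lemma exposed_decomp:
  assumes "\<pi> \<in> Pilings" "v \<in> exposed \<pi>"
  shows "\<exists>h\<in>carrier (H v). \<exists>\<pi>1\<in>Pilings. h \<noteq> \<one>\<^bsub>H v\<^esub> \<and> v \<notin> exposed \<pi>1 \<and> \<pi> = push v h \<pi>1"
  using assms
proof (induction rule: Pilings.induct)
  case empty
  then show ?case by (simp add: exposed_empty)
next
  case (push \<pi> w k)
  show ?case
  proof (cases "w = v")
    case True
    with push show ?thesis by blast
  next
    case False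
    then have vw: "v \<in> exposed \<pi>" "adj v w" using push.prems by (auto simp: exposed_push)
    then obtain h \<pi>1 where *: "h \<in> carrier (H v)" "\<pi>1 \<in> Pilings" "h \<noteq> \<one>\<^bsub>H v\<^esub>" "v \<notin> exposed \<pi>1" "\<pi> = push v h \<pi>1"
      using push.IH by blast
    have "w \<notin> exposed \<pi>1" using push.hyps(5) vw adj_sym unfolding * exposed_push by blast
    with push.hyps * have "push w k \<pi>1 \<in> Pilings" by (blast intro: Pilings.push)
    moreover have "v \<notin> exposed (push w k \<pi>1)" using * False by (auto simp: exposed_push)
    moreover have "push w k \<pi> = push v h (push w k \<pi>1)" using * push_commute[OF vw(2), of h k \<pi>1] by simp
    ultimately show ?thesis using * by blast
  qed
qed

lemma decomp:
  assumes "\<pi> \<in> Pilings" "v \<in> V"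
  obtains h \<pi>1 where "h \<in> carrier (H v)" "\<pi>1 \<in> Pilings" "v \<notin> exposed \<pi>1" "\<pi> = push_reduced v h \<pi>1"
proof (cases "v \<in> exposed \<pi>")
  case True
  from exposed_decomp[OF assms(1) True] that show ?thesis by (auto simp: push_reduced_def)
next
  case False
  interpret group "H v" by (rule H[OF assms(2)])
  show ?thesis using that[of "\<one>\<^bsub>H v\<^esub>" \<pi>] False assms(1) by (simp add: push_reduced_def)
qed

lemma act_Pilings:
  assumes "\<pi> \<in> Pilings" "v \<in> V" "g \<in> carrier (H v)"
  shows "act v g \<pi> \<in> Pilings"
proof -
  interpret group "H v" by (rule H[OF assms(2)])
  obtain h \<pi>1 where "h \<in> carrier (H v)" "\<pi>1 \<in> Pilings" "v \<notin> exposed \<pi>1" "\<pi> = push_reduced v h \<pi>1"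
    using decomp[OF assms(1,2)] .
  then show ?thesis using assms by (simp add: act_push_reduced push_reduced_Pilings)
qed

lemma act_one:
  assumes "\<pi> \<in> Pilings" "v \<in> V"
  shows "act v \<one>\<^bsub>H v\<^esub> \<pi> = \<pi>"
proof -
  interpret group "H v" by (rule H[OF assms(2)])
  obtain h \<pi>1 where "h \<in> carrier (H v)" "\<pi>1 \<in> Pilings" "v \<notin> exposed \<pi>1" "\<pi> = push_reduced v h \<pi>1"
    using decomp[OF assms(1,2)] .
  then show ?thesis using assms by (simp add: act_push_reduced)
qed

lemma act_mult:
  assumes "\<pi> \<in> Pilings" "v \<in> V" "g \<in> carrier (H v)" "k \<in> carrier (H v)"
  shows "act v k (act v g \<pi>) = act v (g \<otimes>\<^bsub>H v\<^esub> k) \<pi>"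
proof -
  interpret group "H v" by (rule H[OF assms(2)])
  obtain h \<pi>1 where "h \<in> carrier (H v)" "\<pi>1 \<in> Pilings" "v \<notin> exposed \<pi>1" "\<pi> = push_reduced v h \<pi>1"
    using decomp[OF assms(1,2)] .
  then show ?thesis using assms by (simp add: act_push_reduced m_assoc)
qed

lemma act_commute:
  assumes "\<pi> \<in> Pilings" "v \<in> V" "w \<in> V" "adj v w" "g \<in> carrier (H v)" "k \<in> carrier (H w)"
  shows "act w k (act v g \<pi>) = act v g (act w k \<pi>)"
proof -
  interpret v: group "H v" by (rule H[OF assms(2)])
  interpret w: group "H w" by (rule H[OF assms(3)])
  note wv = adj_sym[OF assms(4)]
  obtain h \<pi>1 where 1: "h \<in> carrier (H v)" "\<pi>1 \<in> Pilings" "v \<notin> exposed \<pi>1" "\<pi> = push_reduced v h \<pi>1"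
    using decomp[OF assms(1,2)] .
  obtain j \<pi>2 where 2: "j \<in> carrier (H w)" "\<pi>2 \<in> Pilings" "w \<notin> exposed \<pi>2" "\<pi>1 = push_reduced w j \<pi>2"
    using decomp[OF 1(2) assms(3)] .
  have v2: "v \<notin> exposed \<pi>2" using 1(3) exposed_push_reduced_adj[OF assms(4)] unfolding 2 by blast
  have free: "v \<notin> exposed (push_reduced w x \<pi>2)" "w \<notin> exposed (push_reduced v y \<pi>2)" for x y
    using v2 2(3) exposed_push_reduced_adj[OF assms(4)] exposed_push_reduced_adj[OF wv] by blast+
  note comm = push_reduced_commute[OF assms(4)]
  have A: "act v g (push_reduced v x (push_reduced w y \<pi>2)) = push_reduced v (x \<otimes>\<^bsub>H v\<^esub> g) (push_reduced w y \<pi>2)"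
    if "x \<in> carrier (H v)" for x y
    by (rule act_push_reduced[OF assms(2,5) that free(1)])
  have B: "act w k (push_reduced v x (push_reduced w y \<pi>2)) = push_reduced v x (push_reduced w (y \<otimes>\<^bsub>H w\<^esub> k) \<pi>2)"
    if "y \<in> carrier (H w)" for x y
    unfolding comm by (rule act_push_reduced[OF assms(3,6) that free(2)])
  show ?thesis
    unfolding 1(4) 2(4) using 1(1) 2(1) assms(5) by (simp add: A B)
qed

lemma act_free:
  "v \<notin> exposed \<pi> \<Longrightarrow> g \<noteq> \<one>\<^bsub>H v\<^esub> \<Longrightarrow> act v g \<pi> = push v g \<pi>"
  by (auto simp: act_def push_reduced_def exposed_def split: list.splits option.splits)

end

section \<open>Graph products\<close>

lemma (in group) commute_inv:
  assumes "x \<in> carrier G" "y \<in> carrier G" "x \<otimes> y = y \<otimes> x"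
  shows "inv x \<otimes> y = y \<otimes> inv x"
proof -
  have "inv x \<otimes> y = inv x \<otimes> (y \<otimes> x) \<otimes> inv x" using assms(1,2) by (simp add: m_assoc)
  also have "\<dots> = inv x \<otimes> (x \<otimes> y) \<otimes> inv x" by (simp only: assms(3))
  also have "\<dots> = y \<otimes> inv x" using assms(1,2) by (simp add: m_assoc [symmetric])
  finally show ?thesis .
qed

lemma (in group) commute_mult:
  assumes "x \<in> carrier G" "y \<in> carrier G" "z \<in> carrier G" "x \<otimes> y = y \<otimes> x" "x \<otimes> z = z \<otimes> x"
  shows "x \<otimes> (y \<otimes> z) = (y \<otimes> z) \<otimes> x"
proof -
  have "x \<otimes> (y \<otimes> z) = (y \<otimes> x) \<otimes> z" using assms(1-3) by (simp add: m_assoc [symmetric] assms(4))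
  also have "\<dots> = y \<otimes> (z \<otimes> x)" using assms(1-3) by (simp add: m_assoc assms(5))
  finally show ?thesis using assms(1-3) by (simp add: m_assoc)
qed

locale graph_of_presentations =
  fixes V :: "'v set" and E :: "'v set set" and X :: "'v \<Rightarrow> 'x set" and R :: "'v \<Rightarrow> 'x group_word set"
  assumes graph: "finite_simple_graph V E"
    and R: "v \<in> V \<Longrightarrow> R v \<subseteq> group_words (X v)"
begin

abbreviation factor :: "'v \<Rightarrow> 'x group_word set monoid" where "factor v \<equiv> presented_group (X v) (R v)"

abbreviation factor_class :: "'v \<Rightarrow> 'x group_word \<Rightarrow> 'x group_word set" where
  "factor_class v \<equiv> pres_class (X v) (R v)"

definition relators :: "('v \<times> 'x) group_word set" where
  "relators = (\<Union>v\<in>V. tag_word v ` R v) \<union>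
     {commutator_word (v, x) (w, y) | v w x y. v \<in> V \<and> w \<in> V \<and> {v, w} \<in> E \<and> x \<in> X v \<and> y \<in> X w}"

lemma tag_word_simps [simp]:
  "tag_word v [] = []" "tag_word v ((x, b) # w) = ((v, x), b) # tag_word v w"
  "tag_word v (u @ w) = tag_word v u @ tag_word v w"
  by (simp_all add: tag_word_def)

lemma tag_words: "v \<in> V \<Longrightarrow> w \<in> group_words (X v) \<Longrightarrow> tag_word v w \<in> group_words (Sigma V X)"
  by (induction w) auto

lemma relators_words: "relators \<subseteq> group_words (Sigma V X)"
proof
  fix r assume "r \<in> relators"
  then consider v r' where "v \<in> V" "r' \<in> R v" "r = tag_word v r'"
    | v w x y where "v \<in> V" "w \<in> V" "x \<in> X v" "y \<in> X w" "r = commutator_word (v, x) (w, y)"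
    unfolding relators_def by blast
  then show "r \<in> group_words (Sigma V X)"
  proof cases
    case (1 v r')
    then show ?thesis using tag_words[OF 1(1), of r'] R[OF 1(1)] by blast
  next
    case (2 v w x y)
    then show ?thesis by (simp add: commutator_word_def)
  qed
qed

sublocale prod: presentation "Sigma V X" relators
  by unfold_locales (rule relators_words)

abbreviation prod_mult (infixl "\<odot>" 70) where "x \<odot> y \<equiv> x \<otimes>\<^bsub>prod.P\<^esub> y"

lemma graph_product_eq: "graph_product V E X R = prod.P"
  by (simp add: graph_product_def relators_def)

lemma factor_presentation: "v \<in> V \<Longrightarrow> presentation (X v) (R v)"
  by unfold_locales (rule R)

lemmas factor_class_in = presentation.word_class_in[OF factor_presentation]
  and factor_mult = presentation.mult_P[OF factor_presentation]
  and factor_one = presentation.one_P[OF factor_presentation]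
  and factor_class_eq_iff = presentation.word_class_eq_iff[OF factor_presentation]
  and factor_carrier = presentation.carrier_P[OF factor_presentation]
  and factor_group = presentation.group_P[OF factor_presentation]

lemma finite_V: "finite V" and edge_irrefl: "{v} \<notin> E"
  using graph by (auto simp: finite_simple_graph_def)

definition adjacent :: "'v \<Rightarrow> 'v \<Rightarrow> bool" where
  "adjacent u v \<longleftrightarrow> {u, v} \<in> E"

sublocale pil: pilings V adjacent factor
  by (rule pilings.intro) (simp_all add: adjacent_def insert_commute edge_irrefl factor_group)

text \<open>
  The map from a vertex group to the graph product. The union is a way to define it on classes without
  choosing representatives: all its members are equal (\<open>embed_class\<close>).
\<close>

definition embed :: "'v \<Rightarrow> 'x group_word set \<Rightarrow> ('v \<times> 'x) group_word set" where
  "embed v A = (\<Union>w\<in>A. prod.word_class (tag_word v w))"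

lemma tag_eqv:
  assumes "v \<in> V"
  shows "pres_eq (X v) (R v) u w \<Longrightarrow> pres_eq (Sigma V X) relators (tag_word v u) (tag_word v w)"
proof (induction rule: pres_eq.induct)
  case (refl w)
  then show ?case using tag_words[OF assms] by (intro pres_eq.refl)
next
  case (sym u w)
  then show ?case by (blast intro: pres_eq.sym)
next
  case (trans u v w)
  then show ?case by (blast intro: pres_eq.trans)
next
  case (cancel u w x b)
  then show ?case
    using pres_eq.cancel[of "tag_word v u" "Sigma V X" "tag_word v w" "(v, x)" relators b] tag_words[OF assms] assms
    by simp
next
  case (relator u w r)
  then have "tag_word v r \<in> relators" using assms by (auto simp: relators_def)
  from pres_eq.relator[OF tag_words[OF assms relator(1)] tag_words[OF assms relator(2)] this] show ?case by simp
qed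

lemma embed_class:
  assumes "v \<in> V" "w \<in> group_words (X v)"
  shows "embed v (factor_class v w) = prod.word_class (tag_word v w)"
proof -
  have "prod.word_class (tag_word v u) = prod.word_class (tag_word v w)" if "u \<in> factor_class v w" for u
  proof -
    have "pres_eq (X v) (R v) w u" using that by (simp add: pres_class_def)
    from tag_eqv[OF assms(1) this] have "prod.word_class (tag_word v w) = prod.word_class (tag_word v u)"
      using prod.word_class_eq_iff[OF tag_words[OF assms]] by blast
    then show ?thesis by (rule HOL.sym)
  qed
  moreover have "w \<in> factor_class v w" using assms by (simp add: pres_class_def pres_eq.refl)
  ultimately show ?thesis unfolding embed_def by blast
qed

lemma embed_hom: "v \<in> V \<Longrightarrow> embed v \<in> hom (factor v) prod.P"
proof (rule homI)
  fix A B assume v: "v \<in> V" and "A \<in> carrier (factor v)" "B \<in> carrier (factor v)"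
  then obtain u w where *: "A = factor_class v u" "u \<in> group_words (X v)" "B = factor_class v w" "w \<in> group_words (X v)"
    by (auto simp: factor_carrier)
  note t = tag_words[OF v *(2)] tag_words[OF v *(4)]
  show "embed v A \<in> carrier prod.P"
    unfolding * embed_class[OF v *(2)] by (rule prod.word_class_in[OF t(1)])
  have "u @ w \<in> group_words (X v)" using * by simp
  then show "embed v (A \<otimes>\<^bsub>factor v\<^esub> B) = embed v A \<odot> embed v B"
    unfolding *(1,3) factor_mult[OF v *(2,4)] embed_class[OF v *(2)] embed_class[OF v *(4)] prod.mult_P[OF t]
    by (simp add: embed_class[OF v])
qed

lemma letters_commute:
  assumes "v \<in> V" "w \<in> V" "{v, w} \<in> E" "x \<in> X v" "y \<in> X w"
  shows "prod.word_class [((v, x), b)] \<odot> prod.word_class [((w, y), c)] =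
    prod.word_class [((w, y), c)] \<odot> prod.word_class [((v, x), b)]"
proof -
  interpret P: group prod.P by (rule prod.group_P)
  define A where "A = prod.word_class [((v, x), True)]"
  define B where "B = prod.word_class [((w, y), True)]"
  have AB: "A \<in> carrier prod.P" "B \<in> carrier prod.P"
    using assms by (auto simp: A_def B_def)
  have inv: "prod.word_class [((v, x), False)] = inv\<^bsub>prod.P\<^esub> A" "prod.word_class [((w, y), False)] = inv\<^bsub>prod.P\<^esub> B"
    unfolding A_def B_def using assms by (auto intro!: prod.inv_letter)
  have "commutator_word (v, x) (w, y) \<in> relators" using assms unfolding relators_def by blast
  then have "pres_eq (Sigma V X) relators ([] @ commutator_word (v, x) (w, y) @ []) ([] @ [])"
    by (intro pres_eq.relator) auto
  then have "prod.word_class (commutator_word (v, x) (w, y)) = \<one>\<^bsub>prod.P\<^esub>"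
    using assms by (simp add: prod.one_P prod.word_class_eq_iff commutator_word_def)
  moreover have "prod.word_class (commutator_word (v, x) (w, y)) = A \<odot> (B \<odot> (inv\<^bsub>prod.P\<^esub> A \<odot> inv\<^bsub>prod.P\<^esub> B))"
  proof -
    have "prod.word_class (commutator_word (v, x) (w, y)) = A \<odot> (B \<odot>
        (prod.word_class [((v, x), False)] \<odot> prod.word_class [((w, y), False)]))"
      unfolding A_def B_def using assms by (simp add: prod.mult_P commutator_word_def)
    then show ?thesis by (simp only: inv)
  qed
  moreover have "inv\<^bsub>prod.P\<^esub> A \<odot> inv\<^bsub>prod.P\<^esub> B = inv\<^bsub>prod.P\<^esub> (B \<odot> A)"
    using AB by (simp add: P.inv_mult_group)
  ultimately have "(A \<odot> B) \<odot> inv\<^bsub>prod.P\<^esub> (B \<odot> A) = \<one>\<^bsub>prod.P\<^esub>"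
    using AB by (simp add: P.m_assoc)
  then have AB_comm: "A \<odot> B = B \<odot> A"
    using AB P.inv_equality[of "A \<odot> B" "inv\<^bsub>prod.P\<^esub> (B \<odot> A)"] by simp
  note comm = AB_comm P.commute_inv[OF AB AB_comm] P.commute_inv[OF AB(2,1) AB_comm[symmetric]]
  have "inv\<^bsub>prod.P\<^esub> A \<odot> inv\<^bsub>prod.P\<^esub> B = inv\<^bsub>prod.P\<^esub> B \<odot> inv\<^bsub>prod.P\<^esub> A"
    using AB AB_comm P.inv_mult_group by metis
  with comm show ?thesis
    by (cases b; cases c) (simp_all add: inv A_def[symmetric] B_def[symmetric])
qed

text \<open>
  The relators give this for generators; induction over both words extends it to all elements.
\<close>

lemma embed_commute:
  assumes vw: "v \<in> V" "w \<in> V" "{v, w} \<in> E" and "A \<in> carrier (factor v)" "B \<in> carrier (factor w)"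
  shows "embed v A \<odot> embed w B = embed w B \<odot> embed v A"
proof -
  interpret P: group prod.P by (rule prod.group_P)
  let ?c = "prod.word_class"
  have one_letter: "u \<in> group_words (X w) \<Longrightarrow> ?c [((v, x), b)] \<odot> ?c (tag_word w u) = ?c (tag_word w u) \<odot> ?c [((v, x), b)]"
    if x: "x \<in> X v" for x b u
  proof (induction u)
    case Nil
    then show ?case using x vw by (simp add: prod.one_P[symmetric])
  next
    case (Cons a u)
    obtain y c where a: "a = (y, c)" by (cases a)
    have yu: "y \<in> X w" "u \<in> group_words (X w)" using Cons.prems by (auto simp: a)
    have words: "[((v, x), b)] \<in> group_words (Sigma V X)" "[((w, y), c)] \<in> group_words (Sigma V X)"
      "tag_word w u \<in> group_words (Sigma V X)"
      using x vw yu(1) tag_words[OF vw(2) yu(2)] by simp_all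
    note in_carrier = words[THEN prod.word_class_in]
    have "?c (tag_word w (a # u)) = ?c [((w, y), c)] \<odot> ?c (tag_word w u)"
      using prod.mult_P[OF words(2,3)] by (simp add: a)
    moreover have "?c [((v, x), b)] \<odot> ?c [((w, y), c)] = ?c [((w, y), c)] \<odot> ?c [((v, x), b)]"
      using yu(1) by (intro letters_commute vw x)
    ultimately show ?case
      using P.commute_mult[OF in_carrier _ Cons.IH[OF yu(2)]] by simp
  qed
  have words: "z \<in> group_words (X v) \<Longrightarrow> ?c (tag_word v z) \<odot> ?c (tag_word w u) = ?c (tag_word w u) \<odot> ?c (tag_word v z)"
    if u: "u \<in> group_words (X w)" for u z
  proof (induction z)
    case Nil
    then show ?case using tag_words[OF vw(2) u] by (simp add: prod.one_P[symmetric])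
  next
    case (Cons a z)
    obtain x b where a: "a = (x, b)" by (cases a)
    have xz: "x \<in> X v" "z \<in> group_words (X v)" using Cons.prems by (auto simp: a)
    have words: "[((v, x), b)] \<in> group_words (Sigma V X)" "tag_word v z \<in> group_words (Sigma V X)"
      "tag_word w u \<in> group_words (Sigma V X)"
      using vw xz(1) tag_words[OF vw(1) xz(2)] tag_words[OF vw(2) u] by simp_all
    note in_carrier = words[THEN prod.word_class_in]
    have "?c (tag_word v (a # z)) = ?c [((v, x), b)] \<odot> ?c (tag_word v z)"
      using prod.mult_P[OF words(1,2)] by (simp add: a)
    moreover have "?c [((v, x), b)] \<odot> ?c (tag_word w u) = ?c (tag_word w u) \<odot> ?c [((v, x), b)]"
      using xz(1) by (intro one_letter u)
    ultimately show ?case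
      using P.commute_mult[OF in_carrier(3,1,2) _ Cons.IH[OF xz(2), symmetric]] by simp
  qed
  from assms obtain z u where "A = factor_class v z" "z \<in> group_words (X v)" "B = factor_class w u" "u \<in> group_words (X w)"
    by (auto simp: factor_carrier)
  with words vw show ?thesis by (simp add: embed_class)
qed

definition letter_act where
  "letter_act l = (case l of ((v, x), b) \<Rightarrow> pil.act v (factor_class v [(x, b)]))"

text \<open>
  The letters act from left to right, so that words act on the right, in agreement with \<open>pil.act\<close>.
\<close>

definition word_act where
  "word_act w \<pi> = foldl (\<lambda>\<pi> l. letter_act l \<pi>) \<pi> w"

lemma word_act_simps [simp]:
  "word_act [] \<pi> = \<pi>" "word_act (l # w) \<pi> = word_act w (letter_act l \<pi>)"
  "word_act (u @ w) \<pi> = word_act w (word_act u \<pi>)"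
  by (simp_all add: word_act_def)

lemma word_act_Pilings:
  "w \<in> group_words (Sigma V X) \<Longrightarrow> \<pi> \<in> pil.Pilings \<Longrightarrow> word_act w \<pi> \<in> pil.Pilings"
proof (induction w arbitrary: \<pi>)
  case (Cons l w)
  obtain v x b where l: "l = ((v, x), b)" by (metis surj_pair)
  have "v \<in> V" "x \<in> X v" "w \<in> group_words (Sigma V X)" using Cons.prems by (auto simp: l)
  then have "letter_act l \<pi> \<in> pil.Pilings"
    using Cons.prems by (auto simp: letter_act_def l intro!: pil.act_Pilings factor_class_in)
  with Cons.IH \<open>w \<in> _\<close> show ?case by simp
qed simp

lemma word_act_tag_word:
  assumes "v \<in> V"
  shows "w \<in> group_words (X v) \<Longrightarrow> \<pi> \<in> pil.Pilings \<Longrightarrow> word_act (tag_word v w) \<pi> = pil.act v (factor_class v w) \<pi>"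
proof (induction w arbitrary: \<pi>)
  case Nil
  then show ?case using pil.act_one[OF Nil(2) assms] by (simp add: factor_one[OF assms])
next
  case (Cons a w)
  obtain x b where a: "a = (x, b)" by (cases a)
  have *: "[(x, b)] \<in> group_words (X v)" "w \<in> group_words (X v)" using Cons.prems by (auto simp: a)
  note cl = factor_class_in[OF assms *(1)] factor_class_in[OF assms *(2)]
  have "word_act (tag_word v (a # w)) \<pi> = pil.act v (factor_class v w) (pil.act v (factor_class v [(x, b)]) \<pi>)"
    using Cons.IH[OF *(2) pil.act_Pilings[OF Cons.prems(2) assms cl(1)]] by (simp add: a letter_act_def)
  also have "\<dots> = pil.act v (factor_class v (a # w)) \<pi>"
    using pil.act_mult[OF Cons.prems(2) assms cl] factor_mult[OF assms *] by (simp add: a)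
  finally show ?case .
qed

lemma word_act_trivial:
  assumes "v \<in> V" "w \<in> group_words (X v)" "pres_eq (X v) (R v) w []" "\<pi> \<in> pil.Pilings"
  shows "word_act (tag_word v w) \<pi> = \<pi>"
proof -
  have "factor_class v w = \<one>\<^bsub>factor v\<^esub>"
    using assms by (simp add: factor_one factor_class_eq_iff)
  then show ?thesis using word_act_tag_word[OF assms(1,2,4)] pil.act_one[OF assms(4,1)] by simp
qed

text \<open>
  By this lemma the graph product acts on pilings. The relators of the vertex groups act trivially because
  the vertex groups act, and the commutators because the actions of adjacent vertices commute.
\<close>

lemma word_act_eqv:
  "pres_eq (Sigma V X) relators u w \<Longrightarrow> \<pi> \<in> pil.Pilings \<Longrightarrow> word_act u \<pi> = word_act w \<pi>"
proof (induction arbitrary: \<pi> rule: pres_eq.induct)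
  case (cancel u w l b)
  obtain v x where l: "l = (v, x)" by (cases l)
  have v: "v \<in> V" "x \<in> X v" using cancel by (auto simp: l)
  have "pres_eq (X v) (R v) ([] @ [(x, b), (x, \<not> b)] @ []) ([] @ [])"
    using v by (intro pres_eq.cancel) auto
  then have "word_act (tag_word v [(x, b), (x, \<not> b)]) (word_act u \<pi>) = word_act u \<pi>"
    using v cancel by (intro word_act_trivial word_act_Pilings) auto
  then show ?case by (simp add: l)
next
  case (relator u w r)
  have u: "word_act u \<pi> \<in> pil.Pilings" using relator by (intro word_act_Pilings)
  from relator(3) consider v r' where "v \<in> V" "r' \<in> R v" "r = tag_word v r'"
    | v v' x y where "v \<in> V" "v' \<in> V" "{v, v'} \<in> E" "x \<in> X v" "y \<in> X v'" "r = commutator_word (v, x) (v', y)"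
    unfolding relators_def by blast
  then have "word_act r (word_act u \<pi>) = word_act u \<pi>"
  proof cases
    case (1 v r')
    then have "pres_eq (X v) (R v) ([] @ r' @ []) ([] @ [])" by (intro pres_eq.relator) auto
    then show ?thesis using word_act_trivial[OF 1(1) _ _ u] R[OF 1(1)] 1 by auto
  next
    case (2 v v' x y)
    let ?g = "\<lambda>b. factor_class v [(x, b)]" and ?h = "\<lambda>b. factor_class v' [(y, b)]"
    have gh: "?g b \<in> carrier (factor v)" "?h b \<in> carrier (factor v')" for b
      using 2 by (auto intro!: factor_class_in)
    have cancel: "pil.act v (?g False) (pil.act v (?g True) \<sigma>) = \<sigma>" if "\<sigma> \<in> pil.Pilings" for \<sigma>
    proof -
      have "pres_eq (X v) (R v) ([] @ [(x, True), (x, \<not> True)] @ []) ([] @ [])"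
        using 2 by (intro pres_eq.cancel) auto
      from word_act_trivial[OF 2(1) _ _ that, of "[(x, True), (x, \<not> True)]"] this 2(4) show ?thesis
        by (simp add: letter_act_def)
    qed
    have cancel': "pil.act v' (?h False) (pil.act v' (?h True) \<sigma>) = \<sigma>" if "\<sigma> \<in> pil.Pilings" for \<sigma>
    proof -
      have "pres_eq (X v') (R v') ([] @ [(y, True), (y, \<not> True)] @ []) ([] @ [])"
        using 2 by (intro pres_eq.cancel) auto
      from word_act_trivial[OF 2(2) _ _ that, of "[(y, True), (y, \<not> True)]"] this 2(5) show ?thesis
        by (simp add: letter_act_def)
    qed
    let ?\<sigma> = "word_act u \<pi>"
    have "word_act r ?\<sigma> = pil.act v' (?h False) (pil.act v (?g False) (pil.act v' (?h True) (pil.act v (?g True) ?\<sigma>)))"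
      by (simp add: 2 commutator_word_def letter_act_def)
    also have "pil.act v' (?h True) (pil.act v (?g True) ?\<sigma>) = pil.act v (?g True) (pil.act v' (?h True) ?\<sigma>)"
      using 2 u gh by (intro pil.act_commute) (simp_all add: adjacent_def)
    also have "pil.act v (?g False) \<dots> = pil.act v' (?h True) ?\<sigma>"
      using 2 u gh by (intro cancel pil.act_Pilings)
    also have "pil.act v' (?h False) \<dots> = ?\<sigma>" by (rule cancel'[OF u])
    finally show ?thesis .
  qed
  then show ?case by simp
qed simp_all

text \<open>
  The automaton of reduced vertex sequences. A state is a set of exposed vertices; reading \<open>v\<close> covers
  all vertices that are not adjacent to \<open>v\<close>.
\<close>

definition reduced_moves :: "('v set \<times> 'v \<times> 'v set) set" where
  "reduced_moves = {(S, v, S'). S \<subseteq> V \<and> v \<in> V - S \<and> S' = insert v {u \<in> S. adjacent u v}}"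

lemma finite_reduced_moves: "finite reduced_moves"
proof (rule finite_subset)
  show "reduced_moves \<subseteq> Pow V \<times> V \<times> Pow V" by (auto simp: reduced_moves_def)
qed (use finite_V in simp)

text \<open>
  Along a reduced sequence each syllable meets an unexposed vertex, so that the action just pushes it.
  Hence the state of the automaton is the set of exposed vertices of the piling.
\<close>

lemma reduced_word_exposed:
  assumes K: "\<And>v x. v \<in> V \<Longrightarrow> x \<in> K v \<Longrightarrow> x \<in> lists (carrier prod.P) \<and>
      (\<exists>A\<in>carrier (factor v). A \<noteq> \<one>\<^bsub>factor v\<^esub> \<and> word_val prod.P x = embed v A)"
  shows "path_lang reduced_moves K {} w S \<Longrightarrow> w \<in> lists (carrier prod.P) \<and>
    (\<exists>u\<in>group_words (Sigma V X). word_val prod.P w = prod.word_class u \<and> pil.exposed (word_act u (\<lambda>_. [])) = S)"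
proof (induction rule: path_lang.induct)
  case Nil
  show ?case by (auto intro!: bexI[of _ "[]"] simp: prod.one_P pil.exposed_empty)
next
  case (Snoc w S v S' x)
  from Snoc(2) have v: "v \<in> V" "v \<notin> S" "S' = insert v {u \<in> S. adjacent u v}"
    by (auto simp: reduced_moves_def)
  from Snoc.IH obtain u where w: "w \<in> lists (carrier prod.P)" and u: "u \<in> group_words (Sigma V X)"
    "word_val prod.P w = prod.word_class u" "pil.exposed (word_act u (\<lambda>_. [])) = S"
    by blast
  from K[OF v(1) Snoc(3)] obtain A where x: "x \<in> lists (carrier prod.P)" and A: "A \<in> carrier (factor v)"
    "A \<noteq> \<one>\<^bsub>factor v\<^esub>" "word_val prod.P x = embed v A"
    by blast
  from A(1) obtain a where a: "A = factor_class v a" "a \<in> group_words (X v)"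
    by (auto simp: factor_carrier[OF v(1)])
  note ta = tag_words[OF v(1) a(2)]
  have "word_val prod.P (w @ x) = prod.word_class (u @ tag_word v a)"
    using group.word_val_append[OF prod.group_P w x] prod.mult_P[OF u(1) ta] embed_class[OF v(1) a(2)]
    by (simp add: u A a)
  moreover have "word_act (u @ tag_word v a) (\<lambda>_. []) = pil.push v A (word_act u (\<lambda>_. []))"
    using word_act_tag_word[OF v(1) a(2) word_act_Pilings[OF u(1) pil.Pilings.empty]]
      pil.act_free[of v "word_act u (\<lambda>_. [])" A] v(2) u(3) A(2) by (simp add: a)
  then have "pil.exposed (word_act (u @ tag_word v a) (\<lambda>_. [])) = S'"
    using u(3) v(3) by (simp add: pil.exposed_push)
  moreover have "u @ tag_word v a \<in> group_words (Sigma V X)" using u(1) ta by simp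
  moreover have "w @ x \<in> lists (carrier prod.P)" using w x by simp
  ultimately show ?case by blast
qed

lemma reduced_word_nontrivial:
  assumes "\<And>v x. v \<in> V \<Longrightarrow> x \<in> K v \<Longrightarrow> x \<in> lists (carrier prod.P) \<and>
      (\<exists>A\<in>carrier (factor v). A \<noteq> \<one>\<^bsub>factor v\<^esub> \<and> word_val prod.P x = embed v A)"
    and "path_lang reduced_moves K {} w S" "S \<noteq> {}"
  shows "word_val prod.P w \<noteq> \<one>\<^bsub>prod.P\<^esub>"
proof
  assume trivial: "word_val prod.P w = \<one>\<^bsub>prod.P\<^esub>"
  from reduced_word_exposed[OF assms(1,2)] obtain u where u: "u \<in> group_words (Sigma V X)"
    "word_val prod.P w = prod.word_class u" "pil.exposed (word_act u (\<lambda>_. [])) = S"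
    by blast
  with trivial have "pres_eq (Sigma V X) relators u []"
    by (simp add: prod.one_P prod.word_class_eq_iff)
  from word_act_eqv[OF this pil.Pilings.empty] have "S = {}" using u(3) by (simp add: pil.exposed_empty)
  with assms(3) show False by simp
qed

definition syllables :: "('v \<times> 'x group_word set) set" where
  "syllables = (SIGMA v:V. carrier (factor v) - {\<one>\<^bsub>factor v\<^esub>})"

definition syllable_val :: "('v \<times> 'x group_word set) list \<Rightarrow> ('v \<times> 'x) group_word set" where
  "syllable_val s = word_val prod.P (map (\<lambda>(v, A). embed v A) s)"

text \<open>
  Reduced sequences of group elements, together with the state that the automaton reaches. The proof that
  every element has a reduced expression is independent of the chosen words, so it is carried out
  for these.
\<close>

inductive reduced :: "('v \<times> 'x group_word set) list \<Rightarrow> 'v set \<Rightarrow> bool" where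
  Nil: "reduced [] {}"
| Snoc: "reduced s S \<Longrightarrow> (S, v, S') \<in> reduced_moves \<Longrightarrow> (v, A) \<in> syllables \<Longrightarrow> reduced (s @ [(v, A)]) S'"

lemma syllable_closed: "(v, A) \<in> syllables \<Longrightarrow> embed v A \<in> carrier prod.P"
  using embed_hom hom_in_carrier by (fastforce simp: syllables_def)

lemma syllables_closed: "s \<in> lists syllables \<Longrightarrow> map (\<lambda>(v, A). embed v A) s \<in> lists (carrier prod.P)"
  using syllable_closed by (induction s) auto

lemma syllable_val_closed: "s \<in> lists syllables \<Longrightarrow> syllable_val s \<in> carrier prod.P"
  unfolding syllable_val_def by (rule group.word_val_closed[OF prod.group_P syllables_closed])

lemma syllable_val_simps:
  "syllable_val [] = \<one>\<^bsub>prod.P\<^esub>"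
  "syllable_val ((v, A) # s) = embed v A \<odot> syllable_val s"
  "s \<in> lists syllables \<Longrightarrow> t \<in> lists syllables \<Longrightarrow> syllable_val (s @ t) = syllable_val s \<odot> syllable_val t"
  unfolding syllable_val_def
  using group.word_val_append[OF prod.group_P syllables_closed syllables_closed] by simp_all

lemma reduced_syllables: "reduced s S \<Longrightarrow> s \<in> lists syllables \<and> S \<subseteq> V"
  by (induction rule: reduced.induct) (auto simp: reduced_moves_def)

text \<open>
  The meaning of the states: all syllables after the last one of an exposed vertex \<open>v\<close> belong to vertices
  adjacent to \<open>v\<close>.
\<close>

lemma exposed_syllable:
  "reduced s S \<Longrightarrow> v \<in> S \<Longrightarrow> \<exists>s1 B s2. s = s1 @ (v, B) # s2 \<and> (\<forall>(w, C)\<in>set s2. adjacent v w)"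
proof (induction rule: reduced.induct)
  case (Snoc s S w S' A)
  show ?case
  proof (cases "v = w")
    case True
    then show ?thesis by (intro exI[of _ s] exI[of _ A] exI[of _ "[]"]) simp
  next
    case False
    then have "v \<in> S" "adjacent v w" using Snoc by (auto simp: reduced_moves_def)
    with Snoc.IH obtain s1 B s2 where "s = s1 @ (v, B) # s2" "\<forall>(w, C)\<in>set s2. adjacent v w" by blast
    with \<open>adjacent v w\<close> show ?thesis by (intro exI[of _ s1] exI[of _ B] exI[of _ "s2 @ [(w, A)]"]) auto
  qed
qed simp

lemma syllable_commute:
  assumes "v \<in> V" "A \<in> carrier (factor v)"
  shows "s \<in> lists syllables \<Longrightarrow> \<forall>(w, C)\<in>set s. adjacent v w \<Longrightarrow>
    syllable_val s \<odot> embed v A = embed v A \<odot> syllable_val s"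
proof (induction s)
  case Nil
  interpret P: group prod.P by (rule prod.group_P)
  show ?case using hom_in_carrier[OF embed_hom[OF assms(1)] assms(2)] by (simp add: syllable_val_simps)
next
  case (Cons a s)
  interpret P: group prod.P by (rule prod.group_P)
  obtain w C where a: "a = (w, C)" by (cases a)
  have w: "w \<in> V" "adjacent v w" "C \<in> carrier (factor w)" "(w, C) \<in> syllables" "s \<in> lists syllables"
    using Cons.prems by (auto simp: a syllables_def)
  have in_carrier: "embed v A \<in> carrier prod.P" "embed w C \<in> carrier prod.P" "syllable_val s \<in> carrier prod.P"
    using hom_in_carrier[OF embed_hom[OF assms(1)] assms(2)] syllable_closed[OF w(4)] syllable_val_closed[OF w(5)] by auto
  have IH: "syllable_val s \<odot> embed v A = embed v A \<odot> syllable_val s"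
    using Cons.IH w(5) Cons.prems by auto
  have "syllable_val (a # s) \<odot> embed v A = embed w C \<odot> (syllable_val s \<odot> embed v A)"
    using in_carrier by (simp add: a syllable_val_simps P.m_assoc)
  also have "\<dots> = (embed w C \<odot> embed v A) \<odot> syllable_val s"
    using in_carrier by (simp add: IH P.m_assoc)
  also have "embed w C \<odot> embed v A = embed v A \<odot> embed w C"
    by (rule embed_commute[OF assms(1) w(1) w(2)[unfolded adjacent_def] assms(2) w(3), symmetric])
  finally show ?case using in_carrier by (simp add: a syllable_val_simps P.m_assoc)
qed

text \<open>
  Reduce all syllables but the last one. If the vertex of the last syllable is exposed then, the two
  syllables of this vertex can be merged, and the sequence becomes shorter, which
  makes the induction on the length work.
\<close>

lemma reduced_form:
  "s \<in> lists syllables \<Longrightarrow> \<exists>s' S. reduced s' S \<and> syllable_val s' = syllable_val s \<and> length s' \<le> length s"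
proof (induction s rule: length_induct)
  case (1 s)
  interpret P: group prod.P by (rule prod.group_P)
  show ?case
  proof (cases s rule: rev_cases)
    case Nil
    then show ?thesis using reduced.Nil by auto
  next
    case (snoc s0 a)
    obtain v A where a: "a = (v, A)" by (cases a)
    have s0: "s0 \<in> lists syllables" and vA: "(v, A) \<in> syllables" using 1(2) by (auto simp: snoc a)
    have v: "v \<in> V" "A \<in> carrier (factor v)" using vA by (auto simp: syllables_def)
    from 1(1) s0 obtain s0' S where s0': "reduced s0' S" "syllable_val s0' = syllable_val s0" "length s0' \<le> length s0"
      by (auto simp: snoc)
    have s0'_syl: "s0' \<in> lists syllables" and S: "S \<subseteq> V" using reduced_syllables[OF s0'(1)] by auto
    have val: "syllable_val s = syllable_val s0' \<odot> embed v A"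
      using s0 vA syllable_closed[OF vA] by (simp add: snoc a syllable_val_simps s0')
    show ?thesis
    proof (cases "v \<in> S")
      case False
      then have "(S, v, insert v {u \<in> S. adjacent u v}) \<in> reduced_moves" using S v by (auto simp: reduced_moves_def)
      then have "reduced (s0' @ [(v, A)]) (insert v {u \<in> S. adjacent u v})"
        by (rule reduced.Snoc[OF s0'(1) _ vA])
      moreover have "syllable_val (s0' @ [(v, A)]) = syllable_val s"
        using s0'_syl vA syllable_closed[OF vA] by (simp add: syllable_val_simps val)
      moreover have "length (s0' @ [(v, A)]) \<le> length s" using s0'(3) by (simp add: snoc)
      ultimately show ?thesis by blast
    next
      case True
      from exposed_syllable[OF s0'(1) this] obtain s1 B s2 where
        s12: "s0' = s1 @ (v, B) # s2" "\<forall>(w, C)\<in>set s2. adjacent v w" by blast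
      have s1: "s1 \<in> lists syllables" and s2: "s2 \<in> lists syllables" and vB: "(v, B) \<in> syllables"
        using s0'_syl by (auto simp: s12)
      then have B: "B \<in> carrier (factor v)" by (simp add: syllables_def)
      note in_carrier = syllable_val_closed[OF s1] syllable_val_closed[OF s2] syllable_closed[OF vA] syllable_closed[OF vB]
      define BA where "BA = B \<otimes>\<^bsub>factor v\<^esub> A"
      have BA: "BA \<in> carrier (factor v)" "embed v BA = embed v B \<odot> embed v A"
        using group.is_monoid[OF factor_group[OF v(1)]] B v(2) hom_mult[OF embed_hom[OF v(1)] B v(2)]
        by (auto simp: BA_def monoid.m_closed)
      have "syllable_val s0' = syllable_val s1 \<odot> (embed v B \<odot> syllable_val s2)"
        using s1 s2 vB by (simp add: s12 syllable_val_simps)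
      then have "syllable_val s = syllable_val s1 \<odot> (embed v B \<odot> (syllable_val s2 \<odot> embed v A))"
        using in_carrier by (simp add: val P.m_assoc)
      also have "\<dots> = syllable_val s1 \<odot> (embed v BA \<odot> syllable_val s2)"
        using in_carrier by (simp add: syllable_commute[OF v s2 s12(2)] BA P.m_assoc)
      finally have val': "syllable_val s = syllable_val s1 \<odot> (embed v BA \<odot> syllable_val s2)" .
      obtain s3 where s3: "s3 \<in> lists syllables" "syllable_val s3 = syllable_val s" "length s3 < length s"
      proof (cases "BA = \<one>\<^bsub>factor v\<^esub>")
        case True
        then have "embed v BA = \<one>\<^bsub>prod.P\<^esub>"
          using hom_one[OF embed_hom[OF v(1)] factor_group[OF v(1)] prod.group_P] by simp
        then have "syllable_val (s1 @ s2) = syllable_val s"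
          using val' in_carrier s1 s2 by (simp add: syllable_val_simps)
        with that[of "s1 @ s2"] s1 s2 s0'(3) show ?thesis by (simp add: s12 snoc)
      next
        case False
        then have BA_syl: "(v, BA) \<in> syllables" using BA(1) v(1) by (simp add: syllables_def)
        then have "syllable_val (s1 @ (v, BA) # s2) = syllable_val s"
          using val' s1 s2 by (simp add: syllable_val_simps)
        with that[of "s1 @ (v, BA) # s2"] s1 s2 BA_syl s0'(3) show ?thesis by (simp add: s12 snoc)
      qed
      with 1(1) obtain s' S where "reduced s' S" "syllable_val s' = syllable_val s3" "length s' \<le> length s3" by blast
      with s3 show ?thesis by (intro exI[of _ s'] exI[of _ S]) simp
    qed
  qed
qed

lemma word_class_syllable_val:
  "w \<in> group_words (Sigma V X) \<Longrightarrow> \<exists>s\<in>lists syllables. syllable_val s = prod.word_class w"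
proof (induction w)
  case Nil
  show ?case by (rule bexI[of _ "[]"]) (simp_all add: syllable_val_simps prod.one_P)
next
  case (Cons l w)
  interpret P: group prod.P by (rule prod.group_P)
  obtain v x b where l: "l = ((v, x), b)" by (metis surj_pair)
  have w: "w \<in> group_words (Sigma V X)" and v: "v \<in> V" and x: "[(x, b)] \<in> group_words (X v)"
    using Cons.prems by (auto simp: l)
  from Cons.IH w obtain s where s: "s \<in> lists syllables" "syllable_val s = prod.word_class w" by blast
  define A where "A = factor_class v [(x, b)]"
  have A: "A \<in> carrier (factor v)" "embed v A = prod.word_class [l]"
    unfolding A_def using factor_class_in[OF v x] embed_class[OF v x] by (simp_all add: l)
  have l_word: "[l] \<in> group_words (Sigma V X)" using Cons.prems by simp
  have prod: "prod.word_class (l # w) = embed v A \<odot> syllable_val s"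
    using prod.mult_P[OF l_word w] by (simp add: A s)
  show ?case
  proof (cases "A = \<one>\<^bsub>factor v\<^esub>")
    case True
    then have "embed v A = \<one>\<^bsub>prod.P\<^esub>"
      using hom_one[OF embed_hom[OF v] factor_group[OF v] prod.group_P] by simp
    then show ?thesis using s prod syllable_val_closed[OF s(1)] by auto
  next
    case False
    then have "(v, A) \<in> syllables" using A v by (simp add: syllables_def)
    then show ?thesis using s prod by (intro bexI[of _ "(v, A) # s"]) (simp_all add: syllable_val_simps)
  qed
qed

lemma reduced_path:
  assumes K: "\<And>v A. (v, A) \<in> syllables \<Longrightarrow> \<exists>x\<in>K v. x \<in> lists (carrier prod.P) \<and> word_val prod.P x = embed v A"
  shows "reduced s S \<Longrightarrow> \<exists>w\<in>lists (carrier prod.P). path_lang reduced_moves K {} w S \<and> word_val prod.P w = syllable_val s"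
proof (induction rule: reduced.induct)
  case Nil
  show ?case by (intro bexI[of _ "[]"]) (auto intro: path_lang.Nil simp: syllable_val_simps)
next
  case (Snoc s S v S' A)
  then obtain w where w: "w \<in> lists (carrier prod.P)" "path_lang reduced_moves K {} w S" "word_val prod.P w = syllable_val s"
    by blast
  from K[OF Snoc(3)] obtain x where x: "x \<in> K v" "x \<in> lists (carrier prod.P)" "word_val prod.P x = embed v A" by blast
  interpret P: group prod.P by (rule prod.group_P)
  have s: "s \<in> lists syllables" using reduced_syllables[OF Snoc(1)] by simp
  have "word_val prod.P (w @ x) = syllable_val (s @ [(v, A)])"
    using P.word_val_append[OF w(1) x(2)] s Snoc(3) syllable_closed[OF Snoc(3)] by (simp add: w x syllable_val_simps)
  moreover have "w @ x \<in> lists (carrier prod.P)" using w(1) x(2) by simp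
  ultimately show ?case
    by (intro bexI[of _ "w @ x"] conjI path_lang.Snoc[OF w(2) Snoc(2) x(1)])
qed

text \<open>
  The language consists of the words read along reduced vertex sequences that end in a nonempty set of
  exposed vertices; this excludes exactly the empty sequence.
\<close>

theorem epiC_graph_product:
  fixes G :: "'v \<Rightarrow> ('a, 'm) monoid_scheme"
  assumes iso: "\<And>v. v \<in> V \<Longrightarrow> G v \<cong> factor v" and epi: "\<And>v. v \<in> V \<Longrightarrow> epiC C (G v)"
  shows "epiC C (graph_product V E X R)"
proof -
  have "\<exists>A L. v \<in> V \<longrightarrow> group (G v) \<and> finite A \<and> A \<subseteq> carrier (G v) \<and> L \<in> languages C A \<and> L \<subseteq> lists A \<and> [] \<notin> L \<and>
     (\<forall>w\<in>L. word_val (G v) w \<noteq> \<one>\<^bsub>G v\<^esub>) \<and> (\<forall>h\<in>carrier (G v). h \<noteq> \<one>\<^bsub>G v\<^esub> \<longrightarrow> (\<exists>w\<in>L. word_val (G v) w = h))" for v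
  proof (cases "v \<in> V")
    case True
    show ?thesis
    proof (rule epiCE[OF epi[OF True]], goal_cases)
      case (1 A L)
      then show ?case by (intro exI[of _ A] exI[of _ L] impI conjI ballI) auto
    qed
  qed simp
  then obtain A L where "\<And>v. v \<in> V \<Longrightarrow> group (G v) \<and> finite (A v) \<and> A v \<subseteq> carrier (G v) \<and> L v \<in> languages C (A v) \<and>
     L v \<subseteq> lists (A v) \<and> [] \<notin> L v \<and> (\<forall>w\<in>L v. word_val (G v) w \<noteq> \<one>\<^bsub>G v\<^esub>) \<and>
     (\<forall>h\<in>carrier (G v). h \<noteq> \<one>\<^bsub>G v\<^esub> \<longrightarrow> (\<exists>w\<in>L v. word_val (G v) w = h))"
    by metis
  then have grp: "\<And>v. v \<in> V \<Longrightarrow> group (G v)" and A: "\<And>v. v \<in> V \<Longrightarrow> finite (A v) \<and> A v \<subseteq> carrier (G v)"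
    and L: "\<And>v. v \<in> V \<Longrightarrow> L v \<in> languages C (A v) \<and> L v \<subseteq> lists (A v) \<and> [] \<notin> L v"
    and nontriv: "\<And>v w. v \<in> V \<Longrightarrow> w \<in> L v \<Longrightarrow> word_val (G v) w \<noteq> \<one>\<^bsub>G v\<^esub>"
    and onto: "\<And>v h. v \<in> V \<Longrightarrow> h \<in> carrier (G v) \<Longrightarrow> h \<noteq> \<one>\<^bsub>G v\<^esub> \<Longrightarrow> \<exists>w\<in>L v. word_val (G v) w = h"
    by auto
  have "\<exists>\<phi>. v \<in> V \<longrightarrow> \<phi> \<in> iso (G v) (factor v)" for v
    using iso by (auto simp: is_iso_def)
  then obtain \<phi> where \<phi>: "\<And>v. v \<in> V \<Longrightarrow> \<phi> v \<in> Group.iso (G v) (factor v)" by metis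
  define \<psi> where "\<psi> v = embed v \<circ> \<phi> v" for v
  define Y where "Y = (\<Union>v\<in>V. \<psi> v ` A v)"
  define K where "K v = map (\<psi> v) ` L v" for v
  have \<psi>: "\<psi> v \<in> hom (G v) prod.P" if "v \<in> V" for v
    unfolding \<psi>_def using \<phi>[OF that] embed_hom[OF that] by (auto simp: iso_def intro: hom_compose)
  have \<phi>_hom: "\<phi> v \<in> hom (G v) (factor v)" and \<phi>_bij: "bij_betw (\<phi> v) (carrier (G v)) (carrier (factor v))" if "v \<in> V" for v
    using \<phi>[OF that] by (auto simp: iso_def)
  have \<phi>_one: "\<phi> v \<one>\<^bsub>G v\<^esub> = \<one>\<^bsub>factor v\<^esub>" if "v \<in> V" for v
    by (rule hom_one[OF \<phi>_hom[OF that] grp[OF that] factor_group[OF that]])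
  have Y: "finite Y" "Y \<subseteq> carrier prod.P"
  proof -
    show "finite Y" unfolding Y_def using finite_V A by (intro finite_UN_I finite_imageI) auto
    show "Y \<subseteq> carrier prod.P"
      unfolding Y_def
    proof (intro UN_least image_subsetI)
      fix v a assume "v \<in> V" "a \<in> A v"
      then show "\<psi> v a \<in> carrier prod.P" using A by (intro hom_in_carrier[OF \<psi>]) auto
    qed
  qed
  have lists: "w \<in> lists (carrier (G v))" if "v \<in> V" "w \<in> L v" for v w
    using L[OF that(1)] A[OF that(1)] that(2) by auto
  have val: "word_val prod.P (map (\<psi> v) w) = embed v (\<phi> v (word_val (G v) w))" if "v \<in> V" "w \<in> L v" for v w
    using word_val_hom[OF grp[OF that(1)] prod.group_P \<psi>[OF that(1)] lists[OF that]] by (simp add: \<psi>_def)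
  have map_lists: "map (\<psi> v) w \<in> lists (carrier prod.P)" if "v \<in> V" "w \<in> L v" for v w
    by (rule map_in_lists[OF hom_carrier[OF \<psi>[OF that(1)]] lists[OF that]])
  have K_sound: "x \<in> lists (carrier prod.P) \<and>
      (\<exists>B\<in>carrier (factor v). B \<noteq> \<one>\<^bsub>factor v\<^esub> \<and> word_val prod.P x = embed v B)" if v: "v \<in> V" and x: "x \<in> K v" for v x
  proof -
    from x obtain w where w: "w \<in> L v" "x = map (\<psi> v) w" by (auto simp: K_def)
    have c: "word_val (G v) w \<in> carrier (G v)" "\<one>\<^bsub>G v\<^esub> \<in> carrier (G v)"
      using group.word_val_closed[OF grp[OF v] lists[OF v w(1)]] group.is_monoid[OF grp[OF v]] by (auto simp: monoid.one_closed)
    have "\<phi> v (word_val (G v) w) \<noteq> \<phi> v \<one>\<^bsub>G v\<^esub>"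
      using nontriv[OF v w(1)] inj_onD[OF bij_betw_imp_inj_on[OF \<phi>_bij[OF v]] _ c] by (intro notI) simp
    then show ?thesis
      using map_lists[OF v w(1)] val[OF v w(1)] hom_in_carrier[OF \<phi>_hom[OF v] c(1)] by (auto simp: w(2) \<phi>_one[OF v])
  qed
  have K_onto: "\<exists>x\<in>K v. x \<in> lists (carrier prod.P) \<and> word_val prod.P x = embed v B" if "(v, B) \<in> syllables" for v B
  proof -
    have v: "v \<in> V" and B: "B \<in> carrier (factor v)" "B \<noteq> \<one>\<^bsub>factor v\<^esub>" using that by (auto simp: syllables_def)
    have "B \<in> \<phi> v ` carrier (G v)" using B(1) bij_betw_imp_surj_on[OF \<phi>_bij[OF v]] by simp
    then obtain h where h: "h \<in> carrier (G v)" "\<phi> v h = B" by auto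
    then have "h \<noteq> \<one>\<^bsub>G v\<^esub>" using B(2) \<phi>_one[OF v] by auto
    with onto[OF v h(1)] obtain w where w: "w \<in> L v" "word_val (G v) w = h" by blast
    show ?thesis
      using map_lists[OF v w(1)] val[OF v w(1)] w h by (intro bexI[of _ "map (\<psi> v) w"]) (auto simp: K_def)
  qed
  have "subst_lang reduced_moves (\<lambda>v. map (\<psi> v) ` L v) {} (Pow V - {{}}) \<in> languages C Y"
  proof (rule languages_subst[OF finite_reduced_moves Y(1)])
    fix S v S' assume "(S, v, S') \<in> reduced_moves"
    then have v: "v \<in> V" by (auto simp: reduced_moves_def)
    show "L v \<in> languages C (A v) \<and> finite (A v) \<and> [] \<notin> L v" using L[OF v] A[OF v] by blast
    show "\<psi> v ` A v \<subseteq> Y" using v by (auto simp: Y_def)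
  qed
  moreover have "K = (\<lambda>v. map (\<psi> v) ` L v)" by (intro ext) (rule K_def)
  ultimately have lang: "subst_lang reduced_moves K {} (Pow V - {{}}) \<in> languages C Y" by (simp only:)
  show ?thesis
    unfolding graph_product_eq
  proof (rule epiCI[OF prod.group_P Y lang])
    fix w assume "w \<in> subst_lang reduced_moves K {} (Pow V - {{}})"
    then obtain S where S: "S \<noteq> {}" "path_lang reduced_moves K {} w S" by (auto simp: subst_lang_def)
    show "word_val prod.P w \<noteq> \<one>\<^bsub>prod.P\<^esub>"
      by (rule reduced_word_nontrivial[OF K_sound S(2,1)])
  next
    fix h assume h: "h \<in> carrier prod.P" "h \<noteq> \<one>\<^bsub>prod.P\<^esub>"
    obtain u where u: "h = prod.word_class u" "u \<in> group_words (Sigma V X)" using h(1) by (auto simp: prod.carrier_P)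
    from word_class_syllable_val[OF u(2)] obtain s0 where s0: "s0 \<in> lists syllables" "syllable_val s0 = h"
      unfolding u(1) by (elim bexE)
    from reduced_form[OF s0(1)] obtain s S where s: "reduced s S" "syllable_val s = h"
      unfolding s0(2) by (elim exE conjE)
    have "S \<noteq> {}"
    proof
      assume "S = {}"
      with s(1) have "s = []" by cases (auto simp: reduced_moves_def)
      with s(2) h(2) show False by (simp add: syllable_val_simps)
    qed
    moreover have "S \<subseteq> V" using reduced_syllables[OF s(1)] by simp
    moreover have "\<exists>w\<in>lists (carrier prod.P). path_lang reduced_moves K {} w S \<and> word_val prod.P w = syllable_val s"
      by (rule reduced_path[OF _ s(1)]) (rule K_onto)
    ultimately show "\<exists>w\<in>subst_lang reduced_moves K {} (Pow V - {{}}). word_val prod.P w = h"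
      using s(2) by (auto simp: subst_lang_def)
  qed
qed

end

theorem theoremC:
  fixes C :: chomsky
  shows "(\<forall>(V :: 'v set) E (G :: 'v \<Rightarrow> ('a, 'm) monoid_scheme) (X :: 'v \<Rightarrow> 'x set) R.
            finite_simple_graph V E \<longrightarrow>
            (\<forall>v\<in>V. R v \<subseteq> group_words (X v) \<and> G v \<cong> presented_group (X v) (R v) \<and> epiC C (G v)) \<longrightarrow>
            epiC C (graph_product V E X R))
       \<and> (\<forall>(E :: ('e, 'n) monoid_scheme) N.
            N \<lhd> E \<longrightarrow> epiC C (E\<lparr>carrier := N\<rparr>) \<longrightarrow> epiC C (E Mod N) \<longrightarrow> epiC C E)"
proof (intro conjI allI impI)
  fix V :: "'v set" and E and G :: "'v \<Rightarrow> ('a, 'm) monoid_scheme" and X :: "'v \<Rightarrow> 'x set" and R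
  assume "finite_simple_graph V E"
    and *: "\<forall>v\<in>V. R v \<subseteq> group_words (X v) \<and> G v \<cong> presented_group (X v) (R v) \<and> epiC C (G v)"
  then interpret graph_of_presentations V E X R by unfold_locales auto
  show "epiC C (graph_product V E X R)" by (rule epiC_graph_product) (use * in auto)
next
  fix E :: "('e, 'n) monoid_scheme" and N
  assume "N \<lhd> E" "epiC C (E\<lparr>carrier := N\<rparr>)" "epiC C (E Mod N)"
  then show "epiC C E" by (rule epiC_extension)
qed

end
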